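(* Let $N$ and $m$ tend to infinity (along a sequence of pairs of dimensions) in such a way that $$\min\{N,m\}\to\infty,\qquad 0<\underline{c}\le\frac{N}{m}\le\overline{c}<\infty .$$ Let $Z$ be an $N\times m$ matrix with independent standard normal entries, and let $\sigma>0$ be deterministic. For deterministic vectors $a\in\mathbb{R}^N$ and $b\in\mathbb{R}^m$, define $M(a,b):=ab^{\top}+\sigma Z$, let $\hat u(a,b)$ be the unit leading left singular vector of $M(a,b)$ chosen by the selection rule given in the context, and define $\hat P(a,b):=I_N-\hat u(a,b)\hat u(a,b)^{\top}$. Then, for every fixed $\varepsilon>0$, $$\sup_{a\in\mathbb{R}^N,\ b\in\mathbb{R}^m}\mathbb{P}\left\{\left\|\hat P(a,b)\,ab^{\top}\right\|_{\mathrm F}^2>(1+\varepsilon)\,\sigma^2\max\{N,\sqrt{Nm}\}\right\}\to0.$$ Moreover, suppose that $N/m\to c\in(0,\infty)$. For every fixed $\varepsilon\in(0,1)$, there exist deterministic sequences $a_{N,m}\in\mathbb{R}^N$ and $b_{N,m}\in\mathbb{R}^m$ such that $$\mathbb{P}\left\{\left\|\hat P(a_{N,m},b_{N,m})\,a_{N,m}b_{N,m}^{\top}\right\|_{\mathrm F}^2>(1-\varepsilon)\,\sigma^2\max\{N,\sqrt{Nm}\}\right\}\to1.$$ Consequently, the factor $1+\varepsilon$ in the first display cannot be replaced by a fixed number smaller than one.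
   Context: $\|\cdot\|_{\mathrm F}$ denotes the Frobenius norm. Selection rule for the leading left singular vector of an $N\times m$ matrix $B$: project the coordinate vectors $e_1,e_2,\dots$ of $\mathbb{R}^N$ in order orthogonally onto the leading left singular subspace of $B$ (the eigenspace of $BB^\top$ for its largest eigenvalue), take the first nonzero projection, and normalize it. This rule is Borel measurable in $B$ and is unchanged when $B$ is multiplied by a positive number. *)

theory Defs
  imports "Jordan_Normal_Form.Char_Poly" "HOL-Probability.Probability"
begin

(* HOL-Analysis and Jordan_Normal_Form both provide a type vec; the dimensions here are
   natural-number parameters, so vectors and matrices are those of Jordan_Normal_Form. *)
type_synonym rvec = "real Matrix.vec"
type_synonym rmat = "real Matrix.mat"

definition vec_norm2 :: "rvec \<Rightarrow> real" where
  "vec_norm2 v = sqrt (v \<bullet> v)"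

definition frobenius_norm :: "rmat \<Rightarrow> real" where
  "frobenius_norm A = sqrt (\<Sum>i<dim_row A. \<Sum>j<dim_col A. (A $$ (i, j))\<^sup>2)"

definition outer_prod :: "rvec \<Rightarrow> rvec \<Rightarrow> rmat" where
  "outer_prod a b = Matrix.mat (dim_vec a) (dim_vec b) (\<lambda>(i, j). vec_index a i * vec_index b j)"

definition orth_proj :: "rvec set \<Rightarrow> rvec \<Rightarrow> rvec" where
  "orth_proj V x = (THE p. p \<in> V \<and> (\<forall>w\<in>V. (x - p) \<bullet> w = 0))"

definition leading_left_singular_space :: "rmat \<Rightarrow> rvec set" where
  "leading_left_singular_space B =
     (let A = B * transpose_mat B; l = Max {l. eigenvalue A l}
      in {v \<in> carrier_vec (dim_row B). A *\<^sub>v v = l \<cdot>\<^sub>v v})"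

(* The coordinate vectors are numbered from 0. *)
definition leading_left_singular_vec :: "rmat \<Rightarrow> rvec" where
  "leading_left_singular_vec B =
     (let n = dim_row B;
          p = (\<lambda>i. orth_proj (leading_left_singular_space B) (unit_vec n i));
          i = (LEAST i. i < n \<and> p i \<noteq> 0\<^sub>v n)
      in (1 / vec_norm2 (p i)) \<cdot>\<^sub>v p i)"

definition spiked_mat :: "real \<Rightarrow> rmat \<Rightarrow> rvec \<Rightarrow> rvec \<Rightarrow> rmat" where
  "spiked_mat \<sigma> Z a b = outer_prod a b + \<sigma> \<cdot>\<^sub>m Z"

definition u_hat :: "real \<Rightarrow> rmat \<Rightarrow> rvec \<Rightarrow> rvec \<Rightarrow> rvec" where
  "u_hat \<sigma> Z a b = leading_left_singular_vec (spiked_mat \<sigma> Z a b)"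

definition P_hat :: "real \<Rightarrow> rmat \<Rightarrow> rvec \<Rightarrow> rvec \<Rightarrow> rmat" where
  "P_hat \<sigma> Z a b =
     1\<^sub>m (dim_vec a) - outer_prod (u_hat \<sigma> Z a b) (u_hat \<sigma> Z a b)"

definition std_gaussian_matrix :: "'w measure \<Rightarrow> nat \<Rightarrow> nat \<Rightarrow> ('w \<Rightarrow> rmat) \<Rightarrow> bool" where
  "std_gaussian_matrix M n m Z \<longleftrightarrow>
     prob_space M \<and>
     (\<forall>\<omega>\<in>space M. Z \<omega> \<in> carrier_mat n m) \<and>
     prob_space.indep_vars M (\<lambda>_. borel) (\<lambda>(i, j) \<omega>. Z \<omega> $$ (i, j)) ({..<n} \<times> {..<m}) \<and>
     (\<forall>i<n. \<forall>j<m. distributed M lborel (\<lambda>\<omega>. Z \<omega> $$ (i, j)) (\<lambda>x. ennreal (std_normal_density x)))"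

definition exceed_prob ::
  "'w measure \<Rightarrow> nat \<Rightarrow> nat \<Rightarrow> real \<Rightarrow> ('w \<Rightarrow> rmat) \<Rightarrow> real \<Rightarrow> rvec \<Rightarrow> rvec \<Rightarrow> real" where
  "exceed_prob M n m \<sigma> Z q a b =
     \<P>(\<omega> in M. (frobenius_norm (P_hat \<sigma> (Z \<omega>) a b * outer_prod a b))\<^sup>2
                > q * \<sigma>\<^sup>2 * max (real n) (sqrt (real n * real m)))"

end

theory Submission
  imports Defs
begin

text \<open>
  Write \<open>a b\<^sup>T = \<sigma> s x y\<^sup>T\<close> with unit vectors \<open>x, y\<close>; the loss is \<open>\<sigma>\<^sup>2 s\<^sup>2 (1 - (u \<bullet> x)\<^sup>2)\<close> for a unit
  maximiser \<open>u\<close> of \<open>u \<mapsto> |X\<^sup>T u|\<close>, where \<open>X = s x y\<^sup>T + Z\<close>. Rotating rows and columns alternately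
  (Golub-Kahan bidiagonalisation, starting from \<open>x\<close>) turns \<open>X\<close> into a lower bidiagonal matrix whose
  diagonal entries are, up to a factor close to \<open>1\<close>, at most \<open>\<surd>m\<close>, except for the first one \<open>S\<close> with
  \<open>S\<^sup>2 \<approx> s\<^sup>2 + m\<close>, and whose subdiagonal entries are at most \<open>\<surd>N\<close>; a bounded number of them are
  also bounded below in this way. For a unit vector \<open>u\<close> with \<open>\<kappa>\<^sup>2 = 1 - (u \<bullet> x)\<^sup>2\<close> the triangle
  inequality gives \<open>|X\<^sup>T u| \<le> \<surd>(S\<^sup>2 - (S\<^sup>2 - m) \<kappa>\<^sup>2) + \<surd>N \<kappa>\<close>, and a geometric test vector shows that the
  maximum of the right-hand side over \<open>\<kappa>\<close> is almost attained by \<open>|X\<^sup>T u|\<close> as soon as \<open>s\<^sup>2 \<ge> \<tau> \<surd>(N m)\<close> with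
  \<open>\<tau> > 1\<close>. Hence \<open>\<kappa>\<close> is close to the maximising one and \<open>s\<^sup>2 \<kappa>\<^sup>2 \<approx> N (s\<^sup>2 + m) / (s\<^sup>2 + N)\<close>, uniformly in
  \<open>s\<close>. The supremum of this function over \<open>s\<^sup>2 \<ge> \<surd>(N m)\<close> is \<open>max N (\<surd>(N m))\<close>; below the threshold the
  trivial bound \<open>s\<^sup>2\<close> on the loss suffices.
\<close>

section \<open>Rotation invariance of Gaussian vectors\<close>

text \<open>The supremum over all spikes rules out limit theorems for one fixed spike, so every
  estimate is non-asymptotic and depends on the spike only through \<open>s\<close>. The upper
  bounds involve about N steps, hence a union bound with exponentially small tails; the lower bounds
  involve a fixed number of steps, because the test vector decays like (\<surd>(N m) / s^2)^i. This
  is where the threshold \<surd>(N m) enters; above it the bound for |X^T u| has maximal square (s^2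
  + N) (s^2 + m) / s^2. Measurability is the other obstacle. From above, it suffices to enclose the
  exceedance set in a small measurable set; from below, the exceedance event itself must be
  measurable. The worst-case spikes therefore have \<open>a\<close> along the first coordinate axis,
  where the selection rule turns the loss into a condition on the set of all maximisers.\<close>

definition gauss :: "real measure" where
  "gauss = density lborel (\<lambda>x. ennreal (std_normal_density x))"

lemma sets_gauss [simp, measurable_cong]: "sets gauss = sets borel"
  by (simp add: gauss_def)

lemma space_gauss [simp]: "space gauss = UNIV"
  by (simp add: gauss_def)

lemma prob_space_gauss: "prob_space gauss"
  unfolding gauss_def by (rule prob_space_normal_density) simp

interpretation gauss: prob_space gauss
  by (rule prob_space_gauss)

interpretation gauss_product: product_sigma_finite "\<lambda>_::'i. gauss"
  by unfold_locales

abbreviation gauss_space :: "'i set \<Rightarrow> ('i \<Rightarrow> real) measure" where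
  "gauss_space K \<equiv> PiM K (\<lambda>_. gauss)"

abbreviation gauss_event :: "'i set \<Rightarrow> (('i \<Rightarrow> real) \<Rightarrow> bool) \<Rightarrow> ('i \<Rightarrow> real) set" where
  "gauss_event K Q \<equiv> {z \<in> space (gauss_space K). Q z}"

abbreviation gauss_prob :: "'i set \<Rightarrow> (('i \<Rightarrow> real) \<Rightarrow> bool) \<Rightarrow> ennreal" where
  "gauss_prob K Q \<equiv> emeasure (gauss_space K) (gauss_event K Q)"

lemma prob_space_gauss_space: "prob_space (gauss_space K)"
  by (rule prob_space_PiM) (rule prob_space_gauss)

lemma nn_integral_gauss:
  assumes [measurable]: "f \<in> borel_measurable borel"
  shows "(\<integral>\<^sup>+x. f x \<partial>gauss) = (\<integral>\<^sup>+x. ennreal (std_normal_density x) * f x \<partial>lborel)"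
  unfolding gauss_def by (subst nn_integral_density) auto

text \<open>For \<open>c\<close> nonzero the rotation splits into two affine substitutions in one
  variable each, with factors \<open>1 / c\<close> and \<open>c\<close> that cancel. For
  \<open>c = 0\<close> it is an exchange of the variables with signs, which is Fubini and
  reflections.\<close>

lemma nn_integral_lborel_rotate:
  fixes F :: "real \<Rightarrow> real \<Rightarrow> ennreal"
  assumes [measurable]: "case_prod F \<in> borel_measurable (borel \<Otimes>\<^sub>M borel)" and cs: "c\<^sup>2 + s\<^sup>2 = 1"
  shows "(\<integral>\<^sup>+x. \<integral>\<^sup>+y. F (c * x + s * y) (c * y - s * x) \<partial>lborel \<partial>lborel) =
    (\<integral>\<^sup>+x. \<integral>\<^sup>+y. F x y \<partial>lborel \<partial>lborel)"
proof (cases "c = 0")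
  case True
  then have s: "\<bar>s\<bar> = 1" "s \<noteq> 0"
    using cs by (auto simp: power2_eq_1_iff)
  have "(\<integral>\<^sup>+x. \<integral>\<^sup>+y. F x y \<partial>lborel \<partial>lborel) = (\<integral>\<^sup>+y. \<integral>\<^sup>+x. F x y \<partial>lborel \<partial>lborel)"
    by (rule lborel_pair.Fubini'[symmetric]) simp
  also have "\<dots> = (\<integral>\<^sup>+y. \<integral>\<^sup>+x. F (s * x) y \<partial>lborel \<partial>lborel)"
  proof (rule nn_integral_cong)
    fix y
    show "(\<integral>\<^sup>+x. F x y \<partial>lborel) = (\<integral>\<^sup>+x. F (s * x) y \<partial>lborel)"
      using nn_integral_real_affine[of "\<lambda>x. F x y" s 0] s by simp
  qed
  also have "\<dots> = (\<integral>\<^sup>+y. \<integral>\<^sup>+x. F (s * x) (- s * y) \<partial>lborel \<partial>lborel)"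
    using nn_integral_real_affine[of "\<lambda>y. \<integral>\<^sup>+x. F (s * x) y \<partial>lborel" "- s" 0] s by simp
  finally show ?thesis
    using True by simp
next
  case False
  have eq: "c * y - s * ((x - s * y) / c) = (y - s * x) / c" for x y
  proof -
    have "c * y - s * ((x - s * y) / c) = ((c\<^sup>2 + s\<^sup>2) * y - s * x) / c"
      using False by (simp add: field_simps power2_eq_square)
    then show ?thesis using cs by simp
  qed
  have "(\<integral>\<^sup>+x. \<integral>\<^sup>+y. F (c * x + s * y) (c * y - s * x) \<partial>lborel \<partial>lborel)
      = (\<integral>\<^sup>+y. \<integral>\<^sup>+x. F (c * x + s * y) (c * y - s * x) \<partial>lborel \<partial>lborel)"
    by (rule lborel_pair.Fubini'[symmetric]) simp
  also have "\<dots> = (\<integral>\<^sup>+y. ennreal \<bar>1 / c\<bar> * (\<integral>\<^sup>+x. F x ((y - s * x) / c) \<partial>lborel) \<partial>lborel)"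
  proof (rule nn_integral_cong)
    fix y
    have "(\<integral>\<^sup>+x. F (c * x + s * y) (c * y - s * x) \<partial>lborel)
      = ennreal \<bar>1 / c\<bar> * (\<integral>\<^sup>+x. F (c * (- (s * y) / c + 1 / c * x) + s * y) (c * y - s * (- (s * y) / c + 1 / c * x)) \<partial>lborel)"
      by (subst nn_integral_real_affine[of _ "1 / c" "- (s * y) / c"]) (use False in auto)
    also have "(\<integral>\<^sup>+x. F (c * (- (s * y) / c + 1 / c * x) + s * y) (c * y - s * (- (s * y) / c + 1 / c * x)) \<partial>lborel)
      = (\<integral>\<^sup>+x. F x ((y - s * x) / c) \<partial>lborel)"
    proof (intro nn_integral_cong arg_cong2[where f = F])
      fix x
      show "c * (- (s * y) / c + 1 / c * x) + s * y = x"
        using False by (simp add: field_simps)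
      have "- (s * y) / c + 1 / c * x = (x - s * y) / c"
        using False by (simp add: field_simps)
      then show "c * y - s * (- (s * y) / c + 1 / c * x) = (y - s * x) / c"
        by (simp only: eq)
    qed
    finally show "(\<integral>\<^sup>+x. F (c * x + s * y) (c * y - s * x) \<partial>lborel)
      = ennreal \<bar>1 / c\<bar> * (\<integral>\<^sup>+x. F x ((y - s * x) / c) \<partial>lborel)" .
  qed
  also have "\<dots> = ennreal \<bar>1 / c\<bar> * (\<integral>\<^sup>+y. \<integral>\<^sup>+x. F x ((y - s * x) / c) \<partial>lborel \<partial>lborel)"
    by (rule nn_integral_cmult) simp
  also have "(\<integral>\<^sup>+y. \<integral>\<^sup>+x. F x ((y - s * x) / c) \<partial>lborel \<partial>lborel) = (\<integral>\<^sup>+x. \<integral>\<^sup>+y. F x ((y - s * x) / c) \<partial>lborel \<partial>lborel)"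
    by (rule lborel_pair.Fubini') simp
  also have "\<dots> = (\<integral>\<^sup>+x. ennreal \<bar>c\<bar> * (\<integral>\<^sup>+y. F x y \<partial>lborel) \<partial>lborel)"
  proof (rule nn_integral_cong)
    fix x
    show "(\<integral>\<^sup>+y. F x ((y - s * x) / c) \<partial>lborel) = ennreal \<bar>c\<bar> * (\<integral>\<^sup>+y. F x y \<partial>lborel)"
      by (subst nn_integral_real_affine[of _ c "s * x"]) (use False in auto)
  qed
  also have "\<dots> = ennreal \<bar>c\<bar> * (\<integral>\<^sup>+x. \<integral>\<^sup>+y. F x y \<partial>lborel \<partial>lborel)"
    by (rule nn_integral_cmult) simp
  also have "ennreal \<bar>1 / c\<bar> * (ennreal \<bar>c\<bar> * (\<integral>\<^sup>+x. \<integral>\<^sup>+y. F x y \<partial>lborel \<partial>lborel)) = (\<integral>\<^sup>+x. \<integral>\<^sup>+y. F x y \<partial>lborel \<partial>lborel)"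
    using False by (simp add: mult.assoc[symmetric] ennreal_mult'[symmetric])
  finally show ?thesis .
qed

lemma std_normal_density_rotate:
  assumes "c\<^sup>2 + s\<^sup>2 = (1::real)"
  shows "std_normal_density (c * x + s * y) * std_normal_density (c * y - s * x) = std_normal_density x * std_normal_density y"
proof -
  have "(c * x + s * y)\<^sup>2 + (c * y - s * x)\<^sup>2 = (c\<^sup>2 + s\<^sup>2) * (x\<^sup>2 + y\<^sup>2)"
    by (simp add: power2_eq_square algebra_simps)
  then have *: "(c * x + s * y)\<^sup>2 + (c * y - s * x)\<^sup>2 = x\<^sup>2 + y\<^sup>2"
    using assms by simp
  have "std_normal_density (c * x + s * y) * std_normal_density (c * y - s * x)
    = 1 / (2 * pi) * exp (- ((c * x + s * y)\<^sup>2 + (c * y - s * x)\<^sup>2) / 2)"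
    by (simp add: std_normal_density_def exp_add[symmetric] add_divide_distrib)
  also have "\<dots> = std_normal_density x * std_normal_density y"
    unfolding * by (simp add: std_normal_density_def exp_add[symmetric] add_divide_distrib)
  finally show ?thesis .
qed

lemma nn_integral_gauss_rotate:
  fixes f :: "real \<Rightarrow> real \<Rightarrow> ennreal"
  assumes [measurable]: "case_prod f \<in> borel_measurable (borel \<Otimes>\<^sub>M borel)" and cs: "c\<^sup>2 + s\<^sup>2 = 1"
  shows "(\<integral>\<^sup>+x. \<integral>\<^sup>+y. f (c * x + s * y) (c * y - s * x) \<partial>gauss \<partial>gauss) =
    (\<integral>\<^sup>+x. \<integral>\<^sup>+y. f x y \<partial>gauss \<partial>gauss)"
proof -
  define F where "F = (\<lambda>x y. ennreal (std_normal_density x * std_normal_density y) * f x y)"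
  have [measurable]: "case_prod F \<in> borel_measurable (borel \<Otimes>\<^sub>M borel)"
    unfolding F_def by measurable
  have eq: "(\<integral>\<^sup>+x. \<integral>\<^sup>+y. g x y \<partial>gauss \<partial>gauss) =
     (\<integral>\<^sup>+x. \<integral>\<^sup>+y. ennreal (std_normal_density x * std_normal_density y) * g x y \<partial>lborel \<partial>lborel)"
    if [measurable]: "case_prod g \<in> borel_measurable (borel \<Otimes>\<^sub>M borel)" for g :: "real \<Rightarrow> real \<Rightarrow> ennreal"
    by (simp add: nn_integral_gauss nn_integral_cmult[symmetric] ennreal_mult mult.assoc)
  have "(\<integral>\<^sup>+x. \<integral>\<^sup>+y. f (c * x + s * y) (c * y - s * x) \<partial>gauss \<partial>gauss) =
     (\<integral>\<^sup>+x. \<integral>\<^sup>+y. F (c * x + s * y) (c * y - s * x) \<partial>lborel \<partial>lborel)"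
    unfolding F_def std_normal_density_rotate[OF cs] by (rule eq) measurable
  also have "\<dots> = (\<integral>\<^sup>+x. \<integral>\<^sup>+y. F x y \<partial>lborel \<partial>lborel)"
    by (rule nn_integral_lborel_rotate) (use cs in auto)
  also have "\<dots> = (\<integral>\<^sup>+x. \<integral>\<^sup>+y. f x y \<partial>gauss \<partial>gauss)"
    unfolding F_def by (rule eq[symmetric]) measurable
  finally show ?thesis .
qed


section \<open>Rotations in a coordinate plane\<close>

definition plane_rot :: "'i \<Rightarrow> 'i \<Rightarrow> real \<Rightarrow> real \<Rightarrow> ('i \<Rightarrow> real) \<Rightarrow> 'i \<Rightarrow> real" where
  "plane_rot p q c s z = z(p := c * z p + s * z q, q := c * z q - s * z p)"

lemma plane_rot_measurable [measurable]:
  assumes "p \<in> K" "q \<in> K"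
  shows "plane_rot p q c s \<in> measurable (gauss_space K) (gauss_space K)"
proof (rule measurable_PiM_single')
  show "(\<lambda>z. plane_rot p q c s z i) \<in> measurable (gauss_space K) gauss" if "i \<in> K" for i
    unfolding plane_rot_def using assms that by (cases "i = q"; cases "i = p") simp_all
  show "plane_rot p q c s \<in> space (gauss_space K) \<rightarrow> (\<Pi>\<^sub>E i\<in>K. space gauss)"
    using assms by (auto simp: plane_rot_def space_PiM PiE_def extensional_def)
qed

lemma nn_integral_plane_rot:
  assumes K: "finite K" "p \<in> K" "q \<in> K" "p \<noteq> q" and cs: "c\<^sup>2 + s\<^sup>2 = 1"
    and f [measurable]: "f \<in> borel_measurable (gauss_space K)"
  shows "(\<integral>\<^sup>+z. f (plane_rot p q c s z) \<partial>gauss_space K) = (\<integral>\<^sup>+z. f z \<partial>gauss_space K)"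
proof -
  define K' where "K' = K - {p, q}"
  have K_eq: "K = insert p (insert q K')" and K': "finite K'" "q \<notin> K'" "p \<notin> insert q K'"
    using K by (auto simp: K'_def)
  have split: "(\<integral>\<^sup>+z. g z \<partial>gauss_space K) =
      (\<integral>\<^sup>+z. \<integral>\<^sup>+x. \<integral>\<^sup>+y. g (z(q := y, p := x)) \<partial>gauss \<partial>gauss \<partial>gauss_space K')"
    if g: "g \<in> borel_measurable (gauss_space K)" for g :: "_ \<Rightarrow> ennreal"
  proof -
    have [measurable]: "g \<in> borel_measurable (gauss_space (insert p (insert q K')))"
      using g K_eq by simp
    have "(\<integral>\<^sup>+z. g z \<partial>gauss_space K) =
       (\<integral>\<^sup>+z. \<integral>\<^sup>+x. g (z(p := x)) \<partial>gauss \<partial>gauss_space (insert q K'))"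
      unfolding K_eq by (rule gauss_product.product_nn_integral_insert) (use K' in auto)
    also have "\<dots> = (\<integral>\<^sup>+z. \<integral>\<^sup>+y. \<integral>\<^sup>+x. g (z(q := y, p := x)) \<partial>gauss \<partial>gauss \<partial>gauss_space K')"
      by (rule gauss_product.product_nn_integral_insert) (use K' in auto)
    also have "\<dots> = (\<integral>\<^sup>+z. \<integral>\<^sup>+x. \<integral>\<^sup>+y. g (z(q := y, p := x)) \<partial>gauss \<partial>gauss \<partial>gauss_space K')"
    proof (rule nn_integral_cong)
      fix z assume z [measurable]: "z \<in> space (gauss_space K')"
      show "(\<integral>\<^sup>+y. \<integral>\<^sup>+x. g (z(q := y, p := x)) \<partial>gauss \<partial>gauss) =
         (\<integral>\<^sup>+x. \<integral>\<^sup>+y. g (z(q := y, p := x)) \<partial>gauss \<partial>gauss)"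
        by (rule pair_sigma_finite.Fubini') (unfold_locales, measurable)
    qed
    finally show ?thesis .
  qed
  have [measurable]: "p \<in> K" "q \<in> K" by fact+
  have "(\<integral>\<^sup>+z. f (plane_rot p q c s z) \<partial>gauss_space K) =
     (\<integral>\<^sup>+z. \<integral>\<^sup>+x. \<integral>\<^sup>+y. f (plane_rot p q c s (z(q := y, p := x))) \<partial>gauss \<partial>gauss \<partial>gauss_space K')"
    by (rule split) measurable
  also have "\<dots> = (\<integral>\<^sup>+z. \<integral>\<^sup>+x. \<integral>\<^sup>+y. f (z(q := y, p := x)) \<partial>gauss \<partial>gauss \<partial>gauss_space K')"
  proof (rule nn_integral_cong)
    fix z assume z [measurable]: "z \<in> space (gauss_space K')"
    have *: "plane_rot p q c s (z(q := y, p := x)) = z(q := c * y - s * x, p := c * x + s * y)" for x y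
      using K by (auto simp: plane_rot_def fun_eq_iff)
    have [measurable]: "f \<in> borel_measurable (gauss_space (insert p (insert q K')))"
      using f K_eq by simp
    show "(\<integral>\<^sup>+x. \<integral>\<^sup>+y. f (plane_rot p q c s (z(q := y, p := x))) \<partial>gauss \<partial>gauss) =
      (\<integral>\<^sup>+x. \<integral>\<^sup>+y. f (z(q := y, p := x)) \<partial>gauss \<partial>gauss)"
      unfolding * by (rule nn_integral_gauss_rotate[of "\<lambda>x y. f (z(q := y, p := x))"]) (use cs in auto)
  qed
  also have "\<dots> = (\<integral>\<^sup>+z. f z \<partial>gauss_space K)"
    by (rule split[symmetric]) fact
  finally show ?thesis .
qed

definition row_rot :: "nat set \<Rightarrow> nat \<Rightarrow> nat \<Rightarrow> real \<Rightarrow> real \<Rightarrow> (nat \<times> nat \<Rightarrow> real) \<Rightarrow> nat \<times> nat \<Rightarrow> real" where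
  "row_rot J p q c s A = (\<lambda>(i, j). if j \<in> J then plane_rot p q c s (\<lambda>i. A (i, j)) i else A (i, j))"

text \<open>Rotating two rows means rotating the pair of entries in each column, one column at a
  time; hence the induction on the set \<open>J'\<close> of columns already treated inside the fixed
  space over \<open>I\<close> and \<open>J\<close>. Measurability is carried along because the
  integral step applies to the composite with the earlier rotations.\<close>

lemma row_rot_measurable_and_integral:
  assumes I: "finite I" "p \<in> I" "q \<in> I" "p \<noteq> q" and J: "finite J" and cs: "c\<^sup>2 + s\<^sup>2 = 1"
    and J': "finite J'" "J' \<subseteq> J"
    and f [measurable]: "f \<in> borel_measurable (gauss_space (I \<times> J))"
  shows "row_rot J' p q c s \<in> measurable (gauss_space (I \<times> J)) (gauss_space (I \<times> J)) \<and>
    (\<integral>\<^sup>+A. f (row_rot J' p q c s A) \<partial>gauss_space (I \<times> J)) = (\<integral>\<^sup>+A. f A \<partial>gauss_space (I \<times> J))"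
  using J'
proof (induction J' rule: finite_induct)
  case empty
  have "row_rot {} p q c s = (\<lambda>A. A)"
    by (auto simp: row_rot_def fun_eq_iff)
  then show ?case by simp
next
  case (insert j J')
  have j: "(p, j) \<in> I \<times> J" "(q, j) \<in> I \<times> J"
    using insert I by auto
  note [measurable] = plane_rot_measurable[OF j]
  have IH [measurable]: "row_rot J' p q c s \<in> measurable (gauss_space (I \<times> J)) (gauss_space (I \<times> J))"
    using insert by simp
  have eq: "row_rot (insert j J') p q c s A = row_rot J' p q c s (plane_rot (p, j) (q, j) c s A)" for A
    using insert(2) I(4) by (auto simp: row_rot_def plane_rot_def fun_eq_iff)
  have "(\<integral>\<^sup>+A. f (row_rot J' p q c s (plane_rot (p, j) (q, j) c s A)) \<partial>gauss_space (I \<times> J)) =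
    (\<integral>\<^sup>+A. f (row_rot J' p q c s A) \<partial>gauss_space (I \<times> J))"
    by (rule nn_integral_plane_rot) (use j I J cs in \<open>auto\<close>)
  moreover have "(\<lambda>A. row_rot J' p q c s (plane_rot (p, j) (q, j) c s A)) \<in> measurable (gauss_space (I \<times> J)) (gauss_space (I \<times> J))"
    by measurable
  ultimately show ?case
    using insert by (simp add: eq)
qed

section \<open>Gaussian matrices: symmetries, conditioning and tails\<close>

definition ip :: "'i set \<Rightarrow> ('i \<Rightarrow> real) \<Rightarrow> ('i \<Rightarrow> real) \<Rightarrow> real" where
  "ip I f g = (\<Sum>i\<in>I. f i * g i)"

definition nsq :: "'i set \<Rightarrow> ('i \<Rightarrow> real) \<Rightarrow> real" where
  "nsq I f = (\<Sum>i\<in>I. (f i)\<^sup>2)"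

text \<open>A matrix is a function on pairs of indices and \<open>tm I A u\<close> is \<open>A\<^sup>T u\<close>. The dimensions are
  finite index sets rather than numbers, so that a row or a column is removed without renumbering.\<close>

definition tm :: "nat set \<Rightarrow> (nat \<times> nat \<Rightarrow> real) \<Rightarrow> (nat \<Rightarrow> real) \<Rightarrow> nat \<Rightarrow> real" where
  "tm I A u j = (\<Sum>i\<in>I. A (i, j) * u i)"

lemma nsq_eq_ip: "nsq I f = ip I f f"
  by (simp add: nsq_def ip_def power2_eq_square)

lemma tm_eq_ip: "tm I A u j = ip I (\<lambda>i. A (i, j)) u"
  by (simp add: tm_def ip_def)

lemma nsq_nonneg [simp]: "0 \<le> nsq I f"
  by (simp add: nsq_def sum_nonneg)

lemma ip_cong: "I = I' \<Longrightarrow> (\<And>i. i \<in> I' \<Longrightarrow> f i = f' i) \<Longrightarrow> (\<And>i. i \<in> I' \<Longrightarrow> g i = g' i) \<Longrightarrow> ip I f g = ip I' f' g'"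
  by (simp add: ip_def)

lemma nsq_cong: "I = I' \<Longrightarrow> (\<And>i. i \<in> I' \<Longrightarrow> f i = f' i) \<Longrightarrow> nsq I f = nsq I' f'"
  by (simp add: nsq_def)

lemma tm_cong: "I = I' \<Longrightarrow> (\<And>i. i \<in> I' \<Longrightarrow> A (i, j) = A' (i, j)) \<Longrightarrow> (\<And>i. i \<in> I' \<Longrightarrow> u i = u' i) \<Longrightarrow> tm I A u j = tm I' A' u' j"
  by (simp add: tm_def)

lemma nsq_insert: "finite J' \<Longrightarrow> j0 \<notin> J' \<Longrightarrow> nsq (insert j0 J') f = (f j0)\<^sup>2 + nsq J' f"
  by (simp add: nsq_def)

lemma ip_insert: "finite J' \<Longrightarrow> j0 \<notin> J' \<Longrightarrow> ip (insert j0 J') f g = f j0 * g j0 + ip J' f g"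
  by (simp add: ip_def)

lemma nsq_add: "nsq J (\<lambda>j. a * f j + b * g j) = a\<^sup>2 * nsq J f + 2 * a * b * ip J f g + b\<^sup>2 * nsq J g"
  by (simp add: nsq_def ip_def sum_distrib_left sum.distrib[symmetric] power2_eq_square algebra_simps)

lemma nsq_add_smult: "nsq J (\<lambda>j. f j + t * g j) = nsq J f + 2 * t * ip J f g + t\<^sup>2 * nsq J g"
  using nsq_add[of J 1 f t g] by simp

lemma tm_add_smult: "tm I A (\<lambda>i. u i + t * w i) j = tm I A u j + t * tm I A w j"
  by (simp add: tm_def sum.distrib sum_distrib_left algebra_simps)

lemma nsq_scale: "nsq J (\<lambda>j. a * f j) = a\<^sup>2 * nsq J f"
  by (simp add: nsq_def power_mult_distrib sum_distrib_left)

lemma tm_scale: "tm I A (\<lambda>i. a * f i) = (\<lambda>j. a * tm I A f j)"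
  by (simp add: tm_def sum_distrib_left fun_eq_iff algebra_simps)

lemma ip_plane_rot:
  assumes I: "finite I" "p \<in> I" "q \<in> I" "p \<noteq> q" and cs: "c\<^sup>2 + s\<^sup>2 = 1"
  shows "ip I (plane_rot p q c s x) (plane_rot p q c s u) = ip I x u"
proof -
  define I' where "I' = I - {p, q}"
  have I_eq: "I = insert p (insert q I')" and I': "finite I'" "q \<notin> I'" "p \<notin> insert q I'"
    using I by (auto simp: I'_def)
  have "(c * x p + s * x q) * (c * u p + s * u q) + (c * x q - s * x p) * (c * u q - s * u p)
    = (c\<^sup>2 + s\<^sup>2) * (x p * u p + x q * u q)"
    by (simp add: power2_eq_square algebra_simps)
  moreover have "(\<Sum>i\<in>I'. plane_rot p q c s x i * plane_rot p q c s u i) = (\<Sum>i\<in>I'. x i * u i)"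
    by (intro sum.cong refl) (use I' in \<open>auto simp: plane_rot_def\<close>)
  ultimately show ?thesis
    using I' I(4) cs by (simp add: ip_def I_eq) (simp add: plane_rot_def)
qed

lemma nsq_plane_rot:
  assumes "finite I" "p \<in> I" "q \<in> I" "p \<noteq> q" "c\<^sup>2 + s\<^sup>2 = 1"
  shows "nsq I (plane_rot p q c s x) = nsq I x"
  using assms by (simp add: nsq_eq_ip ip_plane_rot)

lemma tm_row_rot:
  assumes "finite I" "p \<in> I" "q \<in> I" "p \<noteq> q" "c\<^sup>2 + s\<^sup>2 = 1" "j \<in> J"
  shows "tm I (row_rot J p q c s A) (plane_rot p q c s u) j = tm I A u j"
  using assms by (simp add: tm_eq_ip ip_plane_rot row_rot_def)

lemma plane_rot_inverse:
  assumes "p \<noteq> q" "c\<^sup>2 + s\<^sup>2 = 1"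
  shows "plane_rot p q c (- s) (plane_rot p q c s x) = x"
proof -
  have "c * (c * x p + s * x q) - s * (c * x q - s * x p) = (c\<^sup>2 + s\<^sup>2) * x p"
    "c * (c * x q - s * x p) + s * (c * x p + s * x q) = (c\<^sup>2 + s\<^sup>2) * x q"
    by (simp_all add: power2_eq_square algebra_simps)
  then show ?thesis
    using assms by (auto simp: plane_rot_def fun_eq_iff)
qed

lemma plane_rot_surj:
  assumes "p \<noteq> q" "c\<^sup>2 + s\<^sup>2 = 1"
  obtains u' where "u = plane_rot p q c s u'"
  using plane_rot_inverse[of p q c "- s" u] assms by (metis minus_minus power2_minus)

text \<open>A rotation is a bijection of the test vectors \<open>u\<close>, so a quantifier over
  \<open>u\<close> absorbs it. This is why the events below quantify over all \<open>u\<close>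
  instead of naming a basis.\<close>

lemma all_plane_rot:
  assumes "p \<noteq> q" "c\<^sup>2 + s\<^sup>2 = 1"
  shows "(\<forall>u. Q u) = (\<forall>u. Q (plane_rot p q c s u))"
  using plane_rot_surj[OF assms] by (intro iffI) (blast, metis)

lemma ex_plane_rot:
  assumes "p \<noteq> q" "c\<^sup>2 + s\<^sup>2 = 1"
  shows "(\<exists>u. Q u) = (\<exists>u. Q (plane_rot p q c s u))"
  using all_plane_rot[OF assms, of "\<lambda>u. \<not> Q u"] by blast

text \<open>The zero vector also receives a unit direction, an arbitrary coordinate vector, so the
  degenerate row needs no separate treatment in the recursion.\<close>

lemma ex_unit_direction:
  fixes w :: "'i \<Rightarrow> real"
  assumes J: "finite J"
  obtains f where "J \<noteq> {} \<Longrightarrow> nsq J f = 1" "\<And>j. j \<in> J \<Longrightarrow> w j = sqrt (nsq J w) * f j"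
proof (cases "nsq J w = 0")
  case True
  then have w: "w j = 0" if "j \<in> J" for j
    using J that by (simp add: nsq_def sum_nonneg_eq_0_iff)
  define f where "f j = (if j = (SOME j. j \<in> J) then 1 else 0 :: real)" for j
  have "nsq J f = 1" if "J \<noteq> {}"
  proof -
    have "(SOME j. j \<in> J) \<in> J" using that by (simp add: some_in_eq)
    then show ?thesis
      using J by (simp add: nsq_def f_def if_distrib[of "\<lambda>x. x\<^sup>2"] cong: if_cong)
  qed
  then show ?thesis using that[of f] True w by simp
next
  case False
  have "nsq J (\<lambda>j. w j / sqrt (nsq J w)) = nsq J w / (sqrt (nsq J w))\<^sup>2"
    unfolding nsq_def by (simp only: power_divide sum_divide_distrib)
  then show ?thesis
    using that[of "\<lambda>j. w j / sqrt (nsq J w)"] False by simp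
qed

text \<open>Each rotation in the plane of \<open>i0\<close> and \<open>p\<close> kills the
  coordinate \<open>p\<close> of \<open>x\<close>, and the same rotation of the rows of
  \<open>A\<close> preserves the law; the induction counts the nonzero coordinates still to be
  killed. The sign remains because a single coordinate cannot be reflected by plane
  rotations.\<close>

lemma emeasure_rotate_to_axis:
  fixes P :: "(nat \<Rightarrow> real) \<Rightarrow> (nat \<times> nat \<Rightarrow> real) \<Rightarrow> bool"
  assumes fin: "finite I" "finite J" and i0: "i0 \<in> I"
    and meas: "\<And>x. gauss_event (I \<times> J) (\<lambda>A. P x A) \<in> sets (gauss_space (I \<times> J))"
    and inv: "\<And>x A p q c s. p \<in> I \<Longrightarrow> q \<in> I \<Longrightarrow> p \<noteq> q \<Longrightarrow> c\<^sup>2 + s\<^sup>2 = 1 \<Longrightarrow>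
       P (plane_rot p q c s x) (row_rot J p q c s A) = P x A"
    and x: "\<And>i. i \<notin> I \<Longrightarrow> x i = 0"
  shows "\<exists>\<sigma>\<in>{1, -1}. gauss_prob (I \<times> J) (\<lambda>A. P x A) =
    gauss_prob (I \<times> J) (\<lambda>A. P (\<lambda>i. if i = i0 then \<sigma> * sqrt (nsq I x) else 0) A)"
  using x
proof (induction "card {i \<in> I - {i0}. x i \<noteq> 0}" arbitrary: x)
  case 0
  then have z: "x i = 0" if "i \<noteq> i0" for i
    using that fin by (cases "i \<in> I") auto
  have "nsq I x = (\<Sum>i\<in>{i0}. (x i)\<^sup>2)"
    unfolding nsq_def by (rule sum.mono_neutral_right) (use fin i0 z in auto)
  then have "sqrt (nsq I x) = \<bar>x i0\<bar>"
    by simp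
  then have eq: "x = (\<lambda>i. if i = i0 then (if x i0 \<ge> 0 then 1 else -1) * sqrt (nsq I x) else 0)"
    using z by (auto simp: fun_eq_iff)
  have "\<exists>\<sigma>\<in>{1, -1}. x = (\<lambda>i. if i = i0 then \<sigma> * sqrt (nsq I x) else 0)"
    by (rule bexI[where x = "if x i0 \<ge> 0 then 1 else -1"], rule eq, simp)
  then obtain \<sigma> :: real where \<sigma>: "\<sigma> \<in> {1, -1}" and x_eq: "x = (\<lambda>i. if i = i0 then \<sigma> * sqrt (nsq I x) else 0)"
    by blast
  show ?case
    by (rule bexI[OF _ \<sigma>])
      (rule arg_cong[OF x_eq, of "\<lambda>x. gauss_prob (I \<times> J) (\<lambda>A. P x A)"])
next
  case (Suc n)
  have "{i \<in> I - {i0}. x i \<noteq> 0} \<noteq> {}"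
  proof
    assume "{i \<in> I - {i0}. x i \<noteq> 0} = {}"
    then show False using Suc(2) by (simp only: card.empty)
  qed
  then obtain p where p: "p \<in> I" "p \<noteq> i0" "x p \<noteq> 0"
    by blast
  define \<rho> where "\<rho> = sqrt ((x i0)\<^sup>2 + (x p)\<^sup>2)"
  have \<rho>2: "\<rho>\<^sup>2 = (x i0)\<^sup>2 + (x p)\<^sup>2"
    by (simp add: \<rho>_def)
  have \<rho>: "\<rho> > 0"
    using p by (simp add: \<rho>_def sum_power2_gt_zero_iff)
  \<comment> \<open>The Givens rotation that carries the pair \<open>(x i0, x p)\<close> to
    \<open>(\<rho>, 0)\<close>.\<close>
  define c s where "c = x i0 / \<rho>" and "s = x p / \<rho>"
  have "c\<^sup>2 + s\<^sup>2 = \<rho>\<^sup>2 / \<rho>\<^sup>2"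
    by (simp only: c_def s_def power_divide add_divide_distrib[symmetric] \<rho>2)
  then have cs: "c\<^sup>2 + s\<^sup>2 = 1"
    using \<rho> by simp
  define x' where "x' = plane_rot i0 p c s x"
  have nsq: "nsq I x' = nsq I x"
    unfolding x'_def by (rule nsq_plane_rot) (use fin i0 p cs in auto)
  have x'p: "x' p = 0"
    using p by (simp add: x'_def plane_rot_def c_def s_def)
  have x'i: "x' i = x i" if "i \<noteq> i0" "i \<noteq> p" for i
    using that by (simp add: x'_def plane_rot_def)
  have "{i \<in> I - {i0}. x i \<noteq> 0} = insert p {i \<in> I - {i0}. x' i \<noteq> 0}"
    using p x'p x'i by (auto, metis)
  moreover have "p \<notin> {i \<in> I - {i0}. x' i \<noteq> 0}"
    using x'p by simp
  ultimately have card: "n = card {i \<in> I - {i0}. x' i \<noteq> 0}"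
    using Suc(2) fin by simp
  have x'0: "x' i = 0" if "i \<notin> I" for i
    using that i0 p Suc(3)[OF that] by (subst x'i) auto
  let ?G = "gauss_space (I \<times> J)" and ?E = "\<lambda>x. (gauss_event (I \<times> J) (\<lambda>A. P x A))"
  have f: "indicator (?E x') \<in> borel_measurable ?G"
    using meas by simp
  note rot = row_rot_measurable_and_integral[OF fin(1) i0 p(1) p(2)[symmetric] fin(2) cs fin(2) order_refl]
  have "emeasure ?G (?E x') = (\<integral>\<^sup>+A. indicator (?E x') A \<partial>?G)"
    using meas by simp
  also have "\<dots> = (\<integral>\<^sup>+A. indicator (?E x') (row_rot J i0 p c s A) \<partial>?G)"
    using rot[OF f] by simp
  also have "\<dots> = (\<integral>\<^sup>+A. indicator (?E x) A \<partial>?G)"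
  proof (rule nn_integral_cong)
    fix A assume A: "A \<in> space ?G"
    then have "row_rot J i0 p c s A \<in> space ?G"
      using rot[OF f] by (auto simp: measurable_def)
    then show "indicator (?E x') (row_rot J i0 p c s A) = (indicator (?E x) A :: ennreal)"
      using A inv[of i0 p c s x A] i0 p cs by (auto simp: indicator_def x'_def)
  qed
  also have "\<dots> = emeasure ?G (?E x)"
    using meas by simp
  finally have eq: "emeasure ?G (?E x) = emeasure ?G (?E x')" by simp
  show ?case
    unfolding eq nsq[symmetric] by (rule Suc(1)[OF card x'0])
qed

text \<open>Transposition preserves the law, so the reduction for columns follows from the one for
  rows. The restriction is there because points of the product space are \<open>undefined\<close>
  off the index set.\<close>

lemma emeasure_gauss_space_swap:
  assumes fin: "finite I" "finite J"
    and meas: "gauss_event (I \<times> J) Q \<in> sets (gauss_space (I \<times> J))"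
  shows "gauss_event (J \<times> I) (\<lambda>A. Q (\<lambda>n\<in>I \<times> J. A (prod.swap n))) \<in> sets (gauss_space (J \<times> I))"
    and "gauss_prob (I \<times> J) Q =
      gauss_prob (J \<times> I) (\<lambda>A. Q (\<lambda>n\<in>I \<times> J. A (prod.swap n)))"
proof -
  let ?t = "\<lambda>A. \<lambda>n\<in>I \<times> J. A (prod.swap n) :: real"
  have t [measurable]: "?t \<in> measurable (gauss_space (J \<times> I)) (gauss_space (I \<times> J))"
    by (intro measurable_restrict measurable_component_singleton) auto
  have distr: "distr (gauss_space (J \<times> I)) (gauss_space (I \<times> J)) ?t = gauss_space (I \<times> J)"
    by (rule distr_PiM_reindex[where M = "\<lambda>_. gauss"]) (auto simp: prob_space_gauss inj_on_def)
  have eq: "?t -` (gauss_event (I \<times> J) Q) \<inter> space (gauss_space (J \<times> I)) =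
      gauss_event (J \<times> I) (\<lambda>A. Q (?t A))"
    using measurable_space[OF t] by auto
  show "gauss_event (J \<times> I) (\<lambda>A. Q (?t A)) \<in> sets (gauss_space (J \<times> I))"
    unfolding eq[symmetric] by (rule measurable_sets[OF t meas])
  show "gauss_prob (I \<times> J) Q =
      gauss_prob (J \<times> I) (\<lambda>A. Q (?t A))"
    by (subst (1) distr[symmetric], subst emeasure_distr) (use meas t eq in simp_all)
qed

definition col_rot :: "nat set \<Rightarrow> nat \<Rightarrow> nat \<Rightarrow> real \<Rightarrow> real \<Rightarrow> (nat \<times> nat \<Rightarrow> real) \<Rightarrow> nat \<times> nat \<Rightarrow> real" where
  "col_rot I p q c s A = (\<lambda>(i, j). if i \<in> I then plane_rot p q c s (\<lambda>j. A (i, j)) j else A (i, j))"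

lemma emeasure_rotate_to_axis_cols:
  fixes P :: "(nat \<Rightarrow> real) \<Rightarrow> (nat \<times> nat \<Rightarrow> real) \<Rightarrow> bool"
  assumes fin: "finite I" "finite J" and j0: "j0 \<in> J"
    and meas: "\<And>x. gauss_event (I \<times> J) (\<lambda>A. P x A) \<in> sets (gauss_space (I \<times> J))"
    and inv: "\<And>x A p q c s. p \<in> J \<Longrightarrow> q \<in> J \<Longrightarrow> p \<noteq> q \<Longrightarrow> c\<^sup>2 + s\<^sup>2 = 1 \<Longrightarrow>
       P (plane_rot p q c s x) (col_rot I p q c s A) = P x A"
    and x: "\<And>j. j \<notin> J \<Longrightarrow> x j = 0"
  shows "\<exists>\<sigma>\<in>{1, -1}. gauss_prob (I \<times> J) (\<lambda>A. P x A) =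
    gauss_prob (I \<times> J) (\<lambda>A. P (\<lambda>j. if j = j0 then \<sigma> * sqrt (nsq J x) else 0) A)"
proof -
  let ?t = "\<lambda>A. \<lambda>n\<in>I \<times> J. A (prod.swap n) :: real"
  have "P (plane_rot p q c s x) (?t (row_rot I p q c s A)) = P x (?t A)"
    if pq: "p \<in> J" "q \<in> J" "p \<noteq> q" "c\<^sup>2 + s\<^sup>2 = 1" for x A p q c s
  proof -
    have "?t (row_rot I p q c s A) = col_rot I p q c s (?t A)"
      using pq by (auto simp: fun_eq_iff row_rot_def col_rot_def plane_rot_def)
    then show ?thesis
      using inv[OF pq] by simp
  qed
  note * = emeasure_rotate_to_axis[where P = "\<lambda>x A. P x (\<lambda>n\<in>I \<times> J. A (prod.swap n))",
      OF fin(2) fin(1) j0 emeasure_gauss_space_swap(1)[OF fin meas] this x]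
  show ?thesis
    unfolding emeasure_gauss_space_swap(2)[OF fin meas] by (rule *)
qed

text \<open>Conditioning on the entries in \<open>K1\<close>: on \<open>bad\<close> the conditional
  probability is bounded by 1, elsewhere by \<open>t\<close>. The entries in \<open>K2\<close> keep
  their law whatever \<open>z\<close> is.\<close>

lemma emeasure_gauss_space_fold_le:
  assumes K: "finite K1" "finite K2" "K1 \<inter> K2 = {}" and B: "B \<in> sets (gauss_space (K1 \<union> K2))"
    and bad: "bad \<in> sets (gauss_space K1)"
    and le: "\<And>z. z \<in> space (gauss_space K1) \<Longrightarrow> z \<notin> bad \<Longrightarrow>
      gauss_prob K2 (\<lambda>y. merge K1 K2 (z, y) \<in> B) \<le> t"
  shows "emeasure (gauss_space (K1 \<union> K2)) B \<le> emeasure (gauss_space K1) bad + t"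
proof -
  interpret G1: prob_space "gauss_space K1" by (rule prob_space_gauss_space)
  interpret G2: prob_space "gauss_space K2" by (rule prob_space_gauss_space)
  have "emeasure (gauss_space (K1 \<union> K2)) B = (\<integral>\<^sup>+z. indicator B z \<partial>gauss_space (K1 \<union> K2))"
    using B by simp
  also have "\<dots> = (\<integral>\<^sup>+z. \<integral>\<^sup>+y. indicator B (merge K1 K2 (z, y)) \<partial>gauss_space K2 \<partial>gauss_space K1)"
    by (rule gauss_product.product_nn_integral_fold) (use K B in auto)
  also have "\<dots> \<le> (\<integral>\<^sup>+z. indicator bad z + t \<partial>gauss_space K1)"
  proof (rule nn_integral_mono)
    fix z assume z: "z \<in> space (gauss_space K1)"
    let ?S = "gauss_event K2 (\<lambda>y. merge K1 K2 (z, y) \<in> B)"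
    have "(\<lambda>y. merge K1 K2 (z, y)) \<in> measurable (gauss_space K2) (gauss_space (K1 \<union> K2))"
      using z by measurable
    then have S: "?S \<in> sets (gauss_space K2)"
      using B by (auto dest!: measurable_sets simp: vimage_def Int_def conj_commute)
    have "(\<integral>\<^sup>+y. indicator B (merge K1 K2 (z, y)) \<partial>gauss_space K2) = (\<integral>\<^sup>+y. indicator ?S y \<partial>gauss_space K2)"
      by (rule nn_integral_cong) (auto simp: indicator_def)
    also have "\<dots> = emeasure (gauss_space K2) ?S"
      using S by simp
    also have "\<dots> \<le> indicator bad z + t"
      using le[OF z] G2.emeasure_le_1[of ?S] by (cases "z \<in> bad") (auto simp: add_increasing2)
    finally show "(\<integral>\<^sup>+y. indicator B (merge K1 K2 (z, y)) \<partial>gauss_space K2) \<le> indicator bad z + t" .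
  qed
  also have "\<dots> = emeasure (gauss_space K1) bad + t"
    using bad by (subst nn_integral_add) (auto simp: G1.emeasure_space_1)
  finally show ?thesis .
qed

section \<open>Measurability of open and closed conditions\<close>

lemma measurable_gauss_space_borel [measurable]:
  "(\<lambda>A. A) \<in> measurable (gauss_space K) (borel :: ('i::countable \<Rightarrow> real) measure)"
proof -
  have "(\<lambda>A. A) \<in> measurable (gauss_space K) (PiM (UNIV :: 'i set) (\<lambda>_. borel :: real measure))"
  proof (rule measurable_PiM_single')
    fix i :: 'i
    show "(\<lambda>A. A i) \<in> borel_measurable (gauss_space K)"
    proof (cases "i \<in> K")
      case False
      \<comment> \<open>Off \<open>K\<close> a point of the product space has the constant value
        \<open>undefined\<close>.\<close>
      then have "(\<lambda>A. A i) \<in> borel_measurable (gauss_space K) \<longleftrightarrow> (\<lambda>A. undefined :: real) \<in> borel_measurable (gauss_space K)"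
        by (intro measurable_cong) (auto simp: space_PiM PiE_def extensional_def)
      then show ?thesis by simp
    qed measurable
  qed auto
  then show ?thesis
    by (simp add: measurable_cong_sets[OF refl sets_PiM_equal_borel])
qed

text \<open>The events of interest quantify over uncountably many vectors. A universal statement
  with weak inequalities is closed, an existential one with strict inequalities is open, and so both
  are measurable.\<close>

lemma gauss_space_closed_sets:
  fixes Q :: "('i::countable \<Rightarrow> real) \<Rightarrow> bool"
  assumes "closed {A. Q A}"
  shows "gauss_event K Q \<in> sets (gauss_space K)"
  using measurable_sets[OF measurable_gauss_space_borel borel_closed[OF assms], of K]
  by (simp add: vimage_def Int_def conj_commute)

lemma gauss_space_open_sets:
  fixes Q :: "('i::countable \<Rightarrow> real) \<Rightarrow> bool"
  assumes "open {A. Q A}"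
  shows "gauss_event K Q \<in> sets (gauss_space K)"
  using measurable_sets[OF measurable_gauss_space_borel borel_open[OF assms], of K]
  by (simp add: vimage_def Int_def conj_commute)

lemma continuous_on_coordinate [continuous_intros]: "continuous_on S (\<lambda>A :: 'i \<Rightarrow> real. A i)"
  by (rule continuous_on_subset[OF continuous_on_product_coordinates]) simp

lemma continuous_on_tm [continuous_intros]: "continuous_on S (\<lambda>A. tm I A u j)"
  unfolding tm_def by (intro continuous_intros)

lemma continuous_on_ip [continuous_intros]:
  assumes "\<And>i. i \<in> I \<Longrightarrow> continuous_on S (\<lambda>A. f A i)" "\<And>i. i \<in> I \<Longrightarrow> continuous_on S (\<lambda>A. g A i)"
  shows "continuous_on S (\<lambda>A. ip I (f A) (g A))"
  unfolding ip_def by (intro continuous_intros assms)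

lemma continuous_on_nsq [continuous_intros]:
  assumes "\<And>i. i \<in> I \<Longrightarrow> continuous_on S (\<lambda>A. f A i)"
  shows "continuous_on S (\<lambda>A. nsq I (f A))"
  unfolding nsq_def by (intro continuous_intros assms)

section \<open>Chernoff bounds for Gaussian lengths and projections\<close>

lemma nn_integral_gauss_exp_square:
  assumes "a < 1 / 2"
  shows "(\<integral>\<^sup>+x. ennreal (exp (a * x\<^sup>2)) \<partial>gauss) = ennreal (1 / sqrt (1 - 2 * a))"
proof -
  define v where "v = 1 / sqrt (1 - 2 * a)"
  have v: "v > 0" and v2: "v\<^sup>2 = 1 / (1 - 2 * a)"
    using assms by (simp_all add: v_def power_divide)
  have eq: "std_normal_density x * exp (a * x\<^sup>2) = v * normal_density 0 v x" for x
  proof -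
    have "- x\<^sup>2 / 2 + a * x\<^sup>2 = - x\<^sup>2 / (2 * v\<^sup>2)"
      using assms by (simp add: v2 field_simps)
    moreover have "sqrt (2 * pi * v\<^sup>2) = v * sqrt (2 * pi)"
      using v by (simp add: real_sqrt_mult)
    ultimately show ?thesis
      using v by (simp add: normal_density_def exp_add[symmetric] del: exp_add)
  qed
  have "(\<integral>\<^sup>+x. ennreal (exp (a * x\<^sup>2)) \<partial>gauss) = (\<integral>\<^sup>+x. ennreal (v * normal_density 0 v x) \<partial>lborel)"
    by (simp add: nn_integral_gauss ennreal_mult[symmetric] eq)
  also have "\<dots> = ennreal (\<integral>x. v * normal_density 0 v x \<partial>lborel)"
    using v by (intro nn_integral_eq_integral) auto
  also have "\<dots> = ennreal v"
    using v by simp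
  finally show ?thesis by (simp add: v_def)
qed

lemma nn_integral_gauss_exp:
  "(\<integral>\<^sup>+x. ennreal (exp (a * x)) \<partial>gauss) = ennreal (exp (a\<^sup>2 / 2))"
proof -
  have eq: "std_normal_density x * exp (a * x) = exp (a\<^sup>2 / 2) * normal_density a 1 x" for x
  proof -
    have "- x\<^sup>2 / 2 + a * x = a\<^sup>2 / 2 + - (x - a)\<^sup>2 / 2"
      by (simp add: power2_eq_square field_simps)
    then show ?thesis
      by (simp add: normal_density_def exp_add[symmetric] del: exp_add)
  qed
  have "(\<integral>\<^sup>+x. ennreal (exp (a * x)) \<partial>gauss) = (\<integral>\<^sup>+x. ennreal (exp (a\<^sup>2 / 2) * normal_density a 1 x) \<partial>lborel)"
    by (simp add: nn_integral_gauss ennreal_mult[symmetric] eq)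
  also have "\<dots> = ennreal (\<integral>x. exp (a\<^sup>2 / 2) * normal_density a 1 x \<partial>lborel)"
    by (intro nn_integral_eq_integral) auto
  finally show ?thesis by simp
qed

lemma emeasure_gauss_space_chernoff:
  assumes K: "finite K" and [measurable]: "\<And>k. k \<in> K \<Longrightarrow> \<phi> k \<in> borel_measurable borel"
    and m: "\<And>k. k \<in> K \<Longrightarrow> (\<integral>\<^sup>+x. ennreal (exp (\<phi> k x)) \<partial>gauss) = ennreal (b k)"
    and b: "\<And>k. k \<in> K \<Longrightarrow> 0 \<le> b k"
  shows "gauss_prob K (\<lambda>z. t \<le> (\<Sum>k\<in>K. \<phi> k (z k))) \<le> ennreal (exp (- t) * (\<Prod>k\<in>K. b k))"
proof -
  have "gauss_event K (\<lambda>z. t \<le> (\<Sum>k\<in>K. \<phi> k (z k))) \<subseteq>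
     gauss_event K (\<lambda>z. 1 \<le> ennreal (exp (- t)) * (\<Prod>k\<in>K. ennreal (exp (\<phi> k (z k)))))"
    using K by (auto simp: prod_ennreal exp_sum[symmetric] ennreal_mult[symmetric] exp_add[symmetric] ennreal_ge_1 simp del: exp_add)
  then have "gauss_prob K (\<lambda>z. t \<le> (\<Sum>k\<in>K. \<phi> k (z k))) \<le>
     gauss_prob K (\<lambda>z. 1 \<le> ennreal (exp (- t)) * (\<Prod>k\<in>K. ennreal (exp (\<phi> k (z k)))))"
    by (intro emeasure_mono) measurable
  also have "\<dots> \<le> ennreal (exp (- t)) * (\<integral>\<^sup>+z. (\<Prod>k\<in>K. ennreal (exp (\<phi> k (z k)))) * indicator (space (gauss_space K)) z \<partial>gauss_space K)"
    by (rule nn_integral_Markov_inequality) auto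
  also have "(\<integral>\<^sup>+z. (\<Prod>k\<in>K. ennreal (exp (\<phi> k (z k)))) * indicator (space (gauss_space K)) z \<partial>gauss_space K)
     = (\<integral>\<^sup>+z. (\<Prod>k\<in>K. ennreal (exp (\<phi> k (z k)))) \<partial>gauss_space K)"
    by (rule nn_integral_cong) simp
  also have "\<dots> = (\<Prod>k\<in>K. (\<integral>\<^sup>+x. ennreal (exp (\<phi> k x)) \<partial>gauss))"
    by (rule gauss_product.product_nn_integral_prod) (use K in auto)
  also have "\<dots> = ennreal (\<Prod>k\<in>K. b k)"
    using m b by (simp add: prod_ennreal)
  also have "ennreal (exp (- t)) * \<dots> = ennreal (exp (- t) * (\<Prod>k\<in>K. b k))"
    by (simp add: ennreal_mult')
  finally show ?thesis .
qed

text \<open>\<open>M\<close> only bounds the number of coordinates because the matrix loses a row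
  and a column at every step while the threshold stays the same.\<close>

lemma nsq_upper_tail:
  assumes K: "finite K" "card K \<le> M" and d: "0 < d"
  shows "gauss_prob K (\<lambda>z. (1 + d) * real M \<le> nsq K z) \<le> ennreal ((sqrt (1 + d) * exp (- d / 2)) ^ M)"
proof -
  \<comment> \<open>The exponent that minimises the Chernoff bound for \<open>M\<close>
    coordinates.\<close>
  define a where "a = d / (2 * (1 + d))"
  have a: "0 < a" "a < 1 / 2" and a2: "1 - 2 * a = 1 / (1 + d)"
    using d by (simp_all add: a_def field_simps)
  have "gauss_event K (\<lambda>z. (1 + d) * real M \<le> nsq K z) = gauss_event K (\<lambda>z. a * ((1 + d) * real M) \<le> (\<Sum>k\<in>K. a * (z k)\<^sup>2))"
    using a by (simp add: nsq_def sum_distrib_left[symmetric])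
  also have "emeasure (gauss_space K) \<dots> \<le> ennreal (exp (- (a * ((1 + d) * real M))) * (\<Prod>k\<in>K. sqrt (1 + d)))"
    by (rule emeasure_gauss_space_chernoff) (use K a a2 d nn_integral_gauss_exp_square[of a] in \<open>auto simp: real_sqrt_divide\<close>)
  also have "a * ((1 + d) * real M) = real M * (d / 2)"
    using d by (simp add: a_def field_simps)
  also have "exp (- (real M * (d / 2))) * (\<Prod>k\<in>K. sqrt (1 + d)) \<le> exp (- (real M * (d / 2))) * sqrt (1 + d) ^ M"
    using K d by (intro mult_left_mono) (auto intro!: power_increasing)
  also have "\<dots> = (sqrt (1 + d) * exp (- d / 2)) ^ M"
    by (simp add: power_mult_distrib exp_of_nat_mult[symmetric] mult.commute)
  finally show ?thesis
    by (simp add: ennreal_leI)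
qed

text \<open>Here lost coordinates do hurt: up to \<open>k\<close> may be missing, and each costs a
  factor \<open>1 / sqrt (1 - d)\<close>. This is affordable for a bounded \<open>k\<close>
  only.\<close>

lemma nsq_lower_tail:
  assumes K: "finite K" "M \<le> card K + k" and d: "0 < d" "d < 1"
  shows "gauss_prob K (\<lambda>z. nsq K z \<le> (1 - d) * real M) \<le> ennreal ((sqrt (1 - d) * exp (d / 2)) ^ M / sqrt (1 - d) ^ k)"
proof -
  define a where "a = d / (2 * (1 - d))"
  have a: "0 < a" and a2: "1 + 2 * a = 1 / (1 - d)"
    using d by (simp_all add: a_def field_simps)
  have "gauss_event K (\<lambda>z. nsq K z \<le> (1 - d) * real M) = gauss_event K (\<lambda>z. - (a * ((1 - d) * real M)) \<le> (\<Sum>k\<in>K. - a * (z k)\<^sup>2))"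
    using a by (simp add: nsq_def sum_distrib_left[symmetric] sum_negf)
  also have "emeasure (gauss_space K) \<dots> \<le> ennreal (exp (- (- (a * ((1 - d) * real M)))) * (\<Prod>k\<in>K. sqrt (1 - d)))"
    by (rule emeasure_gauss_space_chernoff) (use K a a2 d nn_integral_gauss_exp_square[of "- a"] in \<open>auto simp: real_sqrt_divide\<close>)
  also have "- (- (a * ((1 - d) * real M))) = real M * (d / 2)"
    using d by (simp add: a_def field_simps)
  also have "exp (real M * (d / 2)) * (\<Prod>k\<in>K. sqrt (1 - d)) \<le> exp (real M * (d / 2)) * (sqrt (1 - d) ^ M / sqrt (1 - d) ^ k)"
  proof (rule mult_left_mono)
    have "sqrt (1 - d) ^ (card K + k) \<le> sqrt (1 - d) ^ M"
      using K d by (intro power_decreasing) auto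
    then show "(\<Prod>k\<in>K. sqrt (1 - d)) \<le> sqrt (1 - d) ^ M / sqrt (1 - d) ^ k"
      using d by (simp add: power_add pos_le_divide_eq)
  qed simp
  also have "\<dots> = (sqrt (1 - d) * exp (d / 2)) ^ M / sqrt (1 - d) ^ k"
    by (simp add: power_mult_distrib exp_of_nat_mult[symmetric] mult.commute)
  finally show ?thesis
    by (simp add: ennreal_leI)
qed

text \<open>Chernoff with slope 1. A tail exponential in \<open>t\<close> is enough, as
  \<open>t\<close> will be a multiple of the square root of the dimension.\<close>

lemma ip_tail:
  assumes K: "finite K" "nsq K y = 1"
  shows "gauss_prob K (\<lambda>z. t \<le> \<bar>ip K z y\<bar>) \<le> ennreal (2 * exp (1 / 2 - t))"
proof -
  have one: "gauss_prob K (\<lambda>z. t \<le> ip K z y') \<le> ennreal (exp (1 / 2 - t))"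
    if y': "nsq K y' = 1" for y'
  proof -
    have "gauss_prob K (\<lambda>z. t \<le> (\<Sum>k\<in>K. y' k * z k)) \<le> ennreal (exp (- t) * (\<Prod>k\<in>K. exp ((y' k)\<^sup>2 / 2)))"
      by (rule emeasure_gauss_space_chernoff) (use K nn_integral_gauss_exp in auto)
    also have "(\<Prod>k\<in>K. exp ((y' k)\<^sup>2 / 2)) = exp (1 / 2)"
      using y' K by (simp add: exp_sum[symmetric] sum_divide_distrib[symmetric] nsq_def)
    also have "exp (- t) * exp (1 / 2) = exp (1 / 2 - t)"
      by (simp add: mult_exp_exp)
    finally show ?thesis
      by (simp add: ip_def mult.commute[of "y' _"])
  qed
  have [measurable]: "(\<lambda>z. ip K z y') \<in> borel_measurable (gauss_space K)" for y'
    unfolding ip_def by measurable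
  have "gauss_prob K (\<lambda>z. t \<le> \<bar>ip K z y\<bar>) \<le>
     emeasure (gauss_space K) ((gauss_event K (\<lambda>z. t \<le> ip K z y)) \<union> gauss_event K (\<lambda>z. t \<le> ip K z (\<lambda>k. - y k)))"
    by (intro emeasure_mono) (auto simp: ip_def sum_negf abs_le_iff abs_if split: if_splits)
  also have "\<dots> \<le> gauss_prob K (\<lambda>z. t \<le> ip K z y) + gauss_prob K (\<lambda>z. t \<le> ip K z (\<lambda>k. - y k))"
    by (intro emeasure_subadditive) measurable
  also have "\<dots> \<le> ennreal (exp (1 / 2 - t)) + ennreal (exp (1 / 2 - t))"
    using K by (intro add_mono one) (auto simp: nsq_def)
  also have "\<dots> = ennreal (2 * exp (1 / 2 - t))"
    by (subst ennreal_plus[symmetric]) (simp_all only: mult_2 exp_ge_zero)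
  finally show ?thesis .
qed

section \<open>One step of the bidiagonalisation\<close>

text \<open>The term \<open>\<alpha> * f j\<close> is the contribution of one more row, of direction
  \<open>f\<close>, above the matrix \<open>A\<close>. Keeping its coefficient
  \<open>\<alpha>\<close> inside the square root is what makes the bound reproduce itself when a row
  and a column are added.\<close>

definition up_bound :: "real \<Rightarrow> real \<Rightarrow> nat set \<Rightarrow> nat set \<Rightarrow> (nat \<Rightarrow> real) \<Rightarrow> (nat \<times> nat \<Rightarrow> real) \<Rightarrow> bool" where
  "up_bound D L I J f A \<longleftrightarrow>
     (\<forall>\<alpha> u. sqrt (nsq J (\<lambda>j. \<alpha> * f j + tm I A u j)) \<le> sqrt (\<alpha>\<^sup>2 + D\<^sup>2 * nsq I u) + L * sqrt (nsq I u))"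

text \<open>The vector \<open>u\<close> below is built along the Krylov space with geometrically decaying coefficients
  \<open>1, r, r\<^sup>2, \<dots>\<close>, which is the shape of the top singular vector of an infinite bidiagonal matrix with
  constant entries and perturbed corner; this gives its squared length \<open>geo r k\<close>.\<close>

definition low_bound :: "real \<Rightarrow> real \<Rightarrow> real \<Rightarrow> nat set \<Rightarrow> nat set \<Rightarrow> (nat \<Rightarrow> real) \<Rightarrow> (nat \<times> nat \<Rightarrow> real) \<Rightarrow> bool" where
  "low_bound L' q v I J f A \<longleftrightarrow>
     (\<exists>u. nsq I u = q \<and> ip J f (tm I A u) > L' \<and> nsq J (tm I A u) - (ip J f (tm I A u))\<^sup>2 > v)"

definition geo :: "real \<Rightarrow> nat \<Rightarrow> real" where
  "geo r k = (\<Sum>i<k. r ^ (2 * i))"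

lemma geo_0 [simp]: "geo r 0 = 0"
  by (simp add: geo_def)

lemma geo_Suc: "geo r (Suc k) = 1 + r\<^sup>2 * geo r k"
  unfolding geo_def by (subst sum.lessThan_Suc_shift) (simp add: sum_distrib_left power_mult power2_eq_square mult.assoc)

text \<open>\<open>D'\<close> and \<open>D\<close> enclose the diagonal entries (row lengths),
  \<open>L'\<close> and \<open>L\<close> the subdiagonal ones (column lengths), and \<open>r\<close>
  is the decay ratio of the test vector.\<close>

locale bidiag =
  fixes D L D' L' r :: real
  assumes nonneg: "0 \<le> D" "0 \<le> L" "0 \<le> D'" "0 \<le> L'" "0 \<le> r"
begin

text \<open>\<open>k\<close> counts the steps for which lower bounds are claimed. For a bidiagonal
  matrix with entries \<open>D'\<close> and \<open>L'\<close>, the image of (1, r, ..., r^(k-1)) has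
  component \<open>L'\<close> along \<open>f\<close> and r^(j-1) (D' + r L') in the following
  columns; the last, incomplete column is dropped, whence \<open>geo r (k - 1)\<close>.\<close>

definition good :: "nat \<Rightarrow> nat set \<Rightarrow> nat set \<Rightarrow> (nat \<Rightarrow> real) \<Rightarrow> (nat \<times> nat \<Rightarrow> real) \<Rightarrow> bool" where
  "good k I J f A \<longleftrightarrow> up_bound D L I J f A \<and>
     (k > 0 \<longrightarrow> low_bound L' (geo r k) ((D' + r * L')\<^sup>2 * geo r (k - 1)) I J f A)"

lemma closed_up_bound: "closed {A. up_bound D L I J f A}"
  unfolding up_bound_def by (intro closed_Collect_all closed_Collect_le continuous_intros)

lemma open_low_bound: "open {A. low_bound L' q v I J f A}"
  unfolding low_bound_def by (intro open_Collect_ex open_Collect_conj open_Collect_less open_Collect_const continuous_intros)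

lemma good_sets:
  fixes \<Phi> :: "('i::countable \<Rightarrow> real) \<Rightarrow> nat \<times> nat \<Rightarrow> real"
  assumes "continuous_on UNIV \<Phi>"
  shows "gauss_event K (\<lambda>A. good k I J f (\<Phi> A)) \<in> sets (gauss_space K)"
proof -
  have "closed {A. up_bound D L I J f (\<Phi> A)}"
    using closed_vimage[OF closed_up_bound assms] by (simp add: vimage_def)
  moreover have "open {A. low_bound L' (geo r k) ((D' + r * L')\<^sup>2 * geo r (k - 1)) I J f (\<Phi> A)}"
    using open_vimage[OF open_low_bound assms] by (simp add: vimage_def)
  ultimately show ?thesis
    unfolding good_def
    by (intro sets.sets_Collect_conj sets.sets_Collect_imp sets.sets_Collect_const)
      (simp_all add: gauss_space_closed_sets gauss_space_open_sets)
qed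

lemma not_good_sets:
  fixes \<Phi> :: "('i::countable \<Rightarrow> real) \<Rightarrow> nat \<times> nat \<Rightarrow> real"
  assumes "continuous_on UNIV \<Phi>"
  shows "gauss_event K (\<lambda>A. \<not> good k I J f (\<Phi> A)) \<in> sets (gauss_space K)"
  by (intro sets.sets_Collect_neg good_sets assms)

lemma good_cong:
  assumes "\<And>i j. i \<in> I \<Longrightarrow> j \<in> J \<Longrightarrow> A (i, j) = B (i, j)" "\<And>j. j \<in> J \<Longrightarrow> f j = g j"
  shows "good k I J f A = good k I J g B"
proof -
  have tm: "tm I A u j = tm I B u j" if "j \<in> J" for u j
    using assms that by (intro tm_cong) auto
  have "nsq J (\<lambda>j. \<alpha> * f j + tm I A u j) = nsq J (\<lambda>j. \<alpha> * g j + tm I B u j)" for \<alpha> u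
    using tm assms by (intro nsq_cong) auto
  moreover have "ip J f (tm I A u) = ip J g (tm I B u)" for u
    using tm assms by (intro ip_cong) auto
  moreover have "nsq J (tm I A u) = nsq J (tm I B u)" for u
    using tm by (intro nsq_cong) auto
  ultimately show ?thesis
    unfolding good_def up_bound_def low_bound_def by simp
qed

lemma tm_col_rot: "tm I (col_rot I p q c s A) u = plane_rot p q c s (tm I A u)"
proof
  fix j
  have "tm I (col_rot I p q c s A) u j = (\<Sum>i\<in>I. plane_rot p q c s (\<lambda>j. A (i, j)) j * u i)"
    by (simp add: tm_def col_rot_def)
  also have "\<dots> = plane_rot p q c s (tm I A u) j"
    by (cases "j = q"; cases "j = p")
      (simp_all add: plane_rot_def tm_def sum_distrib_left sum.distrib[symmetric] sum_subtractf[symmetric] algebra_simps)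
  finally show "tm I (col_rot I p q c s A) u j = plane_rot p q c s (tm I A u) j" .
qed

lemma good_col_rot:
  assumes J: "finite J" "p \<in> J" "q \<in> J" "p \<noteq> q" "c\<^sup>2 + s\<^sup>2 = 1"
  shows "good k I J (plane_rot p q c s f) (col_rot I p q c s A) = good k I J f A"
proof -
  have "(\<lambda>j. \<alpha> * plane_rot p q c s f j + plane_rot p q c s (tm I A u) j) = plane_rot p q c s (\<lambda>j. \<alpha> * f j + tm I A u j)" for \<alpha> u
    by (auto simp: plane_rot_def fun_eq_iff algebra_simps)
  then show ?thesis
    unfolding good_def up_bound_def low_bound_def tm_col_rot
    by (simp add: nsq_plane_rot[OF J] ip_plane_rot[OF J])
qed

text \<open>\<open>f\<close> lives on the columns and is unchanged; the rotation of the rows is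
  absorbed by the quantified vectors \<open>u\<close>.\<close>

lemma good_row_rot:
  assumes I: "finite I" "p \<in> I" "q \<in> I" "p \<noteq> q" "c\<^sup>2 + s\<^sup>2 = 1"
  shows "good k I J f (row_rot J p q c s A) = good k I J f A"
proof -
  let ?R = "plane_rot p q c s"
  have tm: "tm I (row_rot J p q c s A) (?R u) j = tm I A u j" if "j \<in> J" for u j
    using I that by (rule tm_row_rot)
  have "nsq J (\<lambda>j. \<alpha> * f j + tm I (row_rot J p q c s A) (?R u) j) = nsq J (\<lambda>j. \<alpha> * f j + tm I A u j)" for \<alpha> u
    using tm by (intro nsq_cong) auto
  moreover have "ip J f (tm I (row_rot J p q c s A) (?R u)) = ip J f (tm I A u)" for u
    using tm by (intro ip_cong) auto
  moreover have "nsq J (tm I (row_rot J p q c s A) (?R u)) = nsq J (tm I A u)" for u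
    using tm by (intro nsq_cong) auto
  ultimately show ?thesis
    unfolding good_def up_bound_def low_bound_def
    by (subst all_plane_rot[OF I(4,5)], subst ex_plane_rot[OF I(4,5)]) (simp add: nsq_plane_rot[OF I])
qed

text \<open>Removes the sign that \<open>emeasure_rotate_to_axis_cols\<close> leaves on
  \<open>f\<close>; the witness of the lower bound changes sign as well.\<close>

lemma good_uminus:
  "good k I J (\<lambda>j. - f j) A = good k I J f A"
proof -
  have *: "good k I J (\<lambda>j. - f j) A" if "good k I J f A" for f
  proof -
    have "up_bound D L I J (\<lambda>j. - f j) A"
      unfolding up_bound_def
    proof (intro allI)
      fix \<alpha> u
      show "sqrt (nsq J (\<lambda>j. \<alpha> * - f j + tm I A u j)) \<le> sqrt (\<alpha>\<^sup>2 + D\<^sup>2 * nsq I u) + L * sqrt (nsq I u)"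
        using that[unfolded good_def up_bound_def, THEN conjunct1, rule_format, of "- \<alpha>" u] by simp
    qed
    moreover have "low_bound L' q v I J (\<lambda>j. - f j) A" if low: "low_bound L' q v I J f A" for q v
    proof -
      obtain u where u: "nsq I u = q" "ip J f (tm I A u) > L'" "nsq J (tm I A u) - (ip J f (tm I A u))\<^sup>2 > v"
        using low unfolding low_bound_def by blast
      have "tm I A (\<lambda>i. - u i) = (\<lambda>j. - tm I A u j)"
        by (simp add: tm_def sum_negf fun_eq_iff)
      then show ?thesis
        unfolding low_bound_def using u
        by (intro exI[of _ "\<lambda>i. - u i"]) (simp add: nsq_def ip_def)
    qed
    ultimately show ?thesis
      using that unfolding good_def by blast
  qed
  show ?thesis
    using *[of f] *[of "\<lambda>j. - f j"] by auto
qed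

text \<open>The row \<open>i0\<close> acts on the smaller matrix as the extra row of direction
  \<open>f'\<close>, so the induction hypothesis is used with the coefficient
  \<open>H * u i0\<close>.\<close>

lemma up_bound_step:
  assumes fin: "finite I'" "finite J'" "i0 \<notin> I'" "j0 \<notin> J'"
    and A0: "A (i0, j0) = g" "\<And>i. i \<in> I' \<Longrightarrow> A (i, j0) = 0" "\<bar>g\<bar> \<le> L"
    and h: "\<And>j. j \<in> J' \<Longrightarrow> A (i0, j) = H * f' j" "0 \<le> H" "H \<le> D"
    and IH: "up_bound D L I' J' f' A"
  shows "up_bound D L (insert i0 I') (insert j0 J') (\<lambda>j. if j = j0 then 1 else 0) A"
  unfolding up_bound_def
proof (intro allI)
  fix \<alpha> u
  let ?I = "insert i0 I'" and ?e = "\<lambda>j. if j = j0 then 1 else 0 :: real"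
  define n where "n = sqrt (nsq I' u)"
  have n: "0 \<le> n" "n\<^sup>2 = nsq I' u"
    by (simp_all add: n_def)
  have nI: "nsq ?I u = (u i0)\<^sup>2 + n\<^sup>2"
    using fin n by (simp add: nsq_insert)
  have "tm ?I A u j0 = g * u i0"
    using fin A0 by (simp add: tm_def)
  moreover have "nsq J' (\<lambda>j. \<alpha> * ?e j + tm ?I A u j) = nsq J' (\<lambda>j. (H * u i0) * f' j + tm I' A u j)"
    using fin h by (intro nsq_cong) (auto simp: tm_def algebra_simps)
  ultimately have eq: "nsq (insert j0 J') (\<lambda>j. \<alpha> * ?e j + tm ?I A u j) =
      (\<alpha> + g * u i0)\<^sup>2 + nsq J' (\<lambda>j. (H * u i0) * f' j + tm I' A u j)"
    using fin by (simp add: nsq_insert)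
  define w where "w = sqrt ((H * u i0)\<^sup>2 + D\<^sup>2 * n\<^sup>2)"
  have "sqrt (nsq J' (\<lambda>j. (H * u i0) * f' j + tm I' A u j)) \<le> w + L * n"
    using IH[unfolded up_bound_def, rule_format, of "H * u i0" u] by (simp add: w_def n_def)
  then have "nsq J' (\<lambda>j. (H * u i0) * f' j + tm I' A u j) \<le> (w + L * n)\<^sup>2"
    using power_mono[of "sqrt (nsq J' (\<lambda>j. (H * u i0) * f' j + tm I' A u j))" "w + L * n" 2] by simp
  then have "sqrt (nsq (insert j0 J') (\<lambda>j. \<alpha> * ?e j + tm ?I A u j)) \<le> sqrt ((\<alpha> + g * u i0)\<^sup>2 + (w + L * n)\<^sup>2)"
    unfolding eq by simp
  \<comment> \<open>Minkowski in the plane: the diagonal part \<open>(\<alpha>, w)\<close> is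
    separated from the subdiagonal part \<open>(g * u i0, L * n)\<close>.\<close>
  also have "\<dots> \<le> sqrt (\<alpha>\<^sup>2 + w\<^sup>2) + sqrt ((g * u i0)\<^sup>2 + (L * n)\<^sup>2)"
    by (rule real_sqrt_sum_squares_triangle_ineq)
  also have "\<dots> \<le> sqrt (\<alpha>\<^sup>2 + D\<^sup>2 * nsq ?I u) + L * sqrt (nsq ?I u)"
  proof (rule add_mono)
    have "H\<^sup>2 * (u i0)\<^sup>2 \<le> D\<^sup>2 * (u i0)\<^sup>2"
      using h by (intro mult_right_mono power_mono) auto
    then show "sqrt (\<alpha>\<^sup>2 + w\<^sup>2) \<le> sqrt (\<alpha>\<^sup>2 + D\<^sup>2 * nsq ?I u)"
      by (simp add: w_def nI power_mult_distrib algebra_simps)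
    have "g\<^sup>2 * (u i0)\<^sup>2 \<le> L\<^sup>2 * (u i0)\<^sup>2"
      using A0 nonneg by (intro mult_right_mono) (auto simp: abs_le_square_iff[symmetric])
    then have "sqrt ((g * u i0)\<^sup>2 + (L * n)\<^sup>2) \<le> sqrt (L\<^sup>2 * nsq ?I u)"
      by (simp add: nI power_mult_distrib algebra_simps)
    then show "sqrt ((g * u i0)\<^sup>2 + (L * n)\<^sup>2) \<le> L * sqrt (nsq ?I u)"
      using nonneg by (simp add: real_sqrt_mult)
  qed
  finally show "sqrt (nsq (insert j0 J') (\<lambda>j. \<alpha> * ?e j + tm ?I A u j)) \<le> sqrt (\<alpha>\<^sup>2 + D\<^sup>2 * nsq ?I u) + L * sqrt (nsq ?I u)" .
qed

text \<open>The new test vector is 1 at \<open>i0\<close> followed by \<open>r\<close> times the old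
  one, up to the sign \<open>\<sigma>\<close> that makes the component along the new direction equal
  to \<open>G\<close>. Splitting the old image into its part along the unit vector \<open>f'\<close>
  and the orthogonal rest (Pythagoras) is the reason why \<open>low_bound\<close> records these two
  parts separately.\<close>

lemma low_bound_step:
  assumes fin: "finite I'" "finite J'" "i0 \<notin> I'" "j0 \<notin> J'"
    and A0: "A (i0, j0) = \<sigma> * G" "\<And>i. i \<in> I' \<Longrightarrow> A (i, j0) = 0" "L' < G" "\<sigma> \<in> {1, -1}"
    and h: "\<And>j. j \<in> J' \<Longrightarrow> A (i0, j) = H * f' j" "D' < H" "nsq J' f' = 1"
    and IH: "k > 0 \<Longrightarrow> low_bound L' (geo r k) ((D' + r * L')\<^sup>2 * geo r (k - 1)) I' J' f' A"
  shows "low_bound L' (geo r (Suc k)) ((D' + r * L')\<^sup>2 * geo r k) (insert i0 I') (insert j0 J') (\<lambda>j. if j = j0 then 1 else 0) A"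
proof -
  have "\<exists>u. nsq I' u = geo r k \<and> nsq J' (\<lambda>j. H * f' j + r * tm I' A u j) > (D' + r * L')\<^sup>2 * geo r k"
  proof (cases k)
    case 0
    have "H\<^sup>2 > 0"
      using h nonneg by (intro zero_less_power) simp
    then show ?thesis
      using 0 h(3) by (intro exI[of _ "\<lambda>_. 0"]) (simp add: nsq_def tm_def power_mult_distrib sum_distrib_left[symmetric])
  next
    case (Suc k')
    then obtain u where u: "nsq I' u = geo r k" "ip J' f' (tm I' A u) > L'"
      "nsq J' (tm I' A u) - (ip J' f' (tm I' A u))\<^sup>2 > (D' + r * L')\<^sup>2 * geo r k'"
      using IH unfolding low_bound_def by auto
    let ?t = "tm I' A u"
    have "(D' + r * L')\<^sup>2 < (H + r * ip J' f' ?t)\<^sup>2"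
      using nonneg h u by (intro power_strict_mono add_less_le_mono mult_left_mono add_nonneg_nonneg mult_nonneg_nonneg) auto
    moreover have "r\<^sup>2 * ((D' + r * L')\<^sup>2 * geo r k') \<le> r\<^sup>2 * (nsq J' ?t - (ip J' f' ?t)\<^sup>2)"
      using u by (intro mult_left_mono) auto
    moreover have "nsq J' (\<lambda>j. H * f' j + r * ?t j) = (H + r * ip J' f' ?t)\<^sup>2 + r\<^sup>2 * (nsq J' ?t - (ip J' f' ?t)\<^sup>2)"
      unfolding nsq_add h(3) by (simp add: power2_eq_square algebra_simps)
    moreover have "(D' + r * L')\<^sup>2 * geo r k = (D' + r * L')\<^sup>2 + r\<^sup>2 * ((D' + r * L')\<^sup>2 * geo r k')"
      by (simp add: Suc geo_Suc algebra_simps)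
    ultimately show ?thesis
      using u by (intro exI[of _ u]) linarith
  qed
  then obtain u where u: "nsq I' u = geo r k" "nsq J' (\<lambda>j. H * f' j + r * tm I' A u j) > (D' + r * L')\<^sup>2 * geo r k"
    by blast
  define u' where "u' i = (if i = i0 then \<sigma> else \<sigma> * r * u i)" for i
  let ?e = "\<lambda>j. if j = j0 then 1 else 0 :: real" and ?I = "insert i0 I'"
  have s2: "\<sigma> * \<sigma> = 1" "\<sigma>\<^sup>2 = 1"
    using A0 by auto
  have "nsq I' u' = (\<Sum>i\<in>I'. r\<^sup>2 * (u i)\<^sup>2)"
    unfolding nsq_def using fin s2 by (intro sum.cong) (auto simp: u'_def power_mult_distrib)
  then have nu': "nsq ?I u' = geo r (Suc k)"
    using fin s2 u by (simp add: nsq_insert u'_def geo_Suc sum_distrib_left[symmetric] nsq_def)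
  have tm0: "tm ?I A u' j0 = G"
    using fin A0 s2 by (auto simp: tm_def u'_def)
  have tmj: "tm ?I A u' j = \<sigma> * (H * f' j + r * tm I' A u j)" if "j \<in> J'" for j
  proof -
    have "tm ?I A u' j = H * f' j * \<sigma> + (\<Sum>i\<in>I'. A (i, j) * (\<sigma> * r * u i))"
      unfolding tm_def using fin h(1)[OF that] by (auto simp: u'_def intro!: sum.cong)
    then show ?thesis
      by (simp add: tm_def sum_distrib_left algebra_simps)
  qed
  have "ip J' ?e (tm ?I A u') = 0"
    unfolding ip_def using fin by (intro sum.neutral) auto
  then have ip: "ip (insert j0 J') ?e (tm ?I A u') = G"
    using fin tm0 by (simp add: ip_insert)
  have "nsq J' (tm ?I A u') = nsq J' (\<lambda>j. H * f' j + r * tm I' A u j)"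
    unfolding nsq_def using s2 tmj by (intro sum.cong) (auto simp: power_mult_distrib)
  then have "nsq (insert j0 J') (tm ?I A u') = G\<^sup>2 + nsq J' (\<lambda>j. H * f' j + r * tm I' A u j)"
    using fin tm0 by (simp add: nsq_insert)
  then show ?thesis
    unfolding low_bound_def using nu' ip u A0 by (intro exI[of _ u']) simp
qed

lemma good_step:
  assumes fin: "finite I'" "finite J'" "i0 \<notin> I'" "j0 \<notin> J'"
    and A0: "A (i0, j0) = \<sigma> * G" "\<And>i. i \<in> I' \<Longrightarrow> A (i, j0) = 0" "0 \<le> G" "G \<le> L" "k > 0 \<Longrightarrow> L' < G" "\<sigma> \<in> {1, -1}"
    and h: "\<And>j. j \<in> J' \<Longrightarrow> A (i0, j) = H * f' j" "0 \<le> H" "H \<le> D" "k > 0 \<Longrightarrow> D' < H" "k > 0 \<Longrightarrow> nsq J' f' = 1"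
    and IH: "good (k - 1) I' J' f' A"
  shows "good k (insert i0 I') (insert j0 J') (\<lambda>j. if j = j0 then 1 else 0) A"
proof -
  have "up_bound D L (insert i0 I') (insert j0 J') (\<lambda>j. if j = j0 then 1 else 0) A"
    using fin A0 h IH by (intro up_bound_step[where g = "\<sigma> * G" and H = H and f' = f']) (auto simp: good_def)
  moreover have "low_bound L' (geo r k) ((D' + r * L')\<^sup>2 * geo r (k - 1)) (insert i0 I') (insert j0 J') (\<lambda>j. if j = j0 then 1 else 0) A" if "k > 0"
    using low_bound_step[where k = "k - 1" and H = H and G = G and f' = f', OF fin A0(1,2) A0(5)[OF that] A0(6) h(1) h(4,5)[OF that]] IH that
    by (simp add: good_def)
  ultimately show ?thesis
    unfolding good_def by blast
qed

end

section \<open>Failure probability of the bidiagonalisation\<close>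

context bidiag
begin

lemma continuous_on_replace_col [continuous_intros]:
  "continuous_on S (\<lambda>A (i, j). if j = j0 then x i else A (i :: nat, j :: nat) :: real)"
proof (rule continuous_on_coordinatewise_then_product)
  fix n :: "nat \<times> nat"
  show "continuous_on S (\<lambda>A. case n of (i, j) \<Rightarrow> if j = j0 then x i else A (i, j))"
    by (cases n; cases "snd n = j0") (auto intro!: continuous_intros)
qed

text \<open>Every step removes one row and one column and costs \<open>t1 + t2\<close>, and
  \<open>t3 + t4\<close> as long as lower bounds are still due. At most \<open>k0\<close> rows or
  columns may be missing for the lower tails; the assumptions on \<open>k\<close> say that the
  remaining steps fit into this allowance. The bound holds for every unit \<open>f\<close>, which is
  what the induction uses for the random direction of the removed row.\<close>

lemma emeasure_not_good:
  assumes tails: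
      "\<And>K :: (nat \<times> nat) set. finite K \<Longrightarrow> card K \<le> m \<Longrightarrow> gauss_prob K (\<lambda>z. D\<^sup>2 \<le> nsq K z) \<le> t1"
      "\<And>K :: (nat \<times> nat) set. finite K \<Longrightarrow> card K \<le> N \<Longrightarrow> gauss_prob K (\<lambda>z. L\<^sup>2 \<le> nsq K z) \<le> t2"
      "\<And>K :: (nat \<times> nat) set. finite K \<Longrightarrow> m \<le> card K + k0 \<Longrightarrow> gauss_prob K (\<lambda>z. nsq K z \<le> D'\<^sup>2) \<le> t3"
      "\<And>K :: (nat \<times> nat) set. finite K \<Longrightarrow> N \<le> card K + k0 \<Longrightarrow> gauss_prob K (\<lambda>z. nsq K z \<le> L'\<^sup>2) \<le> t4"
    and k0: "k0 \<le> N" "k0 \<le> m"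
    and I: "finite I" "card I \<le> N" and J: "finite J" "card J \<le> m"
    and k: "k > 0 \<Longrightarrow> k + N \<le> card I + k0" "k > 0 \<Longrightarrow> k + m \<le> card J + k0"
    and f: "J \<noteq> {} \<Longrightarrow> nsq J f = 1"
  shows "gauss_prob (I \<times> J) (\<lambda>A. \<not> good k I J f A)
    \<le> of_nat (card I) * (t1 + t2) + of_nat k * (t3 + t4)"
  using I J k f
proof (induction "card I" arbitrary: I J k f rule: less_induct)
  case less
  note I = \<open>finite I\<close> \<open>card I \<le> N\<close> and J = \<open>finite J\<close> \<open>card J \<le> m\<close>
  note k = less.prems(5,6) and f = less.prems(7)
  consider "J = {}" | "J \<noteq> {}" "I = {}" | "I \<noteq> {}" "J \<noteq> {}"
    by blast
  then show ?case
  proof cases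
    case 1
    \<comment> \<open>A positive \<open>k\<close> with \<open>k0 \<le> m\<close> forces
      \<open>J\<close> to be nonempty; similarly for \<open>I\<close> below.\<close>
    then have "k = 0" using k k0 by auto
    then have "good k I J f A" for A
      using 1 nonneg by (auto simp: good_def up_bound_def nsq_def[of "{}"])
    then show ?thesis by simp
  next
    case 2
    then have "k = 0" using k k0 by auto
    moreover have "nsq J (\<lambda>j. \<alpha> * f j) = \<alpha>\<^sup>2" for \<alpha>
      using f[OF 2(1)] by (simp add: nsq_def power_mult_distrib sum_distrib_left[symmetric])
    ultimately have "good k I J f A" for A
      using 2 nonneg by (simp add: good_def up_bound_def tm_def nsq_def[of "{}"])
    then show ?thesis by simp
  next
    case 3
    then obtain i0 j0 where ij0: "i0 \<in> I" "j0 \<in> J" by auto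
    define I' J' where "I' = I - {i0}" and "J' = J - {j0}"
    have I': "I = insert i0 I'" "i0 \<notin> I'" "finite I'" "card I = Suc (card I')"
      and J': "J = insert j0 J'" "j0 \<notin> J'" "finite J'" "card J = Suc (card J')"
      using I J ij0 by (auto simp: I'_def J'_def card.remove[where A = I] card.remove[where A = J] simp del: card_Diff_insert)
    let ?G = "\<lambda>K :: (nat \<times> nat) set. gauss_space K"
    let ?e = "\<lambda>j. if j = j0 then 1 else 0 :: real"
    \<comment> \<open>The reduction to an axis asks for a vector that vanishes off the index
      set.\<close>
    define F where "F j = (if j \<in> J then f j else 0)" for j
    \<comment> \<open>Lower tails are charged only while \<open>k > 0\<close>.\<close>
    define pk :: ennreal where "pk = (if k > 0 then 1 else 0)"
    have FJ: "nsq J F = 1"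
      using f 3 by (simp add: F_def nsq_def)
    have "gauss_event (I \<times> J) (\<lambda>A. \<not> good k I J f A) = gauss_event (I \<times> J) (\<lambda>A. \<not> good k I J F A)"
      using good_cong[of I J _ _ f F] by (auto simp: F_def)
    moreover have "\<exists>\<sigma>\<in>{1, -1}. gauss_prob (I \<times> J) (\<lambda>A. \<not> good k I J F A) =
       gauss_prob (I \<times> J) (\<lambda>A. \<not> good k I J (\<lambda>j. if j = j0 then \<sigma> * sqrt (nsq J F) else 0) A)"
      by (rule emeasure_rotate_to_axis_cols[where P = "\<lambda>f A. \<not> good k I J f A"])
        (use I J ij0 good_col_rot not_good_sets[OF continuous_on_id] in \<open>auto simp: F_def\<close>)
    moreover have "good k I J (\<lambda>j. if j = j0 then - 1 else 0) A = good k I J ?e A" for A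
      using good_uminus[of k I J ?e A] by (simp add: if_distrib[of uminus] cong: if_cong)
    ultimately have red1: "gauss_prob (I \<times> J) (\<lambda>A. \<not> good k I J f A) =
       gauss_prob (I \<times> J) (\<lambda>A. \<not> good k I J ?e A)"
      using FJ by (auto cong: if_cong)
    define B where "B = gauss_event (I \<times> J) (\<lambda>A. \<not> good k I J ?e A)"
    have B: "B \<in> sets (?G (I \<times> J))"
      unfolding B_def by (rule not_good_sets) (rule continuous_on_id)
    let ?K1 = "I \<times> {j0}" and ?K2 = "I \<times> J'" and ?L1 = "{i0} \<times> J'" and ?L2 = "I' \<times> J'"
    have K12: "?K1 \<union> ?K2 = I \<times> J" "?K1 \<inter> ?K2 = {}" "finite ?K1" "finite ?K2"
      and L12: "?L1 \<union> ?L2 = I \<times> J'" "?L1 \<inter> ?L2 = {}" "finite ?L1" "finite ?L2"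
      using I' J' by auto
    have [measurable]: "(\<lambda>z. nsq K z) \<in> borel_measurable (?G K)" for K
      unfolding nsq_def by measurable
    define bad1 where "bad1 = gauss_event ?K1 (\<lambda>z. L\<^sup>2 \<le> nsq ?K1 z) \<union> gauss_event ?K1 (\<lambda>z. k > 0 \<and> nsq ?K1 z \<le> L'\<^sup>2)"
    define bad2 where "bad2 = gauss_event ?L1 (\<lambda>z. D\<^sup>2 \<le> nsq ?L1 z) \<union> gauss_event ?L1 (\<lambda>z. k > 0 \<and> nsq ?L1 z \<le> D'\<^sup>2)"
    have bad1_sets: "bad1 \<in> sets (?G ?K1)" and bad2_sets: "bad2 \<in> sets (?G ?L1)"
      unfolding bad1_def bad2_def by measurable
    have card: "card ?K1 = card I" "card ?L1 = card J'"
      by (simp_all add: card_cartesian_product)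
    have "emeasure (?G ?K1) bad1 \<le> gauss_prob ?K1 (\<lambda>z. L\<^sup>2 \<le> nsq ?K1 z) +
       gauss_prob ?K1 (\<lambda>z. k > 0 \<and> nsq ?K1 z \<le> L'\<^sup>2)"
      unfolding bad1_def by (rule emeasure_subadditive) measurable
    also have "\<dots> \<le> t2 + pk * t4"
    proof (rule add_mono)
      show "gauss_prob ?K1 (\<lambda>z. L\<^sup>2 \<le> nsq ?K1 z) \<le> t2"
        using K12(3) I(2) by (intro tails(2)) (simp_all only: card)
      show "gauss_prob ?K1 (\<lambda>z. k > 0 \<and> nsq ?K1 z \<le> L'\<^sup>2) \<le> pk * t4"
      proof (cases "k > 0")
        case True
        then have "N \<le> card ?K1 + k0"
          using k(1) unfolding card by linarith
        then show ?thesis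
          using tails(4)[OF K12(3)] True by (simp add: pk_def)
      qed simp
    qed
    finally have bad1: "emeasure (?G ?K1) bad1 \<le> t2 + pk * t4" .
    have "emeasure (?G ?L1) bad2 \<le> gauss_prob ?L1 (\<lambda>z. D\<^sup>2 \<le> nsq ?L1 z) +
       gauss_prob ?L1 (\<lambda>z. k > 0 \<and> nsq ?L1 z \<le> D'\<^sup>2)"
      unfolding bad2_def by (rule emeasure_subadditive) measurable
    also have "\<dots> \<le> t1 + pk * t3"
    proof (rule add_mono)
      show "gauss_prob ?L1 (\<lambda>z. D\<^sup>2 \<le> nsq ?L1 z) \<le> t1"
        using L12(3) J(2) J'(4) by (intro tails(1)) (simp_all only: card)
      show "gauss_prob ?L1 (\<lambda>z. k > 0 \<and> nsq ?L1 z \<le> D'\<^sup>2) \<le> pk * t3"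
      proof (cases "k > 0")
        case True
        then have "m \<le> card ?L1 + k0"
          using k(2) J'(4) unfolding card by linarith
        then show ?thesis
          using tails(3)[OF L12(3)] True by (simp add: pk_def)
      qed simp
    qed
    finally have bad2: "emeasure (?G ?L1) bad2 \<le> t1 + pk * t3" .
    define t where "t = of_nat (card I') * (t1 + t2) + of_nat (k - 1) * (t3 + t4)"
    \<comment> \<open>First conditioning: the column \<open>j0\<close>, which is the direction
      \<open>f\<close> after the rotation of the columns, is frozen. Rotating the rows then leaves
      only its length, in row \<open>i0\<close>.\<close>
    have "emeasure (?G (?K1 \<union> ?K2)) B \<le> emeasure (?G ?K1) bad1 + (emeasure (?G ?L1) bad2 + t)"
    proof (rule emeasure_gauss_space_fold_le[OF K12(3,4,2)])
      show "B \<in> sets (?G (?K1 \<union> ?K2))" using B K12 by simp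
      show "bad1 \<in> sets (?G ?K1)" by (rule bad1_sets)
      fix z assume z: "z \<in> space (?G ?K1)" "z \<notin> bad1"
      define x where "x i = (if i \<in> I then z (i, j0) else 0)" for i
      define \<rho> where "\<rho> = sqrt (nsq I x)"
      have nx: "nsq I x = nsq ?K1 z"
        unfolding nsq_def by (simp add: x_def sum.cartesian_product')
      have \<rho>: "0 \<le> \<rho>" "\<rho> \<le> L" "k > 0 \<Longrightarrow> L' < \<rho>"
        using z nonneg by (auto simp: bad1_def \<rho>_def nx not_le real_sqrt_le_iff real_le_lsqrt intro!: real_less_rsqrt real_le_lsqrt)
      define P where "P = (\<lambda>x y. good k I J ?e (\<lambda>(i, j). if j = j0 then x i else y (i, j)))"
      have P_sets: "gauss_event K (\<lambda>y. \<not> P x y) \<in> sets (?G K)" for x K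
        unfolding P_def by (rule not_good_sets) (rule continuous_on_replace_col)
      have "gauss_event ?K2 (\<lambda>y. merge ?K1 ?K2 (z, y) \<in> B) = gauss_event ?K2 (\<lambda>y. \<not> P x y)"
      proof -
        have "(merge ?K1 ?K2 (z, y) \<in> B) = (\<not> P x y)" if y: "y \<in> space (?G ?K2)" for y
        proof -
          have "merge ?K1 ?K2 (z, y) \<in> space (?G (I \<times> J))"
            using z y K12 by (auto simp: space_PiM PiE_def merge_def extensional_def)
          moreover have "good k I J ?e (merge ?K1 ?K2 (z, y)) = P x y"
            unfolding P_def by (rule good_cong) (auto simp: merge_def x_def J')
          ultimately show ?thesis by (simp add: B_def)
        qed
        then show ?thesis by auto
      qed
      moreover have "\<exists>\<sigma>\<in>{1, -1}. gauss_prob ?K2 (\<lambda>y. \<not> P x y) =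
         gauss_prob ?K2 (\<lambda>y. \<not> P (\<lambda>i. if i = i0 then \<sigma> * sqrt (nsq I x) else 0) y)"
      proof (rule emeasure_rotate_to_axis[where P = "\<lambda>x y. \<not> P x y"])
        fix x A p q and c s :: real
        assume pq: "p \<in> I" "q \<in> I" "p \<noteq> q" "c\<^sup>2 + s\<^sup>2 = 1"
        have "P (plane_rot p q c s x) (row_rot J' p q c s A) =
          good k I J ?e (row_rot J p q c s (\<lambda>(i, j). if j = j0 then x i else A (i, j)))"
          unfolding P_def by (intro arg_cong[where f = "good k I J ?e"]) (auto simp: fun_eq_iff row_rot_def J' plane_rot_def)
        also have "\<dots> = P x A"
          unfolding P_def by (rule good_row_rot) (use I pq in auto)
        finally show "(\<not> P (plane_rot p q c s x) (row_rot J' p q c s A)) = (\<not> P x A)" by simp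
      qed (use I' J' ij0 P_sets in \<open>auto simp: x_def\<close>)
      ultimately obtain \<sigma> :: real where \<sigma>: "\<sigma> \<in> {1, -1}"
        and red2: "gauss_prob ?K2 (\<lambda>y. merge ?K1 ?K2 (z, y) \<in> B) =
          gauss_prob ?K2 (\<lambda>y. \<not> P (\<lambda>i. if i = i0 then \<sigma> * \<rho> else 0) y)"
        unfolding \<rho>_def by auto
      let ?x = "\<lambda>i. if i = i0 then \<sigma> * \<rho> else 0"
      define C where "C = gauss_event ?K2 (\<lambda>y. \<not> P ?x y)"
      \<comment> \<open>Second conditioning: the rest of row \<open>i0\<close> is frozen. Its length
        is the diagonal entry \<open>H\<close>, its direction \<open>f'\<close> the starting vector
        of the next step.\<close>
      have "emeasure (?G (?L1 \<union> ?L2)) C \<le> emeasure (?G ?L1) bad2 + t"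
      proof (rule emeasure_gauss_space_fold_le[OF L12(3,4,2)])
        show "C \<in> sets (?G (?L1 \<union> ?L2))" using P_sets L12 by (simp add: C_def)
        show "bad2 \<in> sets (?G ?L1)" by (rule bad2_sets)
        fix h assume h: "h \<in> space (?G ?L1)" "h \<notin> bad2"
        define H where "H = sqrt (nsq ?L1 h)"
        have H: "0 \<le> H" "H \<le> D" "k > 0 \<Longrightarrow> D' < H"
          using h nonneg by (auto simp: bad2_def H_def not_le real_sqrt_le_iff real_le_lsqrt intro!: real_less_rsqrt real_le_lsqrt)
        have nH: "H\<^sup>2 = nsq J' (\<lambda>j. h (i0, j))"
          unfolding H_def by (simp add: nsq_def sum.cartesian_product' sum_nonneg)
        have "sqrt (nsq J' (\<lambda>j. h (i0, j))) = H"
          using H(1) by (simp add: nH[symmetric])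
        then obtain f' where f': "J' \<noteq> {} \<Longrightarrow> nsq J' f' = 1" and hf: "\<And>j. j \<in> J' \<Longrightarrow> h (i0, j) = H * f' j"
          using ex_unit_direction[OF J'(3), of "\<lambda>j. h (i0, j)"] by metis
        have J'k: "nsq J' f' = 1" if "k > 0"
        proof (rule f')
          show "J' \<noteq> {}"
          proof
            assume "J' = {}"
            then have "H = 0" using nH by (simp add: nsq_def)
            then show False using H(3)[OF that] nonneg by simp
          qed
        qed
        have "gauss_event ?L2 (\<lambda>y. merge ?L1 ?L2 (h, y) \<in> C) \<subseteq> gauss_event ?L2 (\<lambda>y. \<not> good (k - 1) I' J' f' y)"
        proof (intro subsetI CollectI conjI notI; elim CollectE conjE)
          fix y assume y: "y \<in> space (?G ?L2)" "merge ?L1 ?L2 (h, y) \<in> C" and g: "good (k - 1) I' J' f' y"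
          define A where "A = (\<lambda>(i, j). if j = j0 then ?x i else merge ?L1 ?L2 (h, y) (i, j))"
          have g': "good (k - 1) I' J' f' A"
            using g by (subst good_cong[where B = y and g = f']) (use I' J' in \<open>auto simp: A_def merge_def\<close>)
          have "good k (insert i0 I') (insert j0 J') ?e A"
          proof (rule good_step[where G = \<rho> and H = H and f' = f'])
            show "A (i0, j) = H * f' j" if "j \<in> J'" for j
              using that hf J' by (auto simp: A_def merge_def)
            show "A (i, j0) = 0" if "i \<in> I'" for i
              using that I' by (auto simp: A_def)
          qed (use I' J' \<sigma> \<rho> H J'k g' in \<open>auto simp: A_def\<close>)
          then have "P ?x (merge ?L1 ?L2 (h, y))"
            by (simp add: P_def A_def I'(1)[symmetric] J'(1)[symmetric])
          then show False using y by (simp add: C_def)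
        qed
        then have "gauss_prob ?L2 (\<lambda>y. merge ?L1 ?L2 (h, y) \<in> C) \<le>
           gauss_prob ?L2 (\<lambda>y. \<not> good (k - 1) I' J' f' y)"
          by (rule emeasure_mono) (rule not_good_sets, rule continuous_on_id)
        also have "\<dots> \<le> t"
          unfolding t_def by (rule less.hyps) (use I' J' less.prems f' in auto)
        finally show "gauss_prob ?L2 (\<lambda>y. merge ?L1 ?L2 (h, y) \<in> C) \<le> t" .
      qed
      then show "gauss_prob ?K2 (\<lambda>y. merge ?K1 ?K2 (z, y) \<in> B) \<le> emeasure (?G ?L1) bad2 + t"
        unfolding red2 C_def[symmetric] L12(1) .
    qed
    also have "\<dots> \<le> (t2 + pk * t4) + ((t1 + pk * t3) + t)"
      by (intro add_mono bad1 bad2 order_refl)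
    also have "\<dots> = of_nat (card I) * (t1 + t2) + of_nat k * (t3 + t4)"
    proof -
      have k_eq: "of_nat k = (pk + of_nat (k - 1) :: ennreal)"
        by (cases k) (auto simp: pk_def)
      show ?thesis
        unfolding t_def k_eq I'(4) by (simp add: distrib_right distrib_left add_ac)
    qed
    finally show ?thesis
      unfolding red1 B_def[symmetric] K12(1) .
  qed
qed

end

section \<open>The spiked matrix\<close>

definition spiked_tm :: "nat set \<Rightarrow> (nat \<Rightarrow> real) \<Rightarrow> (nat \<Rightarrow> real) \<Rightarrow> real \<Rightarrow> (nat \<times> nat \<Rightarrow> real) \<Rightarrow> (nat \<Rightarrow> real) \<Rightarrow> nat \<Rightarrow> real" where
  "spiked_tm I x y s A u j = tm I A u j + s * ip I x u * y j"

lemma spiked_tm_row_rot: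
  assumes "finite I" "p \<in> I" "q \<in> I" "p \<noteq> q" "c\<^sup>2 + s\<^sup>2 = 1" "j \<in> J"
  shows "spiked_tm I (plane_rot p q c s x) y b (row_rot J p q c s A) (plane_rot p q c s u) j = spiked_tm I x y b A u j"
  using assms by (simp add: spiked_tm_def tm_row_rot ip_plane_rot)

lemma continuous_on_spiked_tm [continuous_intros]: "continuous_on S (\<lambda>A. spiked_tm I x y s A u j)"
  unfolding spiked_tm_def by (intro continuous_intros)

context bidiag
begin

text \<open>\<open>good\<close> for the rows orthogonal to \<open>x\<close>, with \<open>f\<close>
  the direction of the spiked row, written without coordinates. The lower bounds are multiplied by
  the length of that row: no quotient occurs, every clause is open or closed, and a vanishing row
  falls under the first alternative. The clauses on \<open>tm I A x\<close> locate the length of the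
  spiked row.\<close>

definition top_good :: "real \<Rightarrow> nat \<Rightarrow> nat set \<Rightarrow> nat set \<Rightarrow> (nat \<Rightarrow> real) \<Rightarrow> (nat \<Rightarrow> real) \<Rightarrow> real \<Rightarrow> (nat \<times> nat \<Rightarrow> real) \<Rightarrow> bool" where
  "top_good t k I J x y s A \<longleftrightarrow>
     (D'\<^sup>2 \<le> nsq J (tm I A x) \<and> nsq J (tm I A x) \<le> D\<^sup>2 \<and> \<bar>ip J (tm I A x) y\<bar> \<le> t) \<and>
     (\<forall>u. sqrt (nsq J (spiked_tm I x y s A u)) \<le>
        sqrt (nsq J (spiked_tm I x y s A x) * (ip I x u)\<^sup>2 + D\<^sup>2 * (nsq I u - (ip I x u)\<^sup>2)) + L * sqrt (nsq I u - (ip I x u)\<^sup>2)) \<and>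
     (nsq J (spiked_tm I x y s A x) \<le> 0 \<or>
      (\<exists>u. nsq I u = geo r k \<and> ip I x u = 0 \<and>
        L' * sqrt (nsq J (spiked_tm I x y s A x)) < ip J (spiked_tm I x y s A x) (tm I A u) \<and>
        nsq J (spiked_tm I x y s A x) * ((D' + r * L')\<^sup>2 * geo r (k - 1)) <
          nsq J (spiked_tm I x y s A x) * nsq J (tm I A u) - (ip J (spiked_tm I x y s A x) (tm I A u))\<^sup>2))"

lemma top_good_sets: "gauss_event K (\<lambda>A. top_good t k I J x y s A) \<in> sets (gauss_space K)"
  unfolding top_good_def
  by (intro sets.sets_Collect_conj sets.sets_Collect_disj; (rule gauss_space_closed_sets gauss_space_open_sets),
     (intro closed_Collect_conj closed_Collect_all closed_Collect_le open_Collect_ex open_Collect_conj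
       open_Collect_less open_Collect_const continuous_intros))

lemma top_good_row_rot:
  assumes I: "finite I" "p \<in> I" "q \<in> I" "p \<noteq> q" "c\<^sup>2 + s\<^sup>2 = 1"
  shows "top_good t k I J (plane_rot p q c s x) y b (row_rot J p q c s A) = top_good t k I J x y b A"
proof -
  let ?R = "plane_rot p q c s"
  let ?A = "row_rot J p q c s A"
  have "nsq J (tm I ?A (?R u)) = nsq J (tm I A u)"
    and "nsq J (spiked_tm I (?R x) y b ?A (?R u)) = nsq J (spiked_tm I x y b A u)"
    and "ip J (spiked_tm I (?R x) y b ?A (?R x)) (tm I ?A (?R u)) = ip J (spiked_tm I x y b A x) (tm I A u)"
    and "ip J (tm I ?A (?R u)) y = ip J (tm I A u) y" for u
    by (intro nsq_cong ip_cong refl spiked_tm_row_rot tm_row_rot I; assumption)+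
  then show ?thesis
    unfolding top_good_def
    by (subst all_plane_rot[OF I(4,5)], subst ex_plane_rot[OF I(4,5)]) (simp add: nsq_plane_rot[OF I] ip_plane_rot[OF I])
qed

text \<open>With \<open>x\<close> on the axis of \<open>i0\<close> the spike sits in row
  \<open>i0\<close> only, so the other rows are pure noise and the spiked row plays the part of
  \<open>\<alpha> * f\<close> in \<open>up_bound\<close>.\<close>

lemma top_good_axis:
  assumes fin: "finite I'" "finite J" "i0 \<notin> I'" and \<sigma>: "\<sigma> \<in> {1, -1}"
    and x: "x = (\<lambda>i. if i = i0 then \<sigma> else 0)"
    and f: "\<And>j. j \<in> J \<Longrightarrow> \<sigma> * A (i0, j) + s * y j = sqrt (nsq J (\<lambda>j. \<sigma> * A (i0, j) + s * y j)) * f j"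
    and h: "D'\<^sup>2 \<le> nsq J (\<lambda>j. A (i0, j))" "nsq J (\<lambda>j. A (i0, j)) \<le> D\<^sup>2" "\<bar>ip J (\<lambda>j. A (i0, j)) y\<bar> \<le> t"
    and good: "good k I' J f A" and k: "k > 0"
  shows "top_good t k (insert i0 I') J x y s A"
proof -
  let ?I = "insert i0 I'"
  define S where "S = sqrt (nsq J (\<lambda>j. \<sigma> * A (i0, j) + s * y j))"
  have S: "0 \<le> S" by (simp add: S_def)
  have s2: "\<sigma> * \<sigma> = 1" "\<sigma>\<^sup>2 = 1"
    using \<sigma> by auto
  have tm: "tm ?I A u j = A (i0, j) * u i0 + tm I' A u j" for u j
    using fin by (simp add: tm_def)
  have xi0: "x i0 = \<sigma>"
    by (simp add: x)
  have "ip I' x u = 0" for u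
    unfolding ip_def using fin by (intro sum.neutral) (auto simp: x)
  then have ipx: "ip ?I x u = \<sigma> * u i0" for u
    using fin by (simp add: ip_insert xi0)
  have "tm I' A x j = 0" for j
    unfolding tm_def using fin by (intro sum.neutral) (auto simp: x)
  then have tmx: "tm ?I A x j = \<sigma> * A (i0, j)" for j
    by (simp add: tm xi0)
  have w: "spiked_tm ?I x y s A x j = S * f j" if "j \<in> J" for j
    using f[OF that] s2 by (simp add: spiked_tm_def tmx ipx xi0 S_def)
  have nw: "nsq J (spiked_tm ?I x y s A x) = S\<^sup>2"
    using s2 by (simp add: spiked_tm_def[abs_def] tmx ipx xi0 S_def)
  have n: "nsq ?I u - (ip ?I x u)\<^sup>2 = nsq I' u" and ipx2: "(ip ?I x u)\<^sup>2 = (u i0)\<^sup>2" for u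
    using fin s2 by (simp_all add: nsq_insert ipx power_mult_distrib)
  have spiked: "spiked_tm ?I x y s A u j = (\<sigma> * u i0 * S) * f j + tm I' A u j" if "j \<in> J" for u j
  proof -
    have "(\<sigma> * u i0 * S) * f j = \<sigma> * u i0 * (\<sigma> * A (i0, j) + s * y j)"
      using f[OF that] by (simp add: S_def)
    also have "\<dots> = (\<sigma> * \<sigma>) * u i0 * A (i0, j) + s * (\<sigma> * u i0) * y j"
      by (simp add: algebra_simps)
    finally show ?thesis
      using s2 by (simp add: spiked_tm_def tm ipx algebra_simps)
  qed
  have "nsq J (tm ?I A x) = nsq J (\<lambda>j. A (i0, j))"
    using s2 by (simp add: nsq_def tmx power_mult_distrib)
  moreover have "\<bar>ip J (tm ?I A x) y\<bar> = \<bar>ip J (\<lambda>j. A (i0, j)) y\<bar>"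
    using \<sigma> by (auto simp: ip_def tmx sum_negf)
  moreover have "sqrt (nsq J (spiked_tm ?I x y s A u)) \<le> sqrt (S\<^sup>2 * (u i0)\<^sup>2 + D\<^sup>2 * nsq I' u) + L * sqrt (nsq I' u)" for u
  proof -
    have "nsq J (spiked_tm ?I x y s A u) = nsq J (\<lambda>j. (\<sigma> * u i0 * S) * f j + tm I' A u j)"
      using spiked by (intro nsq_cong) auto
    moreover have "(\<sigma> * u i0 * S)\<^sup>2 = S\<^sup>2 * (u i0)\<^sup>2"
      using s2 by (simp add: power_mult_distrib)
    ultimately show ?thesis
      using good[unfolded good_def up_bound_def, THEN conjunct1, rule_format, of "\<sigma> * u i0 * S" u] by simp
  qed
  moreover have "\<exists>u. nsq ?I u = geo r k \<and> ip ?I x u = 0 \<and> L' * S < ip J (spiked_tm ?I x y s A x) (tm ?I A u) \<and>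
        S\<^sup>2 * ((D' + r * L')\<^sup>2 * geo r (k - 1)) <
          S\<^sup>2 * nsq J (tm ?I A u) - (ip J (spiked_tm ?I x y s A x) (tm ?I A u))\<^sup>2" if S0: "S > 0"
  proof -
    obtain u where u: "nsq I' u = geo r k" "ip J f (tm I' A u) > L'" "nsq J (tm I' A u) - (ip J f (tm I' A u))\<^sup>2 > (D' + r * L')\<^sup>2 * geo r (k - 1)"
      using good k unfolding good_def low_bound_def by blast
    define u' where "u' = u(i0 := 0)"
    have tmu': "tm ?I A u' j = tm I' A u j" for j
      unfolding tm using fin by (auto simp: u'_def tm_def intro!: sum.cong)
    have ip': "ip J (spiked_tm ?I x y s A x) (tm ?I A u') = S * ip J f (tm I' A u)"
      using w by (simp add: ip_def tmu' sum_distrib_left mult.assoc)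
    have "nsq I' u' = nsq I' u"
      using fin by (intro nsq_cong) (auto simp: u'_def)
    then have "nsq ?I u' = geo r k"
      using fin u by (simp add: nsq_insert u'_def)
    moreover have "S\<^sup>2 * ((D' + r * L')\<^sup>2 * geo r (k - 1)) < S\<^sup>2 * (nsq J (tm I' A u) - (ip J f (tm I' A u))\<^sup>2)"
      using S0 u by (intro mult_strict_left_mono) auto
    moreover have "nsq J (tm ?I A u') = nsq J (tm I' A u)"
      using tmu' by (intro nsq_cong) auto
    moreover have "ip ?I x u' = 0"
      by (simp add: ipx u'_def)
    ultimately show ?thesis
      using S0 u by (intro exI[of _ u']) (simp add: ip' algebra_simps power_mult_distrib)
  qed
  moreover have "S = 0 \<or> 0 < S"
    using S by linarith
  ultimately show ?thesis
    unfolding top_good_def nw n using h S by (elim disjE) (auto simp: ipx2)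
qed

text \<open>Freezing the row of the spike costs the tails \<open>t1\<close>, \<open>t3\<close>,
  \<open>t5\<close> and fixes the direction \<open>f\<close> for the independent remaining rows.
  This row counts as one lost row, hence \<open>k < k0\<close>.\<close>

lemma emeasure_not_top_good:
  assumes tails:
      "\<And>K :: (nat \<times> nat) set. finite K \<Longrightarrow> card K \<le> m \<Longrightarrow> gauss_prob K (\<lambda>z. D\<^sup>2 \<le> nsq K z) \<le> t1"
      "\<And>K :: (nat \<times> nat) set. finite K \<Longrightarrow> card K \<le> N \<Longrightarrow> gauss_prob K (\<lambda>z. L\<^sup>2 \<le> nsq K z) \<le> t2"
      "\<And>K :: (nat \<times> nat) set. finite K \<Longrightarrow> m \<le> card K + k0 \<Longrightarrow> gauss_prob K (\<lambda>z. nsq K z \<le> D'\<^sup>2) \<le> t3"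
      "\<And>K :: (nat \<times> nat) set. finite K \<Longrightarrow> N \<le> card K + k0 \<Longrightarrow> gauss_prob K (\<lambda>z. nsq K z \<le> L'\<^sup>2) \<le> t4"
      "\<And>K (y :: nat \<times> nat \<Rightarrow> real). finite K \<Longrightarrow> nsq K y = 1 \<Longrightarrow> gauss_prob K (\<lambda>z. t \<le> \<bar>ip K z y\<bar>) \<le> t5"
    and k0: "k0 \<le> N" "k0 \<le> m" "0 < k" "k < k0"
    and I: "finite I" "card I = N" and J: "finite J" "card J = m"
    and x: "nsq I x = 1" "\<And>i. i \<notin> I \<Longrightarrow> x i = 0" and y: "nsq J y = 1"
  shows "gauss_prob (I \<times> J) (\<lambda>A. \<not> top_good t k I J x y s A)
    \<le> t1 + t3 + t5 + (of_nat N * (t1 + t2) + of_nat k * (t3 + t4))"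
proof -
  let ?G = "\<lambda>K :: (nat \<times> nat) set. gauss_space K"
  have "I \<noteq> {}" using I k0 by auto
  then obtain i0 where i0: "i0 \<in> I" by auto
  define I' where "I' = I - {i0}"
  have I': "I = insert i0 I'" "i0 \<notin> I'" "finite I'" "N = Suc (card I')"
    using I i0 by (auto simp: I'_def card.remove[where A = I] simp del: card_Diff_insert)
  have not_sets: "gauss_event K (\<lambda>A. \<not> top_good t k I J x y s A) \<in> sets (?G K)" for K x
    by (intro sets.sets_Collect_neg top_good_sets)
  have "\<exists>\<sigma>\<in>{1, -1}. gauss_prob (I \<times> J) (\<lambda>A. \<not> top_good t k I J x y s A) =
      gauss_prob (I \<times> J) (\<lambda>A. \<not> top_good t k I J (\<lambda>i. if i = i0 then \<sigma> * sqrt (nsq I x) else 0) y s A)"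
    by (rule emeasure_rotate_to_axis[where P = "\<lambda>x A. \<not> top_good t k I J x y s A"])
      (use I J i0 not_sets x(2) top_good_row_rot in auto)
  then obtain \<sigma> :: real where \<sigma>: "\<sigma> \<in> {1, -1}"
    and red: "gauss_prob (I \<times> J) (\<lambda>A. \<not> top_good t k I J x y s A) =
      gauss_prob (I \<times> J) (\<lambda>A. \<not> top_good t k I J (\<lambda>i. if i = i0 then \<sigma> else 0) y s A)"
    unfolding x(1) real_sqrt_one mult_1_right by blast
  let ?x = "\<lambda>i. if i = i0 then \<sigma> else 0"
  define B where "B = gauss_event (I \<times> J) (\<lambda>A. \<not> top_good t k I J ?x y s A)"
  let ?K1 = "{i0} \<times> J" and ?K2 = "I' \<times> J"
  have K12: "?K1 \<union> ?K2 = I \<times> J" "?K1 \<inter> ?K2 = {}" "finite ?K1" "finite ?K2"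
    using I' J by auto
  have card: "card ?K1 = m" using J by (simp add: card_cartesian_product)
  have [measurable]: "(\<lambda>z. nsq K z) \<in> borel_measurable (?G K)" "(\<lambda>z. ip K z Y) \<in> borel_measurable (?G K)" for K Y
    unfolding nsq_def ip_def by measurable
  define Y where "Y = (\<lambda>(i :: nat, j). y j)"
  define b1 b3 b5 where "b1 = gauss_event ?K1 (\<lambda>z. D\<^sup>2 \<le> nsq ?K1 z)" and "b3 = gauss_event ?K1 (\<lambda>z. nsq ?K1 z \<le> D'\<^sup>2)"
    and "b5 = gauss_event ?K1 (\<lambda>z. t \<le> \<bar>ip ?K1 z Y\<bar>)"
  have b_sets [measurable]: "b1 \<in> sets (?G ?K1)" "b3 \<in> sets (?G ?K1)" "b5 \<in> sets (?G ?K1)"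
    unfolding b1_def b3_def b5_def by measurable
  have "nsq ?K1 Y = 1"
    using y by (simp add: nsq_def sum.cartesian_product' Y_def)
  then have b: "emeasure (?G ?K1) b1 \<le> t1" "emeasure (?G ?K1) b3 \<le> t3" "emeasure (?G ?K1) b5 \<le> t5"
    unfolding b1_def b3_def b5_def using tails(1,3,5) K12 card by auto
  have "emeasure (?G (?K1 \<union> ?K2)) B \<le> emeasure (?G ?K1) (b1 \<union> b3 \<union> b5) + (of_nat (card I') * (t1 + t2) + of_nat k * (t3 + t4))"
  proof (rule emeasure_gauss_space_fold_le[OF K12(3,4,2)])
    show "B \<in> sets (?G (?K1 \<union> ?K2))"
      using not_sets by (simp add: B_def K12)
    fix z assume z: "z \<in> space (?G ?K1)" "z \<notin> b1 \<union> b3 \<union> b5"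
    define w where "w j = \<sigma> * z (i0, j) + s * y j" for j
    obtain f where f: "J \<noteq> {} \<Longrightarrow> nsq J f = 1" and wf: "\<And>j. j \<in> J \<Longrightarrow> w j = sqrt (nsq J w) * f j"
      using ex_unit_direction[OF J(1), of w] by blast
    have nz: "nsq J (\<lambda>j. z (i0, j)) = nsq ?K1 z" and iz: "ip J (\<lambda>j. z (i0, j)) y = ip ?K1 z Y"
      by (simp_all add: nsq_def ip_def sum.cartesian_product' Y_def)
    have "gauss_event ?K2 (\<lambda>A. merge ?K1 ?K2 (z, A) \<in> B) \<subseteq> gauss_event ?K2 (\<lambda>A. \<not> good k I' J f A)"
    proof (intro subsetI CollectI conjI notI; elim CollectE conjE)
      fix A assume A: "merge ?K1 ?K2 (z, A) \<in> B" and g: "good k I' J f A"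
      let ?M = "merge ?K1 ?K2 (z, A)"
      have M0: "?M (i0, j) = z (i0, j)" if "j \<in> J" for j
        using that by (simp add: merge_def)
      have M1: "nsq J (\<lambda>j. ?M (i0, j)) = nsq ?K1 z" "ip J (\<lambda>j. ?M (i0, j)) y = ip ?K1 z Y"
        "nsq J (\<lambda>j. \<sigma> * ?M (i0, j) + s * y j) = nsq J w"
        unfolding nz[symmetric] iz[symmetric] using M0 by (auto intro!: nsq_cong ip_cong simp: w_def)
      have "good k I' J f ?M"
        using g by (subst good_cong[where B = A and g = f]) (use I' in \<open>auto simp: merge_def\<close>)
      then have "top_good t k (insert i0 I') J ?x y s ?M"
        using z M0 wf by (intro top_good_axis[where \<sigma> = \<sigma> and f = f] I'(2,3) J(1) \<sigma> k0(3) refl)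
          (auto simp: M1 b1_def b3_def b5_def w_def)
      then show False using A by (simp add: B_def I'(1)[symmetric])
    qed (simp add: space_PiM)
    then have "gauss_prob ?K2 (\<lambda>A. merge ?K1 ?K2 (z, A) \<in> B) \<le> gauss_prob ?K2 (\<lambda>A. \<not> good k I' J f A)"
      by (rule emeasure_mono) (rule not_good_sets, rule continuous_on_id)
    also have "\<dots> \<le> of_nat (card I') * (t1 + t2) + of_nat k * (t3 + t4)"
      by (rule emeasure_not_good[where m = m and N = N and ?k0.0 = k0]) (use tails(1-4) k0 I' J f in auto)
    finally show "gauss_prob ?K2 (\<lambda>A. merge ?K1 ?K2 (z, A) \<in> B) \<le> of_nat (card I') * (t1 + t2) + of_nat k * (t3 + t4)" .
  qed (rule sets.Un; (rule sets.Un)?; rule b_sets)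
  also have "emeasure (?G ?K1) (b1 \<union> b3 \<union> b5) \<le> emeasure (?G ?K1) (b1 \<union> b3) + emeasure (?G ?K1) b5"
    by (rule emeasure_subadditive) measurable
  also have "emeasure (?G ?K1) (b1 \<union> b3) \<le> emeasure (?G ?K1) b1 + emeasure (?G ?K1) b3"
    by (rule emeasure_subadditive) measurable
  finally have "emeasure (?G (I \<times> J)) B \<le> emeasure (?G ?K1) b1 + emeasure (?G ?K1) b3 + emeasure (?G ?K1) b5 + (of_nat (card I') * (t1 + t2) + of_nat k * (t3 + t4))"
    by (simp add: K12 add_right_mono)
  also have "\<dots> \<le> t1 + t3 + t5 + (of_nat N * (t1 + t2) + of_nat k * (t3 + t4))"
    using I'(4) by (intro add_mono b mult_right_mono) auto
  finally show ?thesis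
    unfolding red B_def .
qed

end

section \<open>Deterministic estimates for the overlap\<close>

lemma geo_closed_form: "geo r k * (1 - r\<^sup>2) = 1 - r ^ (2 * k)"
proof (induction k)
  case (Suc k)
  have "geo r (Suc k) * (1 - r\<^sup>2) = (1 - r\<^sup>2) + r\<^sup>2 * (geo r k * (1 - r\<^sup>2))"
    by (simp add: geo_Suc algebra_simps)
  also have "\<dots> = 1 - r ^ (2 * Suc k)"
    unfolding Suc.IH by (simp add: algebra_simps power2_eq_square)
  finally show ?case .
qed simp

lemma geo_nonneg: "0 \<le> geo r k"
  by (simp add: geo_def sum_nonneg power_mult)

lemma geo_ge_1: "k > 0 \<Longrightarrow> 1 \<le> geo r k"
  by (cases k) (simp_all add: geo_Suc geo_nonneg)

text \<open>Stability of the equality case of Cauchy-Schwarz. The deficit is the square of the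
  distance from the line of equality, so a deficit of order e^2 gives an error \<open>e\<close>. On
  the circle \<open>R\<close> falls as \<open>\<Delta>\<close> grows, so the exact maximiser lies
  between \<open>\<Delta>\<close> and \<open>L / b * R\<close>.\<close>

lemma quadratic_overlap_deviation:
  fixes A B L R \<Delta> :: real
  assumes B: "0 < B" and L: "0 < L" and A: "0 < A" and R: "0 \<le> R" "0 \<le> \<Delta>" "R\<^sup>2 + \<Delta>\<^sup>2 = A"
    and e: "0 \<le> e" "(1 + L\<^sup>2 / B) * A - (R + L / sqrt B * \<Delta>)\<^sup>2 \<le> e\<^sup>2"
  shows "\<bar>\<Delta> - sqrt (L\<^sup>2 * A / (B + L\<^sup>2))\<bar> \<le> e"
proof -
  define b where "b = sqrt B"
  have b: "0 < b" "b\<^sup>2 = B" using B by (simp_all add: b_def)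
  define D where "D = sqrt (L\<^sup>2 * A / (B + L\<^sup>2))"
  define R' where "R' = sqrt (A * B / (B + L\<^sup>2))"
  have BL: "B + L\<^sup>2 > 0" using B by (simp add: add_pos_nonneg)
  have D2: "D\<^sup>2 = L\<^sup>2 * A / (B + L\<^sup>2)" and R'2: "R'\<^sup>2 = A * B / (B + L\<^sup>2)" and D0: "0 \<le> D" and R'0: "0 \<le> R'"
    using A B BL by (simp_all add: D_def R'_def)
  have DR: "D = L / b * R'"
  proof -
    have "(L / b * R')\<^sup>2 = L\<^sup>2 / B * (A * B / (B + L\<^sup>2))"
      by (simp add: power_mult_distrib power_divide b R'2)
    also have "\<dots> = D\<^sup>2"
      using B by (simp add: D2)
    finally show ?thesis
      using D0 R'0 L b by (intro power2_eq_imp_eq[of D]) auto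
  qed
  have sumA: "R'\<^sup>2 + D\<^sup>2 = A"
    using BL by (simp add: D2 R'2 add_divide_distrib[symmetric] field_simps)
  \<comment> \<open>Lagrange's identity for the vectors \<open>(1, L / b)\<close> and \<open>(R, \<Delta>)\<close>\<close>
  have "(\<Delta> - L / b * R)\<^sup>2 = (1 + (L / b)\<^sup>2) * (R\<^sup>2 + \<Delta>\<^sup>2) - (R + L / b * \<Delta>)\<^sup>2"
    by (simp add: power2_eq_square algebra_simps add_divide_distrib)
  also have "\<dots> \<le> e\<^sup>2"
    using e(2) by (simp add: R(3) power_divide b b_def[symmetric])
  finally have dev: "\<bar>\<Delta> - L / b * R\<bar> \<le> e"
    using e(1) abs_le_square_iff[of "\<Delta> - L / b * R" e] by simp
  have "\<bar>\<Delta> - D\<bar> \<le> e"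
  proof (cases "\<Delta> \<ge> D")
    case True
    then have "D\<^sup>2 \<le> \<Delta>\<^sup>2" using D0 by (intro power_mono) auto
    then have "R\<^sup>2 \<le> R'\<^sup>2" using R(3) sumA by linarith
    then have "R \<le> R'" using R'0 by (rule power2_le_imp_le)
    then have "L / b * R \<le> D" unfolding DR using L b by (intro mult_left_mono) auto
    then show ?thesis using dev True by linarith
  next
    case False
    then have "\<Delta>\<^sup>2 \<le> D\<^sup>2" using R(2) by (intro power_mono) auto
    then have "R'\<^sup>2 \<le> R\<^sup>2" using R(3) sumA by linarith
    then have "R' \<le> R" using R(1) by (rule power2_le_imp_le)
    then have "D \<le> L / b * R" unfolding DR using L b by (intro mult_left_mono) auto
    then show ?thesis using dev False by linarith
  qed
  then show ?thesis by (simp add: D_def)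
qed

text \<open>Everything is measured in units of the squared spike strength: \<open>n\<close> and \<open>\<mu>\<close> are the two dimensions,
  \<open>A\<close> is the squared length of the first row, \<open>F\<close> the top eigenvalue, \<open>\<kappa>\<^sup>2\<close> the squared sine of the angle
  to the spike.\<close>

lemma top_eigenvalue_deficit:
  fixes C \<omega> \<delta> n \<mu> A F :: real and k :: nat
  defines "l \<equiv> (1 - \<delta>) * n" and "d \<equiv> (1 - \<delta>) * \<mu>"
  defines "q \<equiv> geo (sqrt (l * d)) k"
  assumes C: "1 \<le> C" and n: "0 < n" "n \<le> C" and \<mu>: "0 < \<mu>" "\<mu> \<le> C" and n\<mu>: "n * \<mu> \<le> \<omega>" "\<omega> < 1"
    and \<delta>: "0 < \<delta>" "8 * C * \<delta> \<le> 1" and k: "k > 0"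
    and A: "\<bar>A - 1 - \<mu>\<bar> \<le> \<delta> * (1 + 2 * \<mu>)"
    and F: "A * (1 + l)\<^sup>2 * q \<le> F * (1 + l * A * q)"
  shows "(1 + (1 + \<delta>) * n / (A - (1 + \<delta>) * \<mu>)) * A - F \<le> (168 * C ^ 3 * \<delta> + 12 * C ^ 4 * \<omega> ^ (k - 1)) * n"
proof -
  define B B' where "B = A - (1 + \<delta>) * \<mu>" and "B' = A - d"
  have \<delta>C: "\<delta> \<le> C * \<delta>"
    using \<delta> C mult_right_mono[of 1 C \<delta>] by simp
  then have \<delta>1: "\<delta> \<le> 1 / 8"
    using \<delta> by linarith
  have \<mu>C: "\<delta> * \<mu> \<le> C * \<delta>"
    using \<delta> \<mu> by (simp add: mult.commute mult_left_mono)
  have A1: "\<bar>A - 1 - \<mu>\<bar> \<le> 3 * (C * \<delta>)"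
    using A \<mu>C \<delta>C by (simp add: algebra_simps)
  have B1: "\<bar>B - 1\<bar> \<le> 4 * (C * \<delta>)" and B'1: "\<bar>B' - 1\<bar> \<le> 4 * (C * \<delta>)"
  proof -
    have "B - 1 = (A - 1 - \<mu>) - \<delta> * \<mu>" "B' - 1 = (A - 1 - \<mu>) + \<delta> * \<mu>" "0 \<le> \<delta> * \<mu>"
      using \<delta> \<mu> by (simp_all add: B_def B'_def d_def algebra_simps)
    then show "\<bar>B - 1\<bar> \<le> 4 * (C * \<delta>)" "\<bar>B' - 1\<bar> \<le> 4 * (C * \<delta>)"
      using A1 \<mu>C by linarith+
  qed
  have Ab: "A \<le> 3 * C" "1 / 2 \<le> A" and Bb: "1 / 2 \<le> B" and B'b: "1 / 2 \<le> B'"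
    using A1 B1 B'1 \<delta> \<mu> C by (simp_all add: abs_le_iff)
  have A2: "A\<^sup>2 \<le> 9 * C\<^sup>2"
    using power_mono[OF Ab(1), of 2] Ab by (simp add: power_mult_distrib)
  have l: "0 < l" "l \<le> n" and d: "0 < d" "d \<le> \<mu>"
    using \<delta> \<delta>1 n \<mu> by (simp_all add: l_def d_def mult_le_cancel_right)
  have ld: "l * d \<le> n * \<mu>" "0 \<le> l * d"
    using l d n by (auto intro!: mult_mono)
  have q: "1 \<le> q" "q * (1 - l * d) = 1 - (l * d) ^ k"
    using geo_ge_1[OF k] geo_closed_form[of "sqrt (l * d)" k] ld by (simp_all add: q_def power_mult)
  \<comment> \<open>The truncation error of the geometric series after \<open>k\<close> terms. One
    factor \<open>n\<close> is kept, since all errors must be relative to \<open>n\<close>.\<close>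
  define \<rho> where "\<rho> = (l * d) ^ k"
  have \<rho>: "0 \<le> \<rho>" "\<rho> \<le> C * \<omega> ^ (k - 1) * n"
  proof -
    show "0 \<le> \<rho>" using ld by (simp add: \<rho>_def)
    have "\<rho> = (l * d) * (l * d) ^ (k - 1)"
      using k by (simp add: \<rho>_def power_Suc[symmetric] del: power_Suc)
    also have "\<dots> \<le> (n * C) * \<omega> ^ (k - 1)"
    proof (rule mult_mono)
      show "l * d \<le> n * C"
        using ld n \<mu> by (meson mult_left_mono less_imp_le order_trans)
      show "(l * d) ^ (k - 1) \<le> \<omega> ^ (k - 1)"
        using ld n\<mu> by (intro power_mono) auto
    qed (use n C ld in auto)
    finally show "\<rho> \<le> C * \<omega> ^ (k - 1) * n" by (simp add: algebra_simps)
  qed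
  \<comment> \<open>\<open>V\<close> is the Rayleigh quotient bound from the test vector with
    \<open>k\<close> terms, \<open>W\<close> its limit for infinitely many terms, where
    \<open>1 / q\<close> becomes \<open>1 - l * d\<close>.\<close>
  define V W where "V = A * (1 + l)\<^sup>2 / (1 / q + l * A)" and "W = A * (1 + l)\<^sup>2 / (1 + l * B')"
  have den: "1 \<le> 1 + l * B'" "1 + l * B' \<le> 1 / q + l * A" "1 / q + l * A - (1 + l * B') \<le> \<rho>"
  proof -
    have "1 / q + l * A - (1 + l * B') = 1 / q - (1 - l * d)"
      by (simp add: B'_def algebra_simps)
    also have "\<dots> = \<rho> / q"
      using q by (simp add: \<rho>_def field_simps)
    finally have eq: "1 / q + l * A - (1 + l * B') = \<rho> / q" .
    have "0 \<le> \<rho> / q" "\<rho> / q \<le> \<rho>"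
      using q \<rho> by (auto simp: pos_divide_le_eq mult_le_cancel_left1)
    then show "1 + l * B' \<le> 1 / q + l * A" "1 / q + l * A - (1 + l * B') \<le> \<rho>"
      using eq by linarith+
    show "1 \<le> 1 + l * B'" using l B'b by simp
  qed
  have "V \<le> F"
  proof -
    have "A * (1 + l)\<^sup>2 \<le> F * (1 / q + l * A)"
    proof -
      have "A * (1 + l)\<^sup>2 * q / q \<le> F * (1 + l * A * q) / q"
        using F q by (intro divide_right_mono) auto
      moreover have "F * (1 + l * A * q) / q = F * (1 / q + l * A)" "A * (1 + l)\<^sup>2 * q / q = A * (1 + l)\<^sup>2"
        using q by (simp_all add: field_simps)
      ultimately show ?thesis by simp
    qed
    then show ?thesis
      using den unfolding V_def by (subst pos_divide_le_eq) auto
  qed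
  moreover have "W - V \<le> 12 * C ^ 4 * \<omega> ^ (k - 1) * n"
  proof -
    have W1: "W - V = A * (1 + l)\<^sup>2 * ((1 / q + l * A - (1 + l * B')) / ((1 + l * B') * (1 / q + l * A)))"
    proof -
      have ne: "1 + l * B' \<noteq> 0" "1 / q + l * A \<noteq> 0" using den by auto
      show ?thesis unfolding V_def W_def using ne by (simp add: divide_simps) (simp add: algebra_simps)
    qed
    also have "\<dots> \<le> (3 * C) * (2 * C)\<^sup>2 * \<rho>"
    proof (rule mult_mono)
      show "A * (1 + l)\<^sup>2 \<le> (3 * C) * (2 * C)\<^sup>2"
        using Ab l n C by (intro mult_mono power_mono) auto
      have "1 \<le> (1 + l * B') * (1 / q + l * A)"
        using den mult_mono[of 1 "1 + l * B'" 1 "1 / q + l * A"] by auto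
      then show "(1 / q + l * A - (1 + l * B')) / ((1 + l * B') * (1 / q + l * A)) \<le> \<rho>"
        using den \<rho> by (subst pos_divide_le_eq) (auto intro: order_trans mult_right_mono[of 1 _ \<rho>] simp: mult_le_cancel_left1)
      show "0 \<le> (1 / q + l * A - (1 + l * B')) / ((1 + l * B') * (1 / q + l * A))"
        using den by (intro divide_nonneg_nonneg mult_nonneg_nonneg) auto
    qed (use C in auto)
    also have "\<dots> \<le> (3 * C) * (2 * C)\<^sup>2 * (C * \<omega> ^ (k - 1) * n)"
      using \<rho> C by (intro mult_left_mono) auto
    also have "\<dots> = 12 * C ^ 4 * \<omega> ^ (k - 1) * n"
      by (simp add: eval_nat_numeral algebra_simps)
    finally show ?thesis .
  qed
  \<comment> \<open>The ratio of the test vector is the optimal one for \<open>B' = 1\<close>, so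
    the loss against the optimum is quadratic in \<open>B' - 1\<close>.\<close>
  moreover have "(1 + l / B') * A - W \<le> 96 * C ^ 3 * \<delta> * n"
  proof -
    have "(1 + l / B') * A - W = A * l * (B' - 1)\<^sup>2 / (B' * (1 + l * B'))"
    proof -
      have ne: "1 + l * B' \<noteq> 0" "B' \<noteq> 0" using den B'b by auto
      show ?thesis unfolding W_def using ne by (simp add: divide_simps power2_eq_square) (simp add: algebra_simps)
    qed
    also have "\<dots> \<le> A * l * (B' - 1)\<^sup>2 / (1 / 2)"
    proof -
      have "1 / 2 * 1 \<le> B' * (1 + l * B')"
        using den(1) B'b by (intro mult_mono) auto
      then have p: "1 / 2 \<le> B' * (1 + l * B')" by simp
      show ?thesis
        by (rule divide_left_mono[OF p]) (use Ab l p in auto)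
    qed
    also have "\<dots> \<le> (3 * C) * n * (4 * (C * \<delta>))\<^sup>2 / (1 / 2)"
    proof -
      have "(B' - 1)\<^sup>2 \<le> (4 * (C * \<delta>))\<^sup>2"
        using power_mono[OF B'1 abs_ge_zero, of 2] by simp
      then show ?thesis
        by (intro divide_right_mono mult_mono) (use Ab l n C in auto)
    qed
    also have "\<dots> = 96 * C ^ 3 * \<delta> * n * \<delta>"
      by (simp add: power2_eq_square power3_eq_cube algebra_simps)
    also have "\<dots> \<le> 96 * C ^ 3 * \<delta> * n"
      using C \<delta> \<delta>1 n by (intro mult_left_le) auto
    finally show ?thesis .
  qed
  \<comment> \<open>The gap between the upper constants \<open>1 + \<delta>\<close> and the lower
    constants \<open>1 - \<delta>\<close>.\<close>
  moreover have "(1 + (1 + \<delta>) * n / B) * A - (1 + l / B') * A \<le> 72 * C ^ 3 * \<delta> * n"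
  proof -
    have "(1 + (1 + \<delta>) * n / B) * A - (1 + l / B') * A = A\<^sup>2 * (2 * \<delta> * n) / (B * B')"
    proof -
      have ne: "B \<noteq> 0" "B' \<noteq> 0" using Bb B'b by auto
      have "(1 + (1 + \<delta>) * n / B) * A - (1 + l / B') * A = A * n * ((1 + \<delta>) * B' - (1 - \<delta>) * B) / (B * B')"
        using ne by (simp add: divide_simps l_def) (simp add: algebra_simps)
      also have "(1 + \<delta>) * B' - (1 - \<delta>) * B = 2 * \<delta> * A"
        by (simp add: B_def B'_def d_def algebra_simps)
      finally show ?thesis by (simp add: power2_eq_square algebra_simps)
    qed
    also have "\<dots> \<le> A\<^sup>2 * (2 * \<delta> * n) / (1 / 4)"
      using Bb B'b \<delta> n mult_mono[of "1/2" B "1/2" B'] by (intro divide_left_mono mult_pos_pos mult_nonneg_nonneg) auto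
    also have "\<dots> \<le> (9 * C\<^sup>2) * (2 * \<delta> * n) / (1 / 4)"
      using A2 \<delta> n by (intro divide_right_mono mult_right_mono) auto
    also have "\<dots> = 72 * C\<^sup>2 * \<delta> * n" by simp
    also have "\<dots> \<le> 72 * C ^ 3 * \<delta> * n"
      using C \<delta> n by (intro mult_right_mono mult_left_mono power_increasing) auto
    finally show ?thesis .
  qed
  ultimately have "(1 + (1 + \<delta>) * n / B) * A - F \<le> 12 * C ^ 4 * \<omega> ^ (k - 1) * n + 96 * C ^ 3 * \<delta> * n + 72 * C ^ 3 * \<delta> * n"
    by linarith
  then show ?thesis
    by (simp add: B_def algebra_simps)
qed

text \<open>The three summands come from the near-maximality of the overlap (with a square root of
  \<open>\<eta>\<close>, as stability loses a power), from the perturbed location of the maximiser,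
  and from replacing \<open>B\<close> by 1. It tends to 0 with \<open>\<delta>\<close> and
  \<open>\<eta>\<close>.\<close>

definition overlap_error :: "real \<Rightarrow> real \<Rightarrow> real \<Rightarrow> real" where
  "overlap_error C \<delta> \<eta> = (8 * C * sqrt \<eta> + \<eta>) + 44 * C\<^sup>2 * \<delta> + 4 * C * \<delta> * (32 * C\<^sup>2 + 2 * (8 * C * sqrt \<eta> + \<eta>))"

text \<open>The limit is the maximiser for the ideal values \<open>A = 1 + \<mu>\<close>,
  \<open>B = 1\<close>, squared subdiagonal \<open>n\<close>. The error is proportional to
  \<open>n\<close> because multiplication by the squared spike strength must give an error of order
  N however large the spike is.\<close>

lemma overlap_estimate:
  fixes C \<delta> \<eta> n \<mu> A F \<kappa> :: real
  assumes C: "1 \<le> C" and n: "0 < n" "n \<le> C" and \<mu>: "0 < \<mu>" "\<mu> \<le> C"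
    and \<delta>: "0 < \<delta>" "8 * C * \<delta> \<le> 1" and \<eta>: "0 \<le> \<eta>"
    and A: "\<bar>A - 1 - \<mu>\<bar> \<le> \<delta> * (1 + 2 * \<mu>)"
    and F: "(1 + (1 + \<delta>) * n / (A - (1 + \<delta>) * \<mu>)) * A - F \<le> \<eta> * n"
    and \<kappa>: "0 \<le> \<kappa>" "\<kappa> \<le> 1" and F0: "0 \<le> F"
    and F2: "sqrt F \<le> sqrt (A - (A - (1 + \<delta>) * \<mu>) * \<kappa>\<^sup>2) + sqrt ((1 + \<delta>) * n) * \<kappa>"
  shows "\<bar>\<kappa>\<^sup>2 - n * (1 + \<mu>) / (1 + n)\<bar> \<le> overlap_error C \<delta> \<eta> * n"
proof -
  define B where "B = A - (1 + \<delta>) * \<mu>"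
  define L where "L = sqrt ((1 + \<delta>) * n)"
  have \<delta>C: "\<delta> \<le> C * \<delta>"
    using \<delta> C mult_right_mono[of 1 C \<delta>] by simp
  then have \<delta>1: "\<delta> \<le> 1 / 8"
    using \<delta> by linarith
  have \<mu>C: "\<delta> * \<mu> \<le> C * \<delta>"
    using \<delta> \<mu> by (simp add: mult.commute mult_left_mono)
  have A1: "\<bar>A - 1 - \<mu>\<bar> \<le> 3 * (C * \<delta>)"
    using A \<mu>C \<delta>C by (simp add: algebra_simps)
  have B1: "\<bar>B - 1\<bar> \<le> 4 * (C * \<delta>)"
  proof -
    have "B - 1 = (A - 1 - \<mu>) - \<delta> * \<mu>" "0 \<le> \<delta> * \<mu>"
      using \<delta> \<mu> by (simp_all add: B_def algebra_simps)
    then show ?thesis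
      using A1 \<mu>C by linarith
  qed
  have Ab: "A \<le> 3 * C" "1 / 2 \<le> A" and Bb: "1 / 2 \<le> B"
    using A1 B1 \<delta> \<mu> C by (simp_all add: abs_le_iff)
  have L: "0 < L" "L\<^sup>2 = (1 + \<delta>) * n"
    using \<delta> n by (simp_all add: L_def)
  have L2: "L\<^sup>2 \<le> 2 * n"
    unfolding L(2) using \<delta>1 n by (intro mult_right_mono) auto
  define \<Delta> R where "\<Delta> = sqrt B * \<kappa>" and "R = sqrt (A - B * \<kappa>\<^sup>2)"
  have \<kappa>2: "\<kappa>\<^sup>2 \<le> 1" using \<kappa> by (simp add: power_le_one)
  have "A - B * \<kappa>\<^sup>2 = A * (1 - \<kappa>\<^sup>2) + (1 + \<delta>) * \<mu> * \<kappa>\<^sup>2"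
    by (simp add: B_def algebra_simps)
  also have "\<dots> \<ge> 0"
    using Ab \<kappa>2 \<delta> \<mu> by (intro add_nonneg_nonneg mult_nonneg_nonneg) auto
  finally have AB: "0 \<le> A - B * \<kappa>\<^sup>2" .
  have \<Delta>2: "\<Delta>\<^sup>2 = B * \<kappa>\<^sup>2" using Bb by (simp add: \<Delta>_def power_mult_distrib)
  define e where "e = sqrt (\<eta> * n)"
  have e: "0 \<le> e" "e\<^sup>2 = \<eta> * n"
    using \<eta> n by (simp_all add: e_def)
  define D where "D = sqrt (L\<^sup>2 * A / (B + L\<^sup>2))"
  have BL: "B + L\<^sup>2 \<ge> 1 / 2" using Bb by (simp add: add_increasing2)
  have D0: "0 \<le> D" and D2: "D\<^sup>2 = L\<^sup>2 * A / (B + L\<^sup>2)"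
    using Ab BL by (simp_all add: D_def)
  have dev: "\<bar>\<Delta> - D\<bar> \<le> e"
    unfolding D_def
  proof (rule quadratic_overlap_deviation)
    show "R\<^sup>2 + \<Delta>\<^sup>2 = A" using AB by (simp add: R_def \<Delta>2)
    have "F = (sqrt F)\<^sup>2" using F0 by simp
    also have "\<dots> \<le> (R + L * \<kappa>)\<^sup>2"
      using F2 F0 by (intro power_mono) (auto simp: R_def L_def B_def)
    also have "R + L * \<kappa> = R + L / sqrt B * \<Delta>"
      using Bb by (simp add: \<Delta>_def)
    finally show "(1 + L\<^sup>2 / B) * A - (R + L / sqrt B * \<Delta>)\<^sup>2 \<le> e\<^sup>2"
      using F unfolding e L(2) B_def[symmetric] by linarith
  qed (use Ab Bb L e \<kappa> AB in \<open>auto simp: R_def \<Delta>_def\<close>)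
  have Dn: "D\<^sup>2 \<le> 16 * C\<^sup>2 * n"
  proof -
    have "D\<^sup>2 \<le> L\<^sup>2 * A / (1 / 2)"
      unfolding D2 using BL Ab by (intro divide_left_mono mult_nonneg_nonneg) auto
    also have "\<dots> \<le> (2 * n) * (3 * C) / (1 / 2)"
      using L2 Ab n by (intro divide_right_mono mult_mono) auto
    also have "\<dots> = 12 * C * n" by simp
    also have "\<dots> \<le> 16 * C\<^sup>2 * n"
      using C n mult_mono[of 12 16 C "C\<^sup>2"] self_le_power[of C 2] by (intro mult_right_mono) auto
    finally show ?thesis .
  qed
  have "D \<le> sqrt (16 * C\<^sup>2 * n)"
    using Dn D0 by (simp add: real_le_rsqrt)
  then have D1: "D \<le> 4 * C * sqrt n"
    using C by (simp add: real_sqrt_mult)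
  define \<xi> where "\<xi> = 8 * C * sqrt \<eta> + \<eta>"
  have \<xi>0: "0 \<le> \<xi>" using C \<eta> by (simp add: \<xi>_def)
  have d1: "\<bar>\<Delta>\<^sup>2 - D\<^sup>2\<bar> \<le> \<xi> * n"
  proof -
    have "\<bar>\<Delta>\<^sup>2 - D\<^sup>2\<bar> = \<bar>\<Delta> - D\<bar> * \<bar>(\<Delta> - D) + 2 * D\<bar>"
      by (simp add: abs_mult[symmetric] power2_eq_square algebra_simps)
    also have "\<dots> \<le> e * (e + 2 * D)"
      using dev D0 e by (intro mult_mono) auto
    also have "\<dots> \<le> e * (e + 2 * (4 * C * sqrt n))"
      using D1 e by (intro mult_left_mono) auto
    also have "\<dots> = e\<^sup>2 + 8 * C * (sqrt n * e)"
      by (simp add: power2_eq_square algebra_simps)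
    also have "sqrt n * e = sqrt \<eta> * n"
      using n by (simp add: e_def real_sqrt_mult)
    finally show ?thesis
      by (simp add: \<xi>_def e algebra_simps)
  qed
  have d2: "\<bar>D\<^sup>2 - n * (1 + \<mu>) / (1 + n)\<bar> \<le> 44 * C\<^sup>2 * \<delta> * n"
  proof -
    define \<alpha> \<beta> where "\<alpha> = A - 1 - \<mu>" and "\<beta> = B - 1"
    have "D\<^sup>2 - n * (1 + \<mu>) / (1 + n) = n * ((1 + \<delta>) * A * (1 + n) - (1 + \<mu>) * (B + (1 + \<delta>) * n)) / ((B + L\<^sup>2) * (1 + n))"
    proof -
      have ne: "B + (1 + \<delta>) * n \<noteq> 0" "1 + n \<noteq> 0" using BL n unfolding L(2) by auto
      show ?thesis unfolding D2 L(2) using ne by (simp add: divide_simps) (simp add: algebra_simps)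
    qed
    also have "(1 + \<delta>) * A * (1 + n) - (1 + \<mu>) * (B + (1 + \<delta>) * n) = (1 + \<mu>) * (\<delta> - \<beta>) + (1 + \<delta>) * (1 + n) * \<alpha>"
      by (simp add: \<alpha>_def \<beta>_def algebra_simps)
    finally have eq: "D\<^sup>2 - n * (1 + \<mu>) / (1 + n) = n * ((1 + \<mu>) * (\<delta> - \<beta>) + (1 + \<delta>) * (1 + n) * \<alpha>) / ((B + L\<^sup>2) * (1 + n))" .
    have "\<bar>(1 + \<mu>) * (\<delta> - \<beta>) + (1 + \<delta>) * (1 + n) * \<alpha>\<bar> \<le> (2 * C) * (5 * (C * \<delta>)) + 2 * (2 * C) * (3 * (C * \<delta>))"
    proof (rule order_trans[OF abs_triangle_ineq add_mono])
      show "\<bar>(1 + \<mu>) * (\<delta> - \<beta>)\<bar> \<le> (2 * C) * (5 * (C * \<delta>))"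
      proof -
        have "\<bar>\<delta> - \<beta>\<bar> \<le> 5 * (C * \<delta>)"
          using B1 \<delta>C \<delta>(1) unfolding \<beta>_def by linarith
        then show ?thesis
          unfolding abs_mult using \<mu> C \<delta> by (intro mult_mono) auto
      qed
      show "\<bar>(1 + \<delta>) * (1 + n) * \<alpha>\<bar> \<le> 2 * (2 * C) * (3 * (C * \<delta>))"
        unfolding abs_mult using n C \<delta> A1 \<delta>1 by (intro mult_mono) (auto simp: \<alpha>_def)
    qed
    also have "\<dots> = 22 * C\<^sup>2 * \<delta>" by (simp add: power2_eq_square)
    finally have num: "\<bar>(1 + \<mu>) * (\<delta> - \<beta>) + (1 + \<delta>) * (1 + n) * \<alpha>\<bar> \<le> 22 * C\<^sup>2 * \<delta>" .
    have den: "1 / 2 \<le> (B + L\<^sup>2) * (1 + n)"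
      using BL n mult_mono[of "1/2" "B + L\<^sup>2" 1 "1 + n"] by auto
    have "\<bar>D\<^sup>2 - n * (1 + \<mu>) / (1 + n)\<bar> = n * \<bar>(1 + \<mu>) * (\<delta> - \<beta>) + (1 + \<delta>) * (1 + n) * \<alpha>\<bar> / ((B + L\<^sup>2) * (1 + n))"
    proof -
      have "\<bar>B + L\<^sup>2\<bar> = B + L\<^sup>2" using BL by simp
      then show ?thesis
        unfolding eq using n by (simp add: abs_mult)
    qed
    also have "\<dots> \<le> n * (22 * C\<^sup>2 * \<delta>) / (1 / 2)"
      using num den n C \<delta> by (intro frac_le mult_left_mono mult_nonneg_nonneg) auto
    finally show ?thesis by (simp add: algebra_simps)
  qed
  \<comment> \<open>The squared sine itself is of order \<open>n\<close>, so a relative error of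
    order \<open>\<delta>\<close> in \<open>B\<close> costs only order
    \<open>\<delta> * n\<close>.\<close>
  have d3: "\<bar>\<kappa>\<^sup>2 - \<Delta>\<^sup>2\<bar> \<le> 4 * C * \<delta> * (32 * C\<^sup>2 + 2 * \<xi>) * n"
  proof -
    have "\<kappa>\<^sup>2 / 2 \<le> \<Delta>\<^sup>2"
      unfolding \<Delta>2 using Bb mult_right_mono[of "1/2" B "\<kappa>\<^sup>2"] by simp
    also have "\<Delta>\<^sup>2 \<le> 16 * C\<^sup>2 * n + \<xi> * n" using d1 Dn by (simp add: abs_le_iff)
    finally have \<kappa>n: "\<kappa>\<^sup>2 \<le> (32 * C\<^sup>2 + 2 * \<xi>) * n" by (simp add: algebra_simps)
    have "\<kappa>\<^sup>2 - \<Delta>\<^sup>2 = - ((B - 1) * \<kappa>\<^sup>2)"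
      by (simp add: \<Delta>2 algebra_simps)
    then have "\<bar>\<kappa>\<^sup>2 - \<Delta>\<^sup>2\<bar> = \<bar>B - 1\<bar> * \<kappa>\<^sup>2"
      by (simp add: abs_mult)
    also have "\<dots> \<le> (4 * (C * \<delta>)) * ((32 * C\<^sup>2 + 2 * \<xi>) * n)"
      using B1 \<kappa>n C \<delta> by (intro mult_mono) auto
    finally show ?thesis by (simp add: algebra_simps)
  qed
  have triangle: "\<bar>a1 - a4\<bar> \<le> \<bar>a1 - a2\<bar> + \<bar>a2 - a3\<bar> + \<bar>a3 - a4\<bar>" for a1 a2 a3 a4 :: real
    by linarith
  have "\<bar>\<kappa>\<^sup>2 - n * (1 + \<mu>) / (1 + n)\<bar> \<le> \<bar>\<kappa>\<^sup>2 - \<Delta>\<^sup>2\<bar> + \<bar>\<Delta>\<^sup>2 - D\<^sup>2\<bar> + \<bar>D\<^sup>2 - n * (1 + \<mu>) / (1 + n)\<bar>"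
    by (rule triangle)
  also have "\<dots> \<le> 4 * C * \<delta> * (32 * C\<^sup>2 + 2 * \<xi>) * n + \<xi> * n + 44 * C\<^sup>2 * \<delta> * n"
    by (intro add_mono d1 d2 d3)
  also have "\<dots> = overlap_error C \<delta> \<eta> * n"
    by (simp add: overlap_error_def \<xi>_def algebra_simps)
  finally show ?thesis .
qed

lemma overlap_error_small:
  fixes C \<omega> \<epsilon> :: real
  assumes C: "1 \<le> C" and \<omega>: "0 \<le> \<omega>" "\<omega> < 1" and \<epsilon>: "0 < \<epsilon>"
  obtains \<delta> k where "0 < \<delta>" "8 * C * \<delta> \<le> 1" "0 < (k :: nat)"
    "overlap_error C \<delta> (168 * C ^ 3 * \<delta> + 12 * C ^ 4 * \<omega> ^ (k - 1)) \<le> \<epsilon>"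
proof -
  \<comment> \<open>A single index \<open>j\<close> drives both \<open>\<delta>\<close> and the
    number \<open>Suc j\<close> of steps; the factor \<open>1 / (8 * C)\<close> enforces the
    smallness condition already for \<open>j = 0\<close>.\<close>
  define \<delta> where "\<delta> j = 1 / (8 * C) * inverse (real (Suc j))" for j
  have \<delta>0: "\<delta> \<longlonglongrightarrow> 0"
    unfolding \<delta>_def by (rule tendsto_mult_right_zero) (rule LIMSEQ_inverse_real_of_nat)
  have \<omega>0: "(\<lambda>j. \<omega> ^ j) \<longlonglongrightarrow> 0"
    using \<omega> by (intro LIMSEQ_realpow_zero) auto
  define \<eta> where "\<eta> j = 168 * C ^ 3 * \<delta> j + 12 * C ^ 4 * \<omega> ^ j" for j
  have \<eta>0: "\<eta> \<longlonglongrightarrow> 0"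
    unfolding \<eta>_def by (rule tendsto_eq_intros \<delta>0 \<omega>0 refl | simp)+
  have "(\<lambda>j. overlap_error C (\<delta> j) (\<eta> j)) \<longlonglongrightarrow> 0"
    unfolding overlap_error_def by (rule tendsto_eq_intros \<delta>0 \<eta>0 refl | simp)+
  then have "eventually (\<lambda>j. overlap_error C (\<delta> j) (\<eta> j) < \<epsilon>) sequentially"
    by (rule order_tendstoD(2)) (rule \<epsilon>)
  then obtain j where "overlap_error C (\<delta> j) (\<eta> j) < \<epsilon>"
    by (auto simp: eventually_sequentially)
  moreover have "0 < \<delta> j" "8 * C * \<delta> j \<le> 1"
    using C by (auto simp: \<delta>_def inverse_le_1_iff)
  ultimately show thesis
    using that[of "\<delta> j" "Suc j"] by (simp add: \<eta>_def)
qed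

section \<open>The leading left singular vector\<close>

text \<open>A first variation at a minimum vanishes. It yields the eigenvector equation for
  maximisers and the orthogonality of nearest points. The test value has denominator
  \<open>a + 1\<close> so that \<open>a = 0\<close> is covered.\<close>

lemma linear_term_zero:
  fixes a b :: real
  assumes "\<And>t. 0 \<le> 2 * t * b + t\<^sup>2 * a" "0 \<le> a"
  shows "b = 0"
proof (rule ccontr)
  assume b: "b \<noteq> 0"
  define t where "t = - b / (a + 1)"
  have tb: "t * (a + 1) = - b" using assms(2) by (simp add: t_def)
  have "2 * t * b + t\<^sup>2 * a = t * (2 * b + (t * (a + 1)) - t)"
    by (simp add: power2_eq_square algebra_simps)
  also have "\<dots> = t * b - t\<^sup>2"
    unfolding tb by (simp add: power2_eq_square algebra_simps)
  also have "t * b = - (b\<^sup>2 / (a + 1))"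
    by (simp add: t_def power2_eq_square)
  also have "- (b\<^sup>2 / (a + 1)) - t\<^sup>2 < 0"
  proof -
    have "0 < b\<^sup>2 / (a + 1)"
      using b assms(2) by (intro divide_pos_pos) auto
    then show ?thesis
      using zero_le_power2[of t] by linarith
  qed
  finally show False using assms(1)[of t] by linarith
qed

text \<open>Vectors are functions on all of \<open>nat\<close>; setting the coordinates from
  \<open>n\<close> on to 0 makes Tychonoff's theorem applicable.\<close>

lemma compact_box:
  fixes n :: nat and R :: real
  shows "compact {u :: nat \<Rightarrow> real. (\<forall>i<n. \<bar>u i\<bar> \<le> R) \<and> (\<forall>i\<ge>n. u i = 0)}"
proof -
  have "compactin (product_topology (\<lambda>i. euclidean) UNIV) (PiE UNIV (\<lambda>i. if i < n then {- R..R} else {0 :: real}))"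
    by (subst compactin_PiE) auto
  moreover have "PiE UNIV (\<lambda>i. if i < n then {- R..R} else {0 :: real}) = {u. (\<forall>i<n. \<bar>u i\<bar> \<le> R) \<and> (\<forall>i\<ge>n. u i = 0)}"
    by (auto simp: PiE_iff abs_le_iff; drule_tac x = i in spec; simp)
  ultimately show ?thesis
    by (simp add: euclidean_product_topology)
qed

lemma nsq_coordinate_bound: "i < (n :: nat) \<Longrightarrow> (u i)\<^sup>2 \<le> nsq {..<n} u"
  unfolding nsq_def by (rule member_le_sum) auto

lemma compact_sphere_fun: "compact {u :: nat \<Rightarrow> real. nsq {..<n} u = 1 \<and> (\<forall>i\<ge>n. u i = 0)}"
proof -
  have "{u :: nat \<Rightarrow> real. nsq {..<n} u = 1 \<and> (\<forall>i\<ge>n. u i = 0)} =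
     {u. (\<forall>i<n. \<bar>u i\<bar> \<le> 1) \<and> (\<forall>i\<ge>n. u i = 0)} \<inter> {u. nsq {..<n} u = 1}"
  proof -
    have "\<bar>u i\<bar> \<le> 1" if "nsq {..<n} u = 1" "i < n" for u :: "nat \<Rightarrow> real" and i
      using nsq_coordinate_bound[OF that(2), of u] that(1) by (simp add: abs_square_le_1)
    then show ?thesis by auto
  qed
  moreover have "closed {u :: nat \<Rightarrow> real. nsq {..<n} u = 1}"
    by (intro closed_Collect_eq continuous_intros)
  ultimately show ?thesis
    using compact_box by (simp add: compact_Int_closed)
qed

lemma continuous_on_tm_vec [continuous_intros]: "continuous_on S (\<lambda>u. tm I A u j)"
  unfolding tm_def by (intro continuous_intros)

text \<open>The homogeneous form of being a unit maximiser of |A^T u|, which lets test vectors be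
  used without normalising them.\<close>

definition is_top :: "nat \<Rightarrow> nat \<Rightarrow> (nat \<times> nat \<Rightarrow> real) \<Rightarrow> (nat \<Rightarrow> real) \<Rightarrow> bool" where
  "is_top n m A u \<longleftrightarrow> nsq {..<n} u = 1 \<and>
     (\<forall>w. nsq {..<m} (tm {..<n} A w) \<le> nsq {..<n} w * nsq {..<m} (tm {..<n} A u))"

lemma nsq_zero_imp: "nsq {..<n :: nat} w = 0 \<Longrightarrow> i < n \<Longrightarrow> w i = 0"
  by (simp add: nsq_def sum_nonneg_eq_0_iff)

lemma is_topI_unit:
  assumes u: "nsq {..<n} u = 1"
    and max: "\<And>w. nsq {..<n} w = 1 \<Longrightarrow> (\<forall>i\<ge>n. w i = 0) \<Longrightarrow> nsq {..<m} (tm {..<n} A w) \<le> nsq {..<m} (tm {..<n} A u)"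
  shows "is_top n m A u"
  unfolding is_top_def
proof (intro conjI allI u)
  fix w :: "nat \<Rightarrow> real"
  show "nsq {..<m} (tm {..<n} A w) \<le> nsq {..<n} w * nsq {..<m} (tm {..<n} A u)"
  proof (cases "nsq {..<n} w = 0")
    case True
    then have "tm {..<n} A w = (\<lambda>j. 0)"
      using nsq_zero_imp[OF True] by (simp add: tm_def fun_eq_iff)
    then show ?thesis using True by (simp add: nsq_def)
  next
    case False
    define s where "s = sqrt (nsq {..<n} w)"
    have s: "s > 0" "s\<^sup>2 = nsq {..<n} w"
      using False by (simp_all add: s_def less_le)
    define v where "v i = (if i < n then inverse s * w i else 0)" for i
    have "nsq {..<n} v = nsq {..<n} (\<lambda>i. inverse s * w i)"
      by (rule nsq_cong) (auto simp: v_def)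
    also have "\<dots> = 1"
      unfolding nsq_scale s(2)[symmetric] using s(1) by (simp add: power_inverse)
    finally have "nsq {..<m} (tm {..<n} A v) \<le> nsq {..<m} (tm {..<n} A u)"
      by (rule max) (simp add: v_def)
    also have "tm {..<n} A v = tm {..<n} A (\<lambda>i. inverse s * w i)"
      by (intro ext tm_cong) (auto simp: v_def)
    finally have "inverse (s\<^sup>2) * nsq {..<m} (tm {..<n} A w) \<le> nsq {..<m} (tm {..<n} A u)"
      by (simp add: tm_scale nsq_scale power_inverse)
    moreover have "0 < s\<^sup>2" using s(1) by simp
    ultimately show ?thesis
      unfolding s(2)[symmetric] by (simp add: field_simps)
  qed
qed

lemma ex_is_top:
  assumes "n > 0"
  shows "\<exists>u. is_top n m A u \<and> (\<forall>i\<ge>n. u i = 0)"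
proof -
  let ?S = "{u :: nat \<Rightarrow> real. nsq {..<n} u = 1 \<and> (\<forall>i\<ge>n. u i = 0)}"
  have "(\<lambda>i. if i = 0 then 1 else 0) \<in> ?S"
    using assms by (simp add: nsq_def if_distrib[of "\<lambda>x. x\<^sup>2"] cong: if_cong)
  then have "?S \<noteq> {}" by blast
  moreover have "continuous_on ?S (\<lambda>u. nsq {..<m} (tm {..<n} A u))"
    by (intro continuous_intros)
  ultimately obtain u where "u \<in> ?S" "\<forall>w\<in>?S. nsq {..<m} (tm {..<n} A w) \<le> nsq {..<m} (tm {..<n} A u)"
    using continuous_attains_sup[OF compact_sphere_fun, of n "\<lambda>u. nsq {..<m} (tm {..<n} A u)"] by blast
  then show ?thesis
    by (intro exI[of _ u]) (auto intro!: is_topI_unit)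
qed

section \<open>The top eigenspace of the Gram matrix and projections onto it\<close>

context
  fixes n m :: nat and B :: rmat
  assumes B: "B \<in> carrier_mat n m" and n: "n > 0"
begin

private abbreviation "Bf \<equiv> \<lambda>p. B $$ p"

private abbreviation "gram \<equiv> B * transpose_mat B"

lemma gram_carrier: "gram \<in> carrier_mat n n"
  using B by auto

lemma gram_mult: 
  assumes v: "v \<in> carrier_vec n" and i: "i < n"
  shows "vec_index (gram *\<^sub>v v) i = (\<Sum>j<m. Bf (i, j) * tm {..<n} Bf (vec_index v) j)"
proof -
  have "gram *\<^sub>v v = B *\<^sub>v (transpose_mat B *\<^sub>v v)"
    using B v by (intro assoc_mult_mat_vec) auto
  then show ?thesis
    using B v i by (simp add: scalar_prod_def tm_def lessThan_atLeast0)
qed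

lemma gram_bilinear:
  assumes v: "v \<in> carrier_vec n"
  shows "ip {..<n} (vec_index (gram *\<^sub>v v)) w = ip {..<m} (tm {..<n} Bf (vec_index v)) (tm {..<n} Bf w)"
proof -
  have "ip {..<n} (vec_index (gram *\<^sub>v v)) w = (\<Sum>i<n. \<Sum>j<m. Bf (i, j) * tm {..<n} Bf (vec_index v) j * w i)"
    unfolding ip_def by (intro sum.cong refl) (simp add: gram_mult[OF v] sum_distrib_right)
  also have "\<dots> = (\<Sum>j<m. \<Sum>i<n. Bf (i, j) * tm {..<n} Bf (vec_index v) j * w i)"
    by (rule sum.swap)
  also have "\<dots> = ip {..<m} (tm {..<n} Bf (vec_index v)) (tm {..<n} Bf w)"
    unfolding ip_def by (intro sum.cong refl) (simp add: tm_def[of _ _ w] sum_distrib_left algebra_simps)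
  finally show ?thesis .
qed

lemma nsq_vec [simp]: "nsq {..<n} (vec_index (Matrix.vec n u)) = nsq {..<n} u"
  by (rule nsq_cong) auto

lemma tm_vec [simp]: "tm {..<n} A (vec_index (Matrix.vec n u)) = tm {..<n} A u"
  by (intro ext tm_cong) auto

definition "top_eig = (SOME l. \<exists>u. is_top n m Bf u \<and> l = nsq {..<m} (tm {..<n} Bf u))"

lemma top_eig: "\<exists>u. is_top n m Bf u \<and> top_eig = nsq {..<m} (tm {..<n} Bf u)"
  unfolding top_eig_def by (rule someI_ex) (use ex_is_top[OF n, of m Bf] in blast)

lemma top_eig_max: "nsq {..<m} (tm {..<n} Bf w) \<le> nsq {..<n} w * top_eig"
  using top_eig by (auto simp: is_top_def)

lemma is_top_iff: "is_top n m Bf u \<longleftrightarrow> nsq {..<n} u = 1 \<and> nsq {..<m} (tm {..<n} Bf u) = top_eig"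
proof
  assume u: "is_top n m Bf u"
  obtain v where v: "is_top n m Bf v" "top_eig = nsq {..<m} (tm {..<n} Bf v)" using top_eig by blast
  have "top_eig \<le> nsq {..<m} (tm {..<n} Bf u)"
    using u v by (metis is_top_def mult_1)
  then show "nsq {..<n} u = 1 \<and> nsq {..<m} (tm {..<n} Bf u) = top_eig"
    using u top_eig_max[of u] by (auto simp: is_top_def)
next
  assume "nsq {..<n} u = 1 \<and> nsq {..<m} (tm {..<n} Bf u) = top_eig"
  then show "is_top n m Bf u"
    using top_eig_max by (simp add: is_top_def)
qed

text \<open>Equality in the Rayleigh bound characterises top eigenvectors, by first variation. The
  quadratic form of the condition is visibly closed and matches \<open>is_top\<close>.\<close>

lemma eigen_iff:
  assumes v: "v \<in> carrier_vec n"
  shows "gram *\<^sub>v v = top_eig \<cdot>\<^sub>v v \<longleftrightarrow> nsq {..<m} (tm {..<n} Bf (vec_index v)) = top_eig * nsq {..<n} (vec_index v)"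
proof
  assume "gram *\<^sub>v v = top_eig \<cdot>\<^sub>v v"
  then have "ip {..<n} (vec_index (gram *\<^sub>v v)) (vec_index v) = top_eig * nsq {..<n} (vec_index v)"
    using v by (simp add: ip_def nsq_eq_ip sum_distrib_left mult.assoc)
  then show "nsq {..<m} (tm {..<n} Bf (vec_index v)) = top_eig * nsq {..<n} (vec_index v)"
    unfolding gram_bilinear[OF v] by (simp add: nsq_eq_ip)
next
  assume eq: "nsq {..<m} (tm {..<n} Bf (vec_index v)) = top_eig * nsq {..<n} (vec_index v)"
  have zero: "top_eig * ip {..<n} (vec_index v) w - ip {..<m} (tm {..<n} Bf (vec_index v)) (tm {..<n} Bf w) = 0" for w
  proof (rule linear_term_zero)
    show "0 \<le> top_eig * nsq {..<n} w - nsq {..<m} (tm {..<n} Bf w)"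
      using top_eig_max[of w] by (simp add: mult.commute)
    fix t
    let ?u = "\<lambda>i. vec_index v i + t * w i"
    have "0 \<le> top_eig * nsq {..<n} ?u - nsq {..<m} (tm {..<n} Bf ?u)"
      using top_eig_max[of ?u] by (simp add: mult.commute)
    also have "tm {..<n} Bf ?u = (\<lambda>j. tm {..<n} Bf (vec_index v) j + t * tm {..<n} Bf w j)"
      by (rule ext) (rule tm_add_smult)
    finally show "0 \<le> 2 * t * (top_eig * ip {..<n} (vec_index v) w - ip {..<m} (tm {..<n} Bf (vec_index v)) (tm {..<n} Bf w))
       + t\<^sup>2 * (top_eig * nsq {..<n} w - nsq {..<m} (tm {..<n} Bf w))"
      unfolding nsq_add_smult using eq by (simp add: algebra_simps)
  qed
  show "gram *\<^sub>v v = top_eig \<cdot>\<^sub>v v"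
  proof (rule eq_vecI)
    show dim: "dim_vec (gram *\<^sub>v v) = dim_vec (top_eig \<cdot>\<^sub>v v)" using B v by simp
    fix i assume "i < dim_vec (top_eig \<cdot>\<^sub>v v)"
    then have i: "i < n" using v by simp
    let ?e = "\<lambda>k. if k = i then 1 else 0 :: real"
    have "ip {..<n} (vec_index (gram *\<^sub>v v)) ?e = top_eig * ip {..<n} (vec_index v) ?e"
      using zero[of ?e] by (simp add: gram_bilinear[OF v])
    moreover have "ip {..<n} f ?e = f i" for f
      using i by (simp add: ip_def if_distrib[of "\<lambda>x. _ * x"] cong: if_cong)
    ultimately show "vec_index (gram *\<^sub>v v) i = vec_index (top_eig \<cdot>\<^sub>v v) i"
      using i v by simp
  qed
qed

lemma Max_eigenvalue: "Max {l. eigenvalue gram l} = top_eig"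
proof (rule Max_eqI)
  have "char_poly gram \<noteq> 0"
    using degree_monic_char_poly[OF gram_carrier] n by auto
  then show "finite {l. eigenvalue gram l}"
    by (simp add: eigenvalue_root_char_poly[OF gram_carrier] poly_roots_finite)
  obtain u where "is_top n m Bf u" using top_eig by blast
  define v where "v = Matrix.vec n u"
  have v: "v \<in> carrier_vec n" by (simp add: v_def)
  have nv: "nsq {..<n} (vec_index v) = nsq {..<n} u" "tm {..<n} Bf (vec_index v) = tm {..<n} Bf u"
    by (simp_all add: v_def)
  have "gram *\<^sub>v v = top_eig \<cdot>\<^sub>v v"
    using \<open>is_top n m Bf u\<close> v by (subst eigen_iff) (auto simp: nv is_top_iff)
  moreover have "v \<noteq> 0\<^sub>v n"
    using \<open>is_top n m Bf u\<close> nv(1) by (auto simp: is_top_iff nsq_def)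
  ultimately show "top_eig \<in> {l. eigenvalue gram l}"
    using v B by (auto simp: eigenvalue_def eigenvector_def)
  fix l assume "l \<in> {l. eigenvalue gram l}"
  then obtain v where v: "v \<in> carrier_vec n" "v \<noteq> 0\<^sub>v n" "gram *\<^sub>v v = l \<cdot>\<^sub>v v"
    using B by (auto simp: eigenvalue_def eigenvector_def)
  have "ip {..<n} (vec_index (gram *\<^sub>v v)) (vec_index v) = l * nsq {..<n} (vec_index v)"
    using v by (simp add: ip_def nsq_eq_ip sum_distrib_left mult.assoc)
  then have "l * nsq {..<n} (vec_index v) \<le> top_eig * nsq {..<n} (vec_index v)"
    unfolding gram_bilinear[OF v(1)] using top_eig_max[of "vec_index v"] by (simp add: nsq_eq_ip mult.commute)
  moreover have "nsq {..<n} (vec_index v) > 0"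
  proof -
    have "nsq {..<n} (vec_index v) \<noteq> 0"
      using v nsq_zero_imp[of n "vec_index v"] by (auto intro!: eq_vecI)
    then show ?thesis by (simp add: less_le)
  qed
  ultimately show "l \<le> top_eig" by simp
qed

private abbreviation "E \<equiv> leading_left_singular_space B"

lemma mem_E: "v \<in> E \<longleftrightarrow> v \<in> carrier_vec n \<and> gram *\<^sub>v v = top_eig \<cdot>\<^sub>v v"
  using B by (auto simp: leading_left_singular_space_def Max_eigenvalue Let_def)

lemma E_smult_add:
  assumes "v \<in> E" "w \<in> E"
  shows "v + t \<cdot>\<^sub>v w \<in> E"
proof -
  have c: "v \<in> carrier_vec n" "w \<in> carrier_vec n" using assms by (auto simp: mem_E)
  have "gram *\<^sub>v (v + t \<cdot>\<^sub>v w) = top_eig \<cdot>\<^sub>v v + t \<cdot>\<^sub>v (top_eig \<cdot>\<^sub>v w)"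
    using assms c gram_carrier by (simp add: mult_add_distrib_mat_vec[of _ n n] mult_mat_vec[of _ n n] mem_E)
  also have "\<dots> = top_eig \<cdot>\<^sub>v (v + t \<cdot>\<^sub>v w)"
    using c by (auto intro!: eq_vecI simp: algebra_simps)
  finally show ?thesis using c by (simp add: mem_E)
qed

lemma zero_E: "0\<^sub>v n \<in> E"
proof -
  have "gram *\<^sub>v 0\<^sub>v n = top_eig \<cdot>\<^sub>v 0\<^sub>v n"
    by (subst eigen_iff) (simp_all add: nsq_def tm_def)
  then show ?thesis by (simp add: mem_E)
qed

lemma ip_scalar_prod: "v \<in> carrier_vec n \<Longrightarrow> w \<in> carrier_vec n \<Longrightarrow> v \<bullet> w = ip {..<n} (vec_index v) (vec_index w)"
  by (simp add: scalar_prod_def ip_def lessThan_atLeast0)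

lemma orth_proj_ex1:
  assumes x: "x \<in> carrier_vec n"
  shows "\<exists>!p. p \<in> E \<and> (\<forall>w\<in>E. (x - p) \<bullet> w = 0)"
proof (rule ex_ex1I)
  let ?x = "vec_index x"
  \<comment> \<open>A point with a coordinate beyond twice the length of \<open>x\<close> is at
    least as far from \<open>x\<close> as the zero vector, so the nearest point may be sought in a
    compact box.\<close>
  define R where "R = 2 * sqrt (nsq {..<n} ?x)"
  define S where "S = {u :: nat \<Rightarrow> real. (\<forall>i<n. \<bar>u i\<bar> \<le> R) \<and> (\<forall>i\<ge>n. u i = 0)} \<inter>
     {u. nsq {..<m} (tm {..<n} Bf u) = top_eig * nsq {..<n} u}"
  have "compact S"
    unfolding S_def by (intro compact_Int_closed compact_box closed_Collect_eq continuous_intros)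
  moreover have zS: "(\<lambda>_. 0) \<in> S"
    by (simp add: S_def R_def nsq_def tm_def sum_nonneg)
  moreover have "continuous_on S (\<lambda>u. nsq {..<n} (\<lambda>i. ?x i - u i))"
    by (intro continuous_intros)
  ultimately obtain u where u: "u \<in> S" "\<And>w. w \<in> S \<Longrightarrow> nsq {..<n} (\<lambda>i. ?x i - u i) \<le> nsq {..<n} (\<lambda>i. ?x i - w i)"
    using continuous_attains_inf[of S "\<lambda>u. nsq {..<n} (\<lambda>i. ?x i - u i)"]
    by blast
  define p where "p = Matrix.vec n u"
  have p: "p \<in> carrier_vec n" by (simp add: p_def)
  have memE: "Matrix.vec n w \<in> E \<longleftrightarrow> nsq {..<m} (tm {..<n} Bf w) = top_eig * nsq {..<n} w" for w
    by (simp add: mem_E eigen_iff)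
  have pE: "p \<in> E" using u(1) by (simp add: p_def memE S_def)
  have min: "nsq {..<n} (\<lambda>i. ?x i - vec_index p i) \<le> nsq {..<n} (\<lambda>i. ?x i - vec_index w i)" if w: "w \<in> E" for w
  proof -
    define w' where "w' i = (if i < n then vec_index w i else 0)" for i
    have pu: "nsq {..<n} (\<lambda>i. ?x i - vec_index p i) = nsq {..<n} (\<lambda>i. ?x i - u i)"
      by (rule nsq_cong) (auto simp: p_def)
    have ww: "nsq {..<n} (\<lambda>i. ?x i - vec_index w i) = nsq {..<n} (\<lambda>i. ?x i - w' i)"
      by (rule nsq_cong) (auto simp: w'_def)
    have "Matrix.vec n w' = w" using w by (auto simp: w'_def mem_E)
    then have w'E: "nsq {..<m} (tm {..<n} Bf w') = top_eig * nsq {..<n} w'"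
      using w memE by metis
    show ?thesis
    proof (cases "\<forall>i<n. \<bar>w' i\<bar> \<le> R")
      case True
      then have "w' \<in> S" using w'E by (simp add: S_def w'_def)
      then show ?thesis using u(2) pu ww by simp
    next
      case False
      then obtain i where i: "i < n" "\<bar>w' i\<bar> > R" by (auto simp: not_le)
      have xi: "\<bar>?x i\<bar> \<le> R / 2"
        using nsq_coordinate_bound[OF i(1), of ?x] real_sqrt_le_mono by (fastforce simp: R_def)
      have "R / 2 \<le> \<bar>?x i - w' i\<bar>" using xi i by linarith
      then have "(R / 2)\<^sup>2 \<le> (?x i - w' i)\<^sup>2"
        using abs_le_square_iff[of "R / 2" "?x i - w' i"] xi by auto
      then have "nsq {..<n} ?x \<le> (?x i - w' i)\<^sup>2"
        by (simp add: R_def)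
      also have "\<dots> \<le> nsq {..<n} (\<lambda>i. ?x i - w' i)"
        using nsq_coordinate_bound[OF i(1), of "\<lambda>i. ?x i - w' i"] .
      finally show ?thesis using u(2)[OF zS] pu ww by simp
    qed
  qed
  have "(x - p) \<bullet> w = 0" if w: "w \<in> E" for w
  proof -
    have wc: "w \<in> carrier_vec n" using w by (simp add: mem_E)
    let ?f = "\<lambda>i. ?x i - vec_index p i"
    have "ip {..<n} ?f (\<lambda>i. - vec_index w i) = 0"
    proof (rule linear_term_zero)
      show "0 \<le> nsq {..<n} (\<lambda>i. - vec_index w i)" by simp
      fix t
      have "nsq {..<n} ?f \<le> nsq {..<n} (\<lambda>i. ?x i - vec_index (p + t \<cdot>\<^sub>v w) i)"
        by (rule min) (rule E_smult_add[OF pE w])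
      also have "\<dots> = nsq {..<n} (\<lambda>i. ?f i + t * (- vec_index w i))"
        using p wc by (intro nsq_cong) (auto simp: algebra_simps)
      finally show "0 \<le> 2 * t * ip {..<n} ?f (\<lambda>i. - vec_index w i) + t\<^sup>2 * nsq {..<n} (\<lambda>i. - vec_index w i)"
        unfolding nsq_add_smult by simp
    qed
    then show ?thesis
      using x p wc by (simp add: scalar_prod_def ip_def sum_negf lessThan_atLeast0)
  qed
  then show "\<exists>p. p \<in> E \<and> (\<forall>w\<in>E. (x - p) \<bullet> w = 0)"
    using pE by blast
next
  fix p p' assume p: "p \<in> E \<and> (\<forall>w\<in>E. (x - p) \<bullet> w = 0)" and p': "p' \<in> E \<and> (\<forall>w\<in>E. (x - p') \<bullet> w = 0)"
  have c: "p \<in> carrier_vec n" "p' \<in> carrier_vec n" using p p' by (auto simp: mem_E)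
  have d: "p + (-1) \<cdot>\<^sub>v p' \<in> E" using p p' E_smult_add by blast
  let ?d = "p + (-1) \<cdot>\<^sub>v p'"
  have "?d \<bullet> ?d = (x - p') \<bullet> ?d - (x - p) \<bullet> ?d"
    using x c by (simp add: scalar_prod_def sum_subtractf[symmetric] algebra_simps)
  then have "nsq {..<n} (vec_index ?d) = 0"
    using p p' d c by (simp add: ip_scalar_prod[symmetric] nsq_eq_ip)
  then have "vec_index ?d i = 0" if "i < n" for i
    using nsq_zero_imp that by blast
  then have "vec_index p i = vec_index p' i" if "i < n" for i
    using c that by force
  then show "p = p'"
    using c by (intro eq_vecI) auto
qed

lemma orth_proj_E:
  assumes x: "x \<in> carrier_vec n"
  shows "orth_proj E x \<in> E" "\<And>w. w \<in> E \<Longrightarrow> (x - orth_proj E x) \<bullet> w = 0"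
  using theI'[OF orth_proj_ex1[OF x]] unfolding orth_proj_def by auto

lemma orth_proj_carrier: "i < n \<Longrightarrow> orth_proj E (unit_vec n i) \<in> carrier_vec n"
  using orth_proj_E(1)[of "unit_vec n i"] by (simp add: mem_E)

lemma orth_proj_coordinate:
  assumes i: "i < n" and w: "w \<in> E"
  shows "orth_proj E (unit_vec n i) \<bullet> w = vec_index w i"
proof -
  have c: "w \<in> carrier_vec n" using w by (simp add: mem_E)
  have "(unit_vec n i - orth_proj E (unit_vec n i)) \<bullet> w = 0"
    using orth_proj_E(2)[OF _ w, of "unit_vec n i"] by simp
  moreover have "(unit_vec n i - orth_proj E (unit_vec n i)) \<bullet> w = unit_vec n i \<bullet> w - orth_proj E (unit_vec n i) \<bullet> w"
    using c orth_proj_carrier[OF i] by (simp add: minus_scalar_prod_distrib[of _ n])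
  moreover have "unit_vec n i \<bullet> w = vec_index w i"
    using c i by simp
  ultimately show ?thesis by simp
qed

lemma leading_left_singular_vec_selected:
  obtains i where "i < n" "orth_proj E (unit_vec n i) \<noteq> 0\<^sub>v n"
    "leading_left_singular_vec B = (1 / vec_norm2 (orth_proj E (unit_vec n i))) \<cdot>\<^sub>v orth_proj E (unit_vec n i)"
    "\<And>j. j < i \<Longrightarrow> orth_proj E (unit_vec n j) = 0\<^sub>v n"
proof -
  let ?p = "\<lambda>i. orth_proj E (unit_vec n i)"
  obtain u where u: "is_top n m Bf u" using top_eig by blast
  define v where "v = Matrix.vec n u"
  have v: "v \<in> carrier_vec n" by (simp add: v_def)
  have nv: "nsq {..<n} (vec_index v) = nsq {..<n} u" "tm {..<n} Bf (vec_index v) = tm {..<n} Bf u"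
    by (simp_all add: v_def)
  have vE: "v \<in> E"
    using u v by (simp add: mem_E eigen_iff nv is_top_iff)
  have "\<exists>i<n. ?p i \<noteq> 0\<^sub>v n"
  proof (rule ccontr)
    assume "\<not> (\<exists>i<n. ?p i \<noteq> 0\<^sub>v n)"
    then have "vec_index v i = 0" if "i < n" for i
      using orth_proj_coordinate[OF that vE] that v by simp
    then have "nsq {..<n} (vec_index v) = 0" by (simp add: nsq_def)
    then show False using u nv by (simp add: is_top_iff)
  qed
  then have L: "(LEAST i. i < n \<and> ?p i \<noteq> 0\<^sub>v n) < n \<and> ?p (LEAST i. i < n \<and> ?p i \<noteq> 0\<^sub>v n) \<noteq> 0\<^sub>v n"
    by (intro LeastI_ex[of "\<lambda>i. i < n \<and> ?p i \<noteq> 0\<^sub>v n"])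
  show thesis
  proof (rule that[of "LEAST i. i < n \<and> ?p i \<noteq> 0\<^sub>v n"])
    show "leading_left_singular_vec B = (1 / vec_norm2 (?p (LEAST i. i < n \<and> ?p i \<noteq> 0\<^sub>v n))) \<cdot>\<^sub>v ?p (LEAST i. i < n \<and> ?p i \<noteq> 0\<^sub>v n)"
      using B by (simp add: leading_left_singular_vec_def Let_def)
    fix j assume "j < (LEAST i. i < n \<and> ?p i \<noteq> 0\<^sub>v n)"
    then show "?p j = 0\<^sub>v n"
      using not_less_Least[of j "\<lambda>i. i < n \<and> ?p i \<noteq> 0\<^sub>v n"] L by auto
  qed (use L in auto)
qed

lemma leading_left_singular_vec_top:
  shows "leading_left_singular_vec B \<in> carrier_vec n" "is_top n m Bf (vec_index (leading_left_singular_vec B))"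
proof -
  obtain i where i: "i < n" "orth_proj E (unit_vec n i) \<noteq> 0\<^sub>v n"
    and eq: "leading_left_singular_vec B = (1 / vec_norm2 (orth_proj E (unit_vec n i))) \<cdot>\<^sub>v orth_proj E (unit_vec n i)"
    by (rule leading_left_singular_vec_selected) blast
  define p where "p = orth_proj E (unit_vec n i)"
  have p: "p \<in> carrier_vec n" "p \<in> E" "p \<noteq> 0\<^sub>v n"
    using i orth_proj_carrier orth_proj_E(1)[of "unit_vec n i"] by (auto simp: p_def)
  have u: "leading_left_singular_vec B = (1 / vec_norm2 p) \<cdot>\<^sub>v p"
    by (simp add: eq p_def)
  show c: "leading_left_singular_vec B \<in> carrier_vec n" using p by (simp add: u)
  have n2: "(vec_norm2 p)\<^sup>2 = nsq {..<n} (vec_index p)"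
    using p by (simp add: vec_norm2_def ip_scalar_prod nsq_eq_ip[symmetric])
  have nz: "nsq {..<n} (vec_index p) \<noteq> 0"
    using p nsq_zero_imp[of n "vec_index p"] by (auto intro!: eq_vecI)
  have "nsq {..<n} (vec_index (leading_left_singular_vec B)) = nsq {..<n} (\<lambda>k. 1 / vec_norm2 p * vec_index p k)"
    using p by (intro nsq_cong) (auto simp: u)
  also have "\<dots> = 1"
    unfolding nsq_scale using n2 nz by (simp add: power_divide)
  finally have one: "nsq {..<n} (vec_index (leading_left_singular_vec B)) = 1" .
  have "0\<^sub>v n + (1 / vec_norm2 p) \<cdot>\<^sub>v p \<in> E"
    by (rule E_smult_add[OF zero_E p(2)])
  then have "leading_left_singular_vec B \<in> E" using p by (simp add: u)
  then have "nsq {..<m} (tm {..<n} Bf (vec_index (leading_left_singular_vec B))) = top_eig"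
    using eigen_iff[OF c] one by (simp add: mem_E)
  then show "is_top n m Bf (vec_index (leading_left_singular_vec B))"
    using one by (simp add: is_top_iff)
qed

text \<open>The selection rule starts from the first coordinate vector, so the first coordinate of the
  selected vector is, up to sign, as large as the leading singular subspace allows.\<close>

lemma leading_left_singular_vec_first_coordinate:
  assumes t: "t > 0"
  shows "t \<le> (vec_index (leading_left_singular_vec B) 0)\<^sup>2 \<longleftrightarrow> (\<exists>w. is_top n m Bf w \<and> t \<le> (w 0)\<^sup>2)"
proof
  assume "t \<le> (vec_index (leading_left_singular_vec B) 0)\<^sup>2"
  then show "\<exists>w. is_top n m Bf w \<and> t \<le> (w 0)\<^sup>2"
    using leading_left_singular_vec_top(2) by blast
next
  assume "\<exists>w. is_top n m Bf w \<and> t \<le> (w 0)\<^sup>2"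
  then obtain w where w: "is_top n m Bf w" "t \<le> (w 0)\<^sup>2" by blast
  define v where "v = Matrix.vec n w"
  have v: "v \<in> carrier_vec n" by (simp add: v_def)
  have nv: "nsq {..<n} (vec_index v) = nsq {..<n} w" "tm {..<n} Bf (vec_index v) = tm {..<n} Bf w"
    by (simp_all add: v_def)
  have vE: "v \<in> E"
    using w v by (simp add: mem_E eigen_iff nv is_top_iff)
  define p where "p = orth_proj E (unit_vec n 0)"
  have p: "p \<in> carrier_vec n" "p \<in> E"
    using n orth_proj_carrier orth_proj_E(1)[of "unit_vec n 0"] by (auto simp: p_def)
  have pv: "p \<bullet> v = w 0"
    unfolding p_def by (subst orth_proj_coordinate[OF n vE]) (simp add: v_def n)
  \<comment> \<open>Positivity of \<open>t\<close> makes the projection of the first coordinate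
    vector nonzero, so the rule stops at index 0.\<close>
  have "p \<noteq> 0\<^sub>v n" using pv w t v by auto
  then have u: "leading_left_singular_vec B = (1 / vec_norm2 p) \<cdot>\<^sub>v p"
    by (rule_tac leading_left_singular_vec_selected) (metis p_def not_gr_zero)
  \<comment> \<open>For an orthogonal projection the first coordinate of the image of the first
    coordinate vector is its squared length; after normalisation the squared first coordinate is
    again that squared length, which Cauchy-Schwarz shows to be maximal.\<close>
  have p0: "vec_index p 0 = nsq {..<n} (vec_index p)"
    using orth_proj_coordinate[OF n p(2)] p by (simp add: p_def[symmetric] ip_scalar_prod nsq_eq_ip)
  have n2: "(vec_norm2 p)\<^sup>2 = nsq {..<n} (vec_index p)"
    using p by (simp add: vec_norm2_def ip_scalar_prod nsq_eq_ip[symmetric])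
  have "(w 0)\<^sup>2 = (ip {..<n} (vec_index p) (vec_index v))\<^sup>2"
    using pv p v by (simp add: ip_scalar_prod)
  also have "\<dots> \<le> nsq {..<n} (vec_index p) * nsq {..<n} (vec_index v)"
    unfolding ip_def nsq_def by (rule Cauchy_Schwarz_ineq_sum)
  also have "\<dots> = nsq {..<n} (vec_index p)"
    using w nv by (simp add: is_top_def)
  also have "\<dots> = (vec_index (leading_left_singular_vec B) 0)\<^sup>2"
  proof -
    have "(vec_index (leading_left_singular_vec B) 0)\<^sup>2 = (nsq {..<n} (vec_index p))\<^sup>2 / nsq {..<n} (vec_index p)"
      using p n by (simp add: u p0 power_divide n2)
    then show ?thesis by (simp add: power2_eq_square)
  qed
  finally show "t \<le> (vec_index (leading_left_singular_vec B) 0)\<^sup>2"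
    using w by simp
qed

end

section \<open>Concentration of the loss\<close>

lemma spiked_tm_self:
  assumes "nsq I x = 1"
  shows "spiked_tm I x y s A x = (\<lambda>j. tm I A x j + s * y j)"
  using assms by (simp add: spiked_tm_def fun_eq_iff nsq_eq_ip)

context bidiag
begin

lemma top_good_maximizer:
  assumes D': "0 < D'" and k: "0 < k" and x: "nsq I x = 1"
    and top: "top_good t k I J x y s A"
    and u: "nsq I u = 1" "\<And>w. nsq J (spiked_tm I x y s A w) \<le> nsq I w * nsq J (spiked_tm I x y s A u)"
    and W: "0 < nsq J (spiked_tm I x y s A x)"
  defines "W \<equiv> nsq J (spiked_tm I x y s A x)" and "F \<equiv> nsq J (spiked_tm I x y s A u)"
    and "\<kappa> \<equiv> sqrt (1 - (ip I x u)\<^sup>2)"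
  shows "W * (D' + r * L')\<^sup>2 * geo r k \<le> F * (D'\<^sup>2 + r\<^sup>2 * W * geo r k)"
    and "sqrt F \<le> sqrt (W - (W - D\<^sup>2) * \<kappa>\<^sup>2) + L * \<kappa>"
proof -
  let ?w = "spiked_tm I x y s A x"
  have W0: "0 < W" using W by (simp add: W_def)
  obtain v where v: "nsq I v = geo r k" "ip I x v = 0" "L' * sqrt W < ip J ?w (tm I A v)"
    "W * ((D' + r * L')\<^sup>2 * geo r (k - 1)) < W * nsq J (tm I A v) - (ip J ?w (tm I A v))\<^sup>2"
    using top W unfolding top_good_def W_def by auto
  \<comment> \<open>This \<open>c\<close> continues the geometric pattern up to the spiked row: with
    the model entries, the image of \<open>x + c v\<close> is sqrt W (D' + r L') / D' times (1, r,
    r^2, ...).\<close>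
  define p T c where "p = ip J ?w (tm I A v)" and "T = nsq J (tm I A v)" and "c = r * sqrt W / D'"
  have c: "0 \<le> c" "c\<^sup>2 = r\<^sup>2 * W / D'\<^sup>2" "c * sqrt W = r * W / D'"
    using nonneg W0 by (simp_all add: c_def power_divide power_mult_distrib)
  define z where "z i = x i + c * v i" for i
  have nz: "nsq I z = 1 + c\<^sup>2 * geo r k"
    unfolding z_def nsq_add_smult using x v by simp
  have "ip I x z = 1"
    using x v(2) by (simp add: z_def ip_def nsq_eq_ip distrib_left sum.distrib sum_distrib_left[symmetric] mult.left_commute[of _ c])
  then have "spiked_tm I x y s A z = (\<lambda>j. ?w j + c * tm I A v j)"
    unfolding spiked_tm_self[OF x] by (simp add: fun_eq_iff spiked_tm_def z_def[abs_def] tm_add_smult)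
  then have sz: "nsq J (spiked_tm I x y s A z) = W + 2 * c * p + c\<^sup>2 * T"
    by (simp add: nsq_add_smult W_def p_def T_def)
  have k': "geo r k = 1 + r\<^sup>2 * geo r (k - 1)"
    using k geo_Suc[of r "k - 1"] by simp
  \<comment> \<open>Pythagoras along the spiked row, multiplied by its squared length
    \<open>W\<close> to avoid normalising it.\<close>
  have "(W * (D' + r * L') / D')\<^sup>2 + c\<^sup>2 * (W * ((D' + r * L')\<^sup>2 * geo r (k - 1))) \<le> (W + c * p)\<^sup>2 + c\<^sup>2 * (W * T - p\<^sup>2)"
  proof (rule add_mono)
    have "W * (D' + r * L') / D' = W + L' * (c * sqrt W)"
      unfolding c(3) using D' by (simp add: field_simps)
    also have "\<dots> = W + c * (L' * sqrt W)" by simp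
    also have "\<dots> \<le> W + c * p"
      using v(3) c(1) by (intro add_left_mono mult_left_mono) (auto simp: p_def)
    finally show "(W * (D' + r * L') / D')\<^sup>2 \<le> (W + c * p)\<^sup>2"
      using W0 nonneg D' by (intro power_mono) auto
    show "c\<^sup>2 * (W * ((D' + r * L')\<^sup>2 * geo r (k - 1))) \<le> c\<^sup>2 * (W * T - p\<^sup>2)"
      using v(4) by (intro mult_left_mono) (auto simp: p_def T_def)
  qed
  also have "\<dots> = W * (W + 2 * c * p + c\<^sup>2 * T)"
    by (simp add: power2_eq_square algebra_simps)
  also have "\<dots> \<le> W * ((1 + c\<^sup>2 * geo r k) * F)"
    using u(2)[of z] W0 by (intro mult_left_mono) (auto simp: sz nz F_def)
  also have "(W * (D' + r * L') / D')\<^sup>2 + c\<^sup>2 * (W * ((D' + r * L')\<^sup>2 * geo r (k - 1))) = W * (W * (D' + r * L')\<^sup>2 * geo r k / D'\<^sup>2)"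
  proof -
    have "(W * a / D')\<^sup>2 + (r\<^sup>2 * W / D'\<^sup>2) * (W * (a\<^sup>2 * g)) = W * (W * a\<^sup>2 * (1 + r\<^sup>2 * g) / D'\<^sup>2)" for a g
      by (simp add: power_divide power_mult_distrib power2_eq_square[of W] add_divide_distrib algebra_simps)
    then show ?thesis unfolding c(2) k' .
  qed
  finally have "W * (D' + r * L')\<^sup>2 * geo r k / D'\<^sup>2 \<le> (1 + c\<^sup>2 * geo r k) * F"
    using W0 by (rule mult_left_le_imp_le)
  then have "W * (D' + r * L')\<^sup>2 * geo r k \<le> (1 + c\<^sup>2 * geo r k) * F * D'\<^sup>2"
    using D' by (simp add: pos_divide_le_eq)
  also have "\<dots> = F * (D'\<^sup>2 + r\<^sup>2 * W * geo r k)"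
    unfolding c(2) using D' by (simp add: field_simps)
  finally show "W * (D' + r * L')\<^sup>2 * geo r k \<le> F * (D'\<^sup>2 + r\<^sup>2 * W * geo r k)" .
  have "(ip I x u)\<^sup>2 \<le> nsq I x * nsq I u"
    unfolding ip_def nsq_def by (rule Cauchy_Schwarz_ineq_sum)
  then have \<kappa>2: "\<kappa>\<^sup>2 = 1 - (ip I x u)\<^sup>2"
    using x u by (simp add: \<kappa>_def)
  have "sqrt F \<le> sqrt (W * (ip I x u)\<^sup>2 + D\<^sup>2 * (nsq I u - (ip I x u)\<^sup>2)) + L * sqrt (nsq I u - (ip I x u)\<^sup>2)"
    using top unfolding top_good_def W_def F_def by blast
  also have "W * (ip I x u)\<^sup>2 + D\<^sup>2 * (nsq I u - (ip I x u)\<^sup>2) = W - (W - D\<^sup>2) * \<kappa>\<^sup>2"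
    unfolding \<kappa>2 u(1) by (simp add: algebra_simps)
  finally show "sqrt F \<le> sqrt (W - (W - D\<^sup>2) * \<kappa>\<^sup>2) + L * \<kappa>"
    by (simp add: u \<kappa>_def)
qed

end

text \<open>Division by the squared spike strength reduces to the dimensionless estimates. The ratio
  \<open>r\<close> is then \<open>sqrt (l * d)\<close>, and \<open>\<omega> < 1\<close> keeps the
  geometric series summable uniformly.\<close>

lemma spiked_overlap:
  fixes n m s C \<omega> \<delta> t :: real and k :: nat
  defines "\<eta> \<equiv> 168 * C ^ 3 * \<delta> + 12 * C ^ 4 * \<omega> ^ (k - 1)"
  assumes pos: "0 < n" "0 < m" "0 < s" and C: "1 \<le> C" "n \<le> C * s\<^sup>2" "m \<le> C * s\<^sup>2"
    and \<omega>: "n * m \<le> \<omega> * (s\<^sup>2)\<^sup>2" "\<omega> < 1" "0 \<le> \<omega>" and \<delta>: "0 < \<delta>" "8 * C * \<delta> \<le> 1" and k: "0 < k"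
    and x: "nsq I x = 1" and y: "nsq J y = 1"
    and top: "bidiag.top_good (sqrt ((1 + \<delta>) * m)) (sqrt ((1 + \<delta>) * n)) (sqrt ((1 - \<delta>) * m)) (sqrt ((1 - \<delta>) * n))
       (sqrt ((1 - \<delta>) * m) * sqrt ((1 - \<delta>) * n) / s\<^sup>2) (\<delta> * sqrt m) k I J x y s A"
    and u: "nsq I u = 1" "\<And>w. nsq J (spiked_tm I x y s A w) \<le> nsq I w * nsq J (spiked_tm I x y s A u)"
  shows "\<bar>s\<^sup>2 * (1 - (ip I x u)\<^sup>2) - n * (s\<^sup>2 + m) / (s\<^sup>2 + n)\<bar> \<le> overlap_error C \<delta> \<eta> * n"
proof -
  have \<delta>C: "\<delta> \<le> C * \<delta>"
    using \<delta> C mult_right_mono[of 1 C \<delta>] by simp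
  then have \<delta>1: "\<delta> \<le> 1 / 8"
    using \<delta> by linarith
  define D L D' L' r where "D = sqrt ((1 + \<delta>) * m)" and "L = sqrt ((1 + \<delta>) * n)"
    and "D' = sqrt ((1 - \<delta>) * m)" and "L' = sqrt ((1 - \<delta>) * n)" and "r = D' * L' / s\<^sup>2"
  have sq: "D\<^sup>2 = (1 + \<delta>) * m" "L\<^sup>2 = (1 + \<delta>) * n" "D'\<^sup>2 = (1 - \<delta>) * m" "L'\<^sup>2 = (1 - \<delta>) * n"
    and p: "0 < D'" "0 < L'" "0 \<le> D" "0 \<le> L"
    using \<delta> \<delta>1 pos by (simp_all add: D_def L_def D'_def L'_def)
  interpret bidiag D L D' L' r
    by unfold_locales (use p in \<open>auto simp: r_def\<close>)
  have top': "top_good (\<delta> * sqrt m) k I J x y s A"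
    using top unfolding D_def L_def D'_def L'_def r_def .
  define W F \<kappa> where "W = nsq J (spiked_tm I x y s A x)" and "F = nsq J (spiked_tm I x y s A u)" and "\<kappa> = sqrt (1 - (ip I x u)\<^sup>2)"
  have s2: "0 < s\<^sup>2" using pos by simp
  define n' \<mu> A' F' where "n' = n / s\<^sup>2" and "\<mu> = m / s\<^sup>2" and "A' = W / s\<^sup>2" and "F' = F / s\<^sup>2"
  have n': "0 < n'" "n' \<le> C" and \<mu>: "0 < \<mu>" "\<mu> \<le> C" and n\<mu>: "n' * \<mu> \<le> \<omega>"
    using pos C \<omega> s2 by (simp_all add: n'_def \<mu>_def pos_divide_le_eq power2_eq_square)
  have W: "W = nsq J (tm I A x) + 2 * s * ip J (tm I A x) y + s\<^sup>2"
    unfolding W_def spiked_tm_self[OF x] nsq_add_smult using y by simp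
  have h: "(1 - \<delta>) * m \<le> nsq J (tm I A x)" "nsq J (tm I A x) \<le> (1 + \<delta>) * m" "\<bar>ip J (tm I A x) y\<bar> \<le> \<delta> * sqrt m"
    using top' unfolding top_good_def sq by auto
  \<comment> \<open>The arithmetic-geometric mean inequality turns the cross term of the spiked row
    into a relative error.\<close>
  have "2 * s * sqrt m \<le> s\<^sup>2 + m"
    using sum_squares_bound[of s "sqrt m"] pos by simp
  then have "\<delta> * (2 * s * sqrt m) \<le> \<delta> * (s\<^sup>2 + m)"
    using \<delta> by (intro mult_left_mono) auto
  moreover have "\<bar>2 * s * ip J (tm I A x) y\<bar> \<le> 2 * s * (\<delta> * sqrt m)"
    unfolding abs_mult using h(3) pos by (intro mult_mono) auto
  ultimately have "\<bar>2 * s * ip J (tm I A x) y\<bar> \<le> \<delta> * (s\<^sup>2 + m)"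
    by (simp add: algebra_simps)
  then have Wd: "\<bar>W - s\<^sup>2 - m\<bar> \<le> \<delta> * (s\<^sup>2 + 2 * m)"
    using h(1,2) unfolding W by (simp add: algebra_simps abs_le_iff)
  have "A' - 1 - \<mu> = (W - s\<^sup>2 - m) / s\<^sup>2"
    using s2 by (simp add: A'_def \<mu>_def field_simps)
  then have "\<bar>A' - 1 - \<mu>\<bar> = \<bar>W - s\<^sup>2 - m\<bar> / s\<^sup>2"
    using s2 by (simp add: abs_mult)
  also have "\<dots> \<le> \<delta> * (s\<^sup>2 + 2 * m) / s\<^sup>2"
    using Wd s2 by (intro divide_right_mono) auto
  also have "\<dots> = \<delta> * (1 + 2 * \<mu>)"
    using s2 by (simp add: \<mu>_def field_simps)
  finally have A': "\<bar>A' - 1 - \<mu>\<bar> \<le> \<delta> * (1 + 2 * \<mu>)" .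
  have W0: "0 < W"
  proof -
    have "\<delta> * (s\<^sup>2 + 2 * m) \<le> 1 / 8 * (s\<^sup>2 + 2 * m)"
      using \<delta>1 s2 pos by (intro mult_right_mono) auto
    moreover have "- (W - s\<^sup>2 - m) \<le> \<delta> * (s\<^sup>2 + 2 * m)"
      using Wd by (rule abs_le_D2)
    ultimately have "7 / 8 * s\<^sup>2 + 3 / 4 * m \<le> W"
      by (simp add: field_simps)
    then show ?thesis
      using s2 pos(2) by (smt (verit) mult_pos_pos divide_pos_pos)
  qed
  note max = top_good_maximizer[OF p(1) k x top' u W0[unfolded W_def], folded W_def F_def \<kappa>_def]
  define l d where "l = (1 - \<delta>) * n'" and "d = (1 - \<delta>) * \<mu>"
  have r: "r = sqrt (l * d)"
  proof -
    have "r\<^sup>2 = l * d"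
      by (simp add: r_def power_divide power_mult_distrib sq l_def d_def n'_def \<mu>_def power2_eq_square[of "s\<^sup>2"])
    moreover have "0 \<le> r" by (rule nonneg)
    ultimately show ?thesis by (metis real_sqrt_unique)
  qed
  have l: "l = L'\<^sup>2 / s\<^sup>2" by (simp add: l_def n'_def sq)
  have "A' * (1 + l)\<^sup>2 * geo r k \<le> F' * (1 + l * A' * geo r k)"
  proof -
    have "D'\<^sup>2 * (W * (1 + l)\<^sup>2 * geo r k) = W * (D' + r * L')\<^sup>2 * geo r k"
      by (simp add: r_def l power2_eq_square algebra_simps)
    also have "\<dots> \<le> F * (D'\<^sup>2 + r\<^sup>2 * W * geo r k)" by (rule max)
    also have "\<dots> = D'\<^sup>2 * (F * (1 + l * A' * geo r k))"
      by (simp add: r_def l A'_def power_divide power_mult_distrib algebra_simps power2_eq_square[of "s\<^sup>2"])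
    finally have "W * (1 + l)\<^sup>2 * geo r k \<le> F * (1 + l * A' * geo r k)"
      using p by simp
    then have "W * (1 + l)\<^sup>2 * geo r k / s\<^sup>2 \<le> F * (1 + l * A' * geo r k) / s\<^sup>2"
      using s2 by (intro divide_right_mono) auto
    then show ?thesis by (simp add: A'_def F'_def)
  qed
  then have deficit: "(1 + (1 + \<delta>) * n' / (A' - (1 + \<delta>) * \<mu>)) * A' - F' \<le> \<eta> * n'"
    unfolding \<eta>_def r l_def d_def
    by (intro top_eigenvalue_deficit C(1) n' \<mu> n\<mu> \<omega>(2) \<delta> k A')
  have "(ip I x u)\<^sup>2 \<le> nsq I x * nsq I u"
    unfolding ip_def nsq_def by (rule Cauchy_Schwarz_ineq_sum)
  then have \<kappa>: "0 \<le> \<kappa>" "\<kappa> \<le> 1" "\<kappa>\<^sup>2 = 1 - (ip I x u)\<^sup>2"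
    using x u by (simp_all add: \<kappa>_def)
  have F2: "sqrt F' \<le> sqrt (A' - (A' - (1 + \<delta>) * \<mu>) * \<kappa>\<^sup>2) + sqrt ((1 + \<delta>) * n') * \<kappa>"
  proof -
    have "sqrt F' = sqrt F / s"
      using pos by (simp add: F'_def real_sqrt_divide)
    also have "\<dots> \<le> (sqrt (W - (W - D\<^sup>2) * \<kappa>\<^sup>2) + L * \<kappa>) / s"
      using max(2) pos by (intro divide_right_mono) auto
    also have "\<dots> = sqrt ((W - (W - D\<^sup>2) * \<kappa>\<^sup>2) / s\<^sup>2) + L / s * \<kappa>"
      using pos by (simp add: real_sqrt_divide add_divide_distrib)
    also have "(W - (W - D\<^sup>2) * \<kappa>\<^sup>2) / s\<^sup>2 = A' - (A' - (1 + \<delta>) * \<mu>) * \<kappa>\<^sup>2"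
      using pos(3) by (simp add: A'_def \<mu>_def sq field_simps)
    also have "L / s = sqrt ((1 + \<delta>) * n')"
      using pos by (simp add: L_def n'_def real_sqrt_divide)
    finally show ?thesis .
  qed
  have \<eta>0: "0 \<le> \<eta>"
    using C \<delta> \<omega> by (simp add: \<eta>_def)
  have "\<bar>\<kappa>\<^sup>2 - n' * (1 + \<mu>) / (1 + n')\<bar> \<le> overlap_error C \<delta> \<eta> * n'"
    by (rule overlap_estimate[OF C(1) n' \<mu> \<delta> \<eta>0 A' deficit \<kappa>(1,2) _ F2]) (simp add: F'_def F_def)
  then have "s\<^sup>2 * \<bar>\<kappa>\<^sup>2 - n' * (1 + \<mu>) / (1 + n')\<bar> \<le> s\<^sup>2 * (overlap_error C \<delta> \<eta> * n')"
    by (rule mult_left_mono) simp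
  moreover have "s\<^sup>2 * \<bar>\<kappa>\<^sup>2 - n' * (1 + \<mu>) / (1 + n')\<bar> = \<bar>s\<^sup>2 * (1 - (ip I x u)\<^sup>2) - n * (s\<^sup>2 + m) / (s\<^sup>2 + n)\<bar>"
  proof -
    have "n' * (1 + \<mu>) / (1 + n') = n * (s\<^sup>2 + m) / (s\<^sup>2 + n) / s\<^sup>2"
    proof -
      have "1 + \<mu> = (s\<^sup>2 + m) / s\<^sup>2" "1 + n' = (s\<^sup>2 + n) / s\<^sup>2"
        using s2 by (simp_all add: n'_def \<mu>_def add_divide_distrib)
      moreover have "n / a * ((a + m) / a) / ((a + n) / a) = n * (a + m) / (a + n) / a" if "a > 0" for a
        using that by (simp add: divide_simps)
      ultimately show ?thesis
        unfolding n'_def using s2 by metis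
    qed
    then have "s\<^sup>2 * (\<kappa>\<^sup>2 - n' * (1 + \<mu>) / (1 + n')) = s\<^sup>2 * (1 - (ip I x u)\<^sup>2) - n * (s\<^sup>2 + m) / (s\<^sup>2 + n)"
      using s2 by (simp add: right_diff_distrib \<kappa>(3))
    then show ?thesis
      using s2 by (metis abs_mult abs_of_pos)
  qed
  moreover have "s\<^sup>2 * (overlap_error C \<delta> \<eta> * n') = overlap_error C \<delta> \<eta> * n"
    using s2 by (simp add: n'_def)
  ultimately show ?thesis by simp
qed

section \<open>From matrix entries on a probability space to the loss\<close>

lemma std_gaussian_matrix_event:
  fixes Q :: "(nat \<times> nat \<Rightarrow> real) \<Rightarrow> bool"
  assumes Z: "std_gaussian_matrix M n m Z" and nm: "0 < n" "0 < m"
  defines "G \<equiv> gauss_space ({..<n} \<times> {..<m})" and "X \<equiv> (\<lambda>\<omega>. \<lambda>p\<in>{..<n} \<times> {..<m}. Z \<omega> $$ p)"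
  assumes Q: "{A \<in> space G. Q A} \<in> sets G"
  shows "{\<omega> \<in> space M. Q (X \<omega>)} \<in> sets M" and "emeasure M {\<omega> \<in> space M. Q (X \<omega>)} = emeasure G {A \<in> space G. Q A}"
proof -
  let ?K = "{..<n} \<times> {..<m}"
  define Y where "Y = (\<lambda>p \<omega>. Z \<omega> $$ p)"
  interpret prob_space M
    using Z by (simp add: std_gaussian_matrix_def)
  have "(\<lambda>(i, j) \<omega>. Z \<omega> $$ (i, j)) = Y"
    by (auto simp: Y_def fun_eq_iff)
  then have indep: "indep_vars (\<lambda>_. borel) Y ?K"
    using Z by (simp add: std_gaussian_matrix_def)
  have dist: "distributed M lborel (Y p) (\<lambda>x. ennreal (std_normal_density x))" if "p \<in> ?K" for p
    using Z that by (auto simp: std_gaussian_matrix_def Y_def)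
  have Y [measurable]: "Y p \<in> borel_measurable M" if "p \<in> ?K" for p
    using distributed_measurable[OF dist[OF that]] by simp
  have gauss: "distr M borel (Y p) = gauss" if "p \<in> ?K" for p
  proof -
    have "distr M borel (Y p) = distr M lborel (Y p)"
      by (rule distr_cong) auto
    then show ?thesis
      using distributed_distr_eq_density[OF dist[OF that]] by (simp add: gauss_def)
  qed
  have ne: "?K \<noteq> {}"
    using nm by auto
  have X_eq: "X = (\<lambda>\<omega>. \<lambda>p\<in>?K. Y p \<omega>)"
    by (simp add: X_def Y_def)
  have XB: "X \<in> measurable M (PiM ?K (\<lambda>_. borel))"
    unfolding X_eq by (rule measurable_restrict) (rule Y)
  have "distr M (PiM ?K (\<lambda>_. borel)) X = PiM ?K (\<lambda>p. distr M borel (Y p))"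
    using indep Y unfolding X_eq by (subst (asm) indep_vars_iff_distr_eq_PiM'[OF ne]) auto
  also have "\<dots> = G"
    unfolding G_def by (rule PiM_cong) (use gauss in auto)
  finally have distr: "distr M (PiM ?K (\<lambda>_. borel)) X = G" .
  have E: "{A \<in> space G. Q A} \<in> sets (PiM ?K (\<lambda>_. borel))"
    using Q unfolding distr[symmetric] by simp
  have vim: "X -` {A \<in> space G. Q A} \<inter> space M = {\<omega> \<in> space M. Q (X \<omega>)}"
    using measurable_space[OF XB] by (auto simp: G_def space_PiM)
  show "{\<omega> \<in> space M. Q (X \<omega>)} \<in> sets M"
    using measurable_sets[OF XB E] vim by simp
  show "emeasure M {\<omega> \<in> space M. Q (X \<omega>)} = emeasure G {A \<in> space G. Q A}"
    unfolding vim[symmetric] by (subst distr[symmetric], subst emeasure_distr[OF XB E]) simp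
qed

lemma frobenius_norm_projected_outer_prod:
  assumes a: "a \<in> carrier_vec n" and u: "u \<in> carrier_vec n" "nsq {..<n} (vec_index u) = 1"
  shows "(frobenius_norm ((1\<^sub>m n - outer_prod u u) * outer_prod a b))\<^sup>2 =
    nsq {..<dim_vec b} (vec_index b) * (nsq {..<n} (vec_index a) - (ip {..<n} (vec_index u) (vec_index a))\<^sup>2)"
proof -
  let ?P = "1\<^sub>m n - outer_prod u u" and ?a = "vec_index a" and ?u = "vec_index u" and ?b = "vec_index b"
  define p where "p = ip {..<n} ?u ?a"
  have P: "?P \<in> carrier_mat n n" and O: "outer_prod a b \<in> carrier_mat n (dim_vec b)"
    using a u by (auto simp: outer_prod_def)
  have entry: "(?P * outer_prod a b) $$ (i, j) = ?b j * (?a i + (- p) * ?u i)" if ij: "i < n" "j < dim_vec b" for i j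
  proof -
    have "(A * B) $$ (i, j) = (\<Sum>k<n. A $$ (i, k) * B $$ (k, j))"
      if "A \<in> carrier_mat n n" "B \<in> carrier_mat n (dim_vec b)" for A B :: rmat
      using that ij by (simp add: scalar_prod_def lessThan_atLeast0)
    then have "(?P * outer_prod a b) $$ (i, j) = (\<Sum>k<n. ?P $$ (i, k) * outer_prod a b $$ (k, j))"
      using P O by blast
    also have "\<dots> = (\<Sum>k<n. ((if i = k then 1 else 0) - ?u i * ?u k) * (?a k * ?b j))"
      using ij a u by (intro sum.cong refl) (auto simp: outer_prod_def)
    also have "\<dots> = (\<Sum>k<n. (if i = k then ?a k * ?b j else 0)) - (\<Sum>k<n. ?b j * ?u i * (?u k * ?a k))"
      unfolding sum_subtractf[symmetric] by (intro sum.cong refl) (simp add: algebra_simps)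
    also have "\<dots> = ?a i * ?b j - ?b j * ?u i * p"
      using ij by (simp add: p_def ip_def sum_distrib_left)
    finally show ?thesis by (simp add: algebra_simps)
  qed
  have "(frobenius_norm A)\<^sup>2 = (\<Sum>i<n. \<Sum>j<dim_vec b. (A $$ (i, j))\<^sup>2)" if "A \<in> carrier_mat n (dim_vec b)" for A
    using that by (auto simp: frobenius_norm_def sum_nonneg)
  then have "(frobenius_norm (?P * outer_prod a b))\<^sup>2 = (\<Sum>i<n. \<Sum>j<dim_vec b. ((?P * outer_prod a b) $$ (i, j))\<^sup>2)"
    using mult_carrier_mat[OF P O] by blast
  also have "\<dots> = (\<Sum>i<n. \<Sum>j<dim_vec b. (?a i + (- p) * ?u i)\<^sup>2 * (?b j)\<^sup>2)"
    by (intro sum.cong refl) (simp add: entry power_mult_distrib mult.commute)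
  also have "\<dots> = nsq {..<n} (\<lambda>i. ?a i + (- p) * ?u i) * nsq {..<dim_vec b} ?b"
    by (simp add: nsq_def sum_product)
  also have "nsq {..<n} (\<lambda>i. ?a i + (- p) * ?u i) = nsq {..<n} ?a - p\<^sup>2"
  proof -
    have "ip {..<n} ?a ?u = p" by (simp add: p_def ip_def mult.commute)
    then show ?thesis
      unfolding nsq_add_smult using u(2) by (simp add: power2_eq_square)
  qed
  finally show ?thesis by (simp add: p_def mult.commute)
qed

lemma spiked_mat_carrier:
  assumes "A \<in> carrier_mat n m" "a \<in> carrier_vec n" "b \<in> carrier_vec m"
  shows "spiked_mat \<sigma> A a b \<in> carrier_mat n m"
  using assms by (auto simp: spiked_mat_def outer_prod_def)

lemma spiked_mat_entry:
  assumes "A \<in> carrier_mat n m" "a \<in> carrier_vec n" "b \<in> carrier_vec m" "i < n" "j < m"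
  shows "spiked_mat \<sigma> A a b $$ (i, j) = vec_index a i * vec_index b j + \<sigma> * A $$ (i, j)"
  using assms by (auto simp: spiked_mat_def outer_prod_def)

lemma u_hat_is_top:
  assumes A: "A \<in> carrier_mat n m" "a \<in> carrier_vec n" "b \<in> carrier_vec m" and n: "0 < n"
  shows "u_hat \<sigma> A a b \<in> carrier_vec n"
    and "is_top n m (\<lambda>p. spiked_mat \<sigma> A a b $$ p) (vec_index (u_hat \<sigma> A a b))"
  using leading_left_singular_vec_top[OF spiked_mat_carrier[OF A] n] by (simp_all add: u_hat_def)

lemma loss_eq:
  assumes A: "A \<in> carrier_mat n m" "a \<in> carrier_vec n" "b \<in> carrier_vec m" and n: "0 < n"
  shows "(frobenius_norm (P_hat \<sigma> A a b * outer_prod a b))\<^sup>2 =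
    nsq {..<m} (vec_index b) * (nsq {..<n} (vec_index a) - (ip {..<n} (vec_index (u_hat \<sigma> A a b)) (vec_index a))\<^sup>2)"
proof -
  have "dim_vec a = n" "dim_vec b = m" using A by auto
  then show ?thesis
    using frobenius_norm_projected_outer_prod[OF A(2) u_hat_is_top(1)[OF A n], of \<sigma> b] u_hat_is_top(2)[OF A n, of \<sigma>]
    by (simp add: P_hat_def is_top_def)
qed

text \<open>The failure probability with Chernoff rates inserted. The power \<open>Suc k\<close>
  accounts for \<open>k\<close> steps and the row of the spike. Neither the spike nor
  \<open>\<sigma>\<close> occurs in it, and this gives the uniformity of the supremum.\<close>

definition tail_bound :: "real \<Rightarrow> nat \<Rightarrow> nat \<Rightarrow> nat \<Rightarrow> real" where
  "tail_bound \<delta> k n m =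
    (let p = sqrt (1 + \<delta>) * exp (- \<delta> / 2); q = sqrt (1 - \<delta>) * exp (\<delta> / 2); z = sqrt (1 - \<delta>) ^ Suc k
     in p ^ m + q ^ m / z + 2 * exp (1 / 2 - \<delta> * sqrt (real m)) +
        (real n * (p ^ m + p ^ n) + real k * (q ^ m / z + q ^ n / z)))"

text \<open>The measurable set \<open>G\<close> may vary with \<open>a\<close> and \<open>b\<close>,
  its probability bound does not. An inner set is produced because the loss is not shown to be
  measurable for general spikes.\<close>

lemma spiked_loss_concentration:
  fixes n m k :: nat and C \<omega> \<delta> \<sigma> :: real and a b :: rvec
  defines "s \<equiv> sqrt (nsq {..<n} (vec_index a) * nsq {..<m} (vec_index b)) / \<sigma>"
  assumes Z: "std_gaussian_matrix M n m Z" and nm: "k < n" "k < m" and \<sigma>: "0 < \<sigma>"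
    and ab: "a \<in> carrier_vec n" "b \<in> carrier_vec m" and s: "0 < s"
    and C: "1 \<le> C" "real n \<le> C * s\<^sup>2" "real m \<le> C * s\<^sup>2"
    and \<omega>: "real n * real m \<le> \<omega> * (s\<^sup>2)\<^sup>2" "\<omega> < 1" "0 \<le> \<omega>" and \<delta>: "0 < \<delta>" "8 * C * \<delta> \<le> 1" and k: "0 < k"
    and \<epsilon>: "overlap_error C \<delta> (168 * C ^ 3 * \<delta> + 12 * C ^ 4 * \<omega> ^ (k - 1)) \<le> \<epsilon>"
  shows "\<exists>G\<in>sets M. 1 - tail_bound \<delta> k n m \<le> measure M G \<and>
    (\<forall>w\<in>G. \<bar>(frobenius_norm (P_hat \<sigma> (Z w) a b * outer_prod a b))\<^sup>2 / \<sigma>\<^sup>2 - real n * (s\<^sup>2 + real m) / (s\<^sup>2 + real n)\<bar> \<le> \<epsilon> * real n)"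
proof -
  interpret M: prob_space M
    using Z by (simp add: std_gaussian_matrix_def)
  have \<delta>C: "\<delta> \<le> C * \<delta>"
    using \<delta> C mult_right_mono[of 1 C \<delta>] by simp
  then have \<delta>1: "\<delta> \<le> 1 / 8"
    using \<delta> by linarith
  let ?I = "{..<n}" and ?J = "{..<m}" and ?a = "vec_index a" and ?b = "vec_index b"
  have nm0: "0 < n" "0 < m" using nm by auto
  define D L D' L' r where "D = sqrt ((1 + \<delta>) * real m)" and "L = sqrt ((1 + \<delta>) * real n)"
    and "D' = sqrt ((1 - \<delta>) * real m)" and "L' = sqrt ((1 - \<delta>) * real n)" and "r = D' * L' / s\<^sup>2"
  have sq: "D\<^sup>2 = (1 + \<delta>) * m" "L\<^sup>2 = (1 + \<delta>) * n" "D'\<^sup>2 = (1 - \<delta>) * m" "L'\<^sup>2 = (1 - \<delta>) * n"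
    and nonneg: "0 \<le> D'" "0 \<le> L'" "0 \<le> D" "0 \<le> L"
    using \<delta> \<delta>1 by (simp_all add: D_def L_def D'_def L'_def)
  interpret bidiag D L D' L' r
    by unfold_locales (use nonneg in \<open>auto simp: r_def\<close>)
  define \<alpha> \<beta> where "\<alpha> = sqrt (nsq ?I ?a)" and "\<beta> = sqrt (nsq ?J ?b)"
  have s_eq: "s = \<alpha> * \<beta> / \<sigma>"
    by (simp add: s_def \<alpha>_def \<beta>_def real_sqrt_mult)
  have \<alpha>\<beta>: "0 < \<alpha>" "0 < \<beta>"
    using s \<sigma> by (auto simp: s_eq \<alpha>_def \<beta>_def zero_less_mult_iff zero_less_divide_iff less_le)
  have \<alpha>2: "\<alpha>\<^sup>2 = nsq ?I ?a" and \<beta>2: "\<beta>\<^sup>2 = nsq ?J ?b"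
    by (simp_all add: \<alpha>_def \<beta>_def)
  define x y where "x i = (if i < n then ?a i / \<alpha> else 0)" and "y j = ?b j / \<beta>" for i j
  have x: "nsq ?I x = 1"
  proof -
    have "nsq ?I x = nsq ?I ?a / \<alpha>\<^sup>2"
      by (simp add: nsq_def x_def power_divide sum_divide_distrib)
    then show ?thesis unfolding \<alpha>2[symmetric] using \<alpha>\<beta> by simp
  qed
  have y: "nsq ?J y = 1"
  proof -
    have "nsq ?J y = nsq ?J ?b / \<beta>\<^sup>2"
      by (simp add: nsq_def y_def power_divide sum_divide_distrib)
    then show ?thesis unfolding \<beta>2[symmetric] using \<alpha>\<beta> by simp
  qed
  define X where "X w = (\<lambda>p\<in>?I \<times> ?J. Z w $$ p)" for w
  let ?good = "\<lambda>A. top_good (\<delta> * sqrt (real m)) k ?I ?J x y s A"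
  define Bad where "Bad = {w \<in> space M. \<not> ?good (X w)}"
  have bad_sets: "gauss_event (?I \<times> ?J) (\<lambda>A. \<not> ?good A) \<in> sets (gauss_space (?I \<times> ?J))"
    by (intro sets.sets_Collect_neg top_good_sets)
  have Bad: "Bad \<in> sets M" "emeasure M Bad = gauss_prob (?I \<times> ?J) (\<lambda>A. \<not> ?good A)"
    unfolding Bad_def X_def using std_gaussian_matrix_event[OF Z nm0 bad_sets] by auto
  define p q z where "p = sqrt (1 + \<delta>) * exp (- \<delta> / 2)" and "q = sqrt (1 - \<delta>) * exp (\<delta> / 2)" and "z = sqrt (1 - \<delta>) ^ Suc k"
  have pqz: "0 \<le> p" "0 \<le> q" "0 \<le> z"
    using \<delta> \<delta>1 by (simp_all add: p_def q_def z_def)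
  have "emeasure M Bad \<le> ennreal (p ^ m) + ennreal (q ^ m / z) + ennreal (2 * exp (1 / 2 - \<delta> * sqrt (real m))) +
      (of_nat n * (ennreal (p ^ m) + ennreal (p ^ n)) + of_nat k * (ennreal (q ^ m / z) + ennreal (q ^ n / z)))"
    unfolding Bad(2)
  proof (rule emeasure_not_top_good[where m = m and N = n and ?k0.0 = "Suc k"])
    fix K :: "(nat \<times> nat) set" assume K: "finite K"
    show "gauss_prob K (\<lambda>z. D\<^sup>2 \<le> nsq K z) \<le> ennreal (p ^ m)" if "card K \<le> m"
      unfolding sq p_def by (rule nsq_upper_tail[OF K that \<delta>(1)])
    show "gauss_prob K (\<lambda>z. L\<^sup>2 \<le> nsq K z) \<le> ennreal (p ^ n)" if "card K \<le> n"
      unfolding sq p_def by (rule nsq_upper_tail[OF K that \<delta>(1)])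
    show "gauss_prob K (\<lambda>z. nsq K z \<le> D'\<^sup>2) \<le> ennreal (q ^ m / z)" if "m \<le> card K + Suc k"
      unfolding sq q_def z_def by (rule nsq_lower_tail[OF K that \<delta>(1)]) (use \<delta>1 in simp)
    show "gauss_prob K (\<lambda>z. nsq K z \<le> L'\<^sup>2) \<le> ennreal (q ^ n / z)" if "n \<le> card K + Suc k"
      unfolding sq q_def z_def by (rule nsq_lower_tail[OF K that \<delta>(1)]) (use \<delta>1 in simp)
    show "gauss_prob K (\<lambda>z. \<delta> * sqrt (real m) \<le> \<bar>ip K z y\<bar>) \<le> ennreal (2 * exp (1 / 2 - \<delta> * sqrt (real m)))"
      if "nsq K y = 1" for y
      by (rule ip_tail[OF K that])
  qed (use nm k x y in \<open>auto simp: x_def\<close>)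
  also have "\<dots> = ennreal (tail_bound \<delta> k n m)"
    unfolding tail_bound_def Let_def p_def[symmetric] q_def[symmetric] z_def[symmetric]
    using pqz by (simp add: ennreal_plus[symmetric] ennreal_mult[symmetric] ennreal_of_nat_eq_real_of_nat del: ennreal_plus)
  finally have le: "emeasure M Bad \<le> ennreal (tail_bound \<delta> k n m)" .
  have "0 \<le> tail_bound \<delta> k n m"
    unfolding tail_bound_def Let_def p_def[symmetric] q_def[symmetric] z_def[symmetric] using pqz by simp
  then have "measure M Bad \<le> tail_bound \<delta> k n m"
    using le unfolding measure_def by (simp add: enn2real_leI)
  then have "1 - tail_bound \<delta> k n m \<le> measure M (space M - Bad)"
    using M.prob_compl[OF Bad(1)] by simp
  moreover have "\<bar>(frobenius_norm (P_hat \<sigma> (Z w) a b * outer_prod a b))\<^sup>2 / \<sigma>\<^sup>2 - real n * (s\<^sup>2 + real m) / (s\<^sup>2 + real n)\<bar> \<le> \<epsilon> * real n"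
    if w: "w \<in> space M - Bad" for w
  proof -
    have Zw: "Z w \<in> carrier_mat n m"
      using Z w by (auto simp: std_gaussian_matrix_def)
    define u where "u = vec_index (u_hat \<sigma> (Z w) a b)"
    have u: "is_top n m (\<lambda>p. spiked_mat \<sigma> (Z w) a b $$ p) u"
      unfolding u_def by (rule u_hat_is_top(2)[OF Zw ab nm0(1)])
    have "tm ?I (\<lambda>p. spiked_mat \<sigma> (Z w) a b $$ p) v j = \<sigma> * spiked_tm ?I x y s (X w) v j" if j: "j \<in> ?J" for v j
    proof -
      have "tm ?I (\<lambda>p. spiked_mat \<sigma> (Z w) a b $$ p) v j = (\<Sum>i<n. (?a i * ?b j + \<sigma> * Z w $$ (i, j)) * v i)"
        unfolding tm_def using j by (intro sum.cong refl) (simp add: spiked_mat_entry[OF Zw ab])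
      also have "\<dots> = ip ?I ?a v * ?b j + \<sigma> * tm ?I (X w) v j"
        using j by (simp add: ip_def tm_def X_def sum_distrib_left sum_distrib_right sum.distrib[symmetric] algebra_simps)
      also have "ip ?I ?a v = \<alpha> * ip ?I x v"
        using \<alpha>\<beta> by (simp add: ip_def x_def sum_distrib_left)
      also have "\<alpha> * ip ?I x v * ?b j = \<sigma> * (s * ip ?I x v * y j)"
        using \<alpha>\<beta> \<sigma> by (simp add: s_eq y_def)
      finally show ?thesis
        by (simp add: spiked_tm_def algebra_simps)
    qed
    then have "nsq ?J (tm ?I (\<lambda>p. spiked_mat \<sigma> (Z w) a b $$ p) v) = nsq ?J (\<lambda>j. \<sigma> * spiked_tm ?I x y s (X w) v j)" for v
      by (intro nsq_cong refl) auto
    then have sp: "nsq ?J (tm ?I (\<lambda>p. spiked_mat \<sigma> (Z w) a b $$ p) v) = \<sigma>\<^sup>2 * nsq ?J (spiked_tm ?I x y s (X w) v)" for v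
      by (simp add: nsq_scale)
    have u1: "nsq ?I u = 1" using u by (simp add: is_top_def)
    have umax: "nsq ?J (spiked_tm ?I x y s (X w) v) \<le> nsq ?I v * nsq ?J (spiked_tm ?I x y s (X w) u)" for v
    proof -
      have "\<sigma>\<^sup>2 * nsq ?J (spiked_tm ?I x y s (X w) v) \<le> \<sigma>\<^sup>2 * (nsq ?I v * nsq ?J (spiked_tm ?I x y s (X w) u))"
        using u unfolding is_top_def sp by (simp add: mult.left_commute)
      then show ?thesis using \<sigma> by simp
    qed
    have good: "?good (X w)" using w by (simp add: Bad_def)
    have "\<bar>s\<^sup>2 * (1 - (ip ?I x u)\<^sup>2) - real n * (s\<^sup>2 + real m) / (s\<^sup>2 + real n)\<bar> \<le>
       overlap_error C \<delta> (168 * C ^ 3 * \<delta> + 12 * C ^ 4 * \<omega> ^ (k - 1)) * real n"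
      by (rule spiked_overlap[OF _ _ s C \<omega> \<delta> k x y _ u1 umax]) (use nm0 good in \<open>auto simp: D_def L_def D'_def L'_def r_def\<close>)
    also have "\<dots> \<le> \<epsilon> * real n"
      using \<epsilon> by (intro mult_right_mono) auto
    finally have est: "\<bar>s\<^sup>2 * (1 - (ip ?I x u)\<^sup>2) - real n * (s\<^sup>2 + real m) / (s\<^sup>2 + real n)\<bar> \<le> \<epsilon> * real n" .
    have ipu: "ip ?I u ?a = \<alpha> * ip ?I x u"
      using \<alpha>\<beta> by (simp add: ip_def x_def sum_distrib_left mult.commute)
    have "(frobenius_norm (P_hat \<sigma> (Z w) a b * outer_prod a b))\<^sup>2 = \<beta>\<^sup>2 * (\<alpha>\<^sup>2 - (\<alpha> * ip ?I x u)\<^sup>2)"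
      unfolding loss_eq[OF Zw ab nm0(1)] u_def[symmetric] ipu \<alpha>2 \<beta>2 ..
    also have "\<dots> / \<sigma>\<^sup>2 = s\<^sup>2 * (1 - (ip ?I x u)\<^sup>2)"
      by (simp add: s_eq power_divide power_mult_distrib algebra_simps diff_divide_distrib)
    finally show ?thesis using est by simp
  qed
  ultimately show ?thesis
    using Bad(1) by (intro bexI[of _ "space M - Bad"]) auto
qed

lemma tail_bases:
  assumes "0 < \<delta>" "\<delta> < (1 :: real)"
  shows "sqrt (1 + \<delta>) * exp (- \<delta> / 2) < 1" "sqrt (1 - \<delta>) * exp (\<delta> / 2) < 1"
proof -
  have pos: "0 < \<delta>\<^sup>2" using assms by simp
  have "(1 + \<delta> / 2) \<le> exp (\<delta> / 2)" "1 - \<delta> / 2 \<le> exp (- \<delta> / 2)"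
    using exp_ge_add_one_self[of "\<delta> / 2"] exp_ge_add_one_self[of "- \<delta> / 2"] by simp_all
  then have "(1 + \<delta> / 2)\<^sup>2 \<le> (exp (\<delta> / 2))\<^sup>2" "(1 - \<delta> / 2)\<^sup>2 \<le> (exp (- \<delta> / 2))\<^sup>2"
    using assms by (auto intro!: power_mono)
  moreover have "1 + \<delta> < (1 + \<delta> / 2)\<^sup>2" "1 - \<delta> < (1 - \<delta> / 2)\<^sup>2"
    using pos by (simp_all add: power2_eq_square field_simps)
  ultimately have "1 + \<delta> < (exp (\<delta> / 2))\<^sup>2" "1 - \<delta> < (exp (- \<delta> / 2))\<^sup>2"
    by linarith+
  then have "sqrt (1 + \<delta>) < exp (\<delta> / 2)" "sqrt (1 - \<delta>) < exp (- \<delta> / 2)"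
    by (auto intro!: real_less_lsqrt)
  then have "sqrt (1 + \<delta>) * exp (- \<delta> / 2) < exp (\<delta> / 2) * exp (- \<delta> / 2)"
    "sqrt (1 - \<delta>) * exp (\<delta> / 2) < exp (- \<delta> / 2) * exp (\<delta> / 2)"
    by (auto intro: mult_strict_right_mono)
  then show "sqrt (1 + \<delta>) * exp (- \<delta> / 2) < 1" "sqrt (1 - \<delta>) * exp (\<delta> / 2) < 1"
    by (simp_all add: mult_exp_exp)
qed

text \<open>The delicate term is the union bound over \<open>N\<close> rows with the tail in
  \<open>m\<close>; the bounded aspect ratio turns it into a multiple of \<open>m\<close> times an
  exponentially small quantity.\<close>

lemma tail_bound_tendsto_0:
  fixes N m :: "nat \<Rightarrow> nat"
  assumes \<delta>: "0 < \<delta>" "\<delta> < 1" and N: "filterlim N at_top sequentially" and m: "filterlim m at_top sequentially"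
    and c: "\<And>j. real (N j) \<le> c * real (m j)"
  shows "(\<lambda>j. tail_bound \<delta> k (N j) (m j)) \<longlonglongrightarrow> 0"
proof -
  define p q z where "p = sqrt (1 + \<delta>) * exp (- \<delta> / 2)" and "q = sqrt (1 - \<delta>) * exp (\<delta> / 2)" and "z = sqrt (1 - \<delta>) ^ Suc k"
  have pq: "0 \<le> p" "p < 1" "0 \<le> q" "q < 1"
    using \<delta> tail_bases[OF \<delta>] by (auto simp: p_def q_def)
  have pow: "(\<lambda>j. x ^ f j) \<longlonglongrightarrow> 0" if "0 \<le> x" "x < 1" "filterlim f at_top sequentially" for x :: real and f :: "nat \<Rightarrow> nat"
    by (rule filterlim_compose[OF LIMSEQ_realpow_zero[OF that(1,2)] that(3)])
  have npow: "(\<lambda>j. real (f j) * p ^ f j) \<longlonglongrightarrow> 0" if "filterlim f at_top sequentially" for f :: "nat \<Rightarrow> nat"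
    by (rule filterlim_compose[OF powser_times_n_limit_0 that]) (use pq in simp)
  have Npm: "(\<lambda>j. real (N j) * p ^ m j) \<longlonglongrightarrow> 0"
  proof (rule real_tendsto_sandwich)
    show "\<forall>\<^sub>F j in sequentially. 0 \<le> real (N j) * p ^ m j"
      using pq by simp
    show "\<forall>\<^sub>F j in sequentially. real (N j) * p ^ m j \<le> c * (real (m j) * p ^ m j)"
      using pq c mult_right_mono[OF c] by (intro always_eventually allI) (simp add: mult.assoc[symmetric])
    show "(\<lambda>j. c * (real (m j) * p ^ m j)) \<longlonglongrightarrow> 0"
      by (rule tendsto_mult_right_zero) (rule npow[OF m])
  qed simp
  have "filterlim (\<lambda>j. sqrt (real (m j))) at_top sequentially"
    by (rule filterlim_compose[OF sqrt_at_top filterlim_compose[OF filterlim_real_sequentially m]])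
  then have "filterlim (\<lambda>j. - (\<delta> * sqrt (real (m j)))) at_bot sequentially"
    using \<delta> by (auto simp: filterlim_uminus_at_bot intro!: filterlim_tendsto_pos_mult_at_top[OF tendsto_const])
  then have "(\<lambda>j. exp (- (\<delta> * sqrt (real (m j))))) \<longlonglongrightarrow> 0"
    by (rule filterlim_compose[OF exp_at_bot])
  then have "(\<lambda>j. exp (1 / 2) * exp (- (\<delta> * sqrt (real (m j))))) \<longlonglongrightarrow> 0"
    by (rule tendsto_mult_right_zero)
  then have ex: "(\<lambda>j. exp (1 / 2 - \<delta> * sqrt (real (m j)))) \<longlonglongrightarrow> 0"
    by (simp add: mult_exp_exp)
  have "(\<lambda>j. p ^ m j + q ^ m j / z + 2 * exp (1 / 2 - \<delta> * sqrt (real (m j))) +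
      (real (N j) * p ^ m j + real (N j) * p ^ N j + real k * (q ^ m j / z + q ^ N j / z))) \<longlonglongrightarrow> 0 + 0 / z + 2 * 0 + (0 + 0 + real k * (0 / z + 0 / z))"
    using \<delta> by (intro tendsto_intros pow pq m N ex Npm npow) (auto simp: z_def)
  moreover have "tail_bound \<delta> k i j = p ^ j + q ^ j / z + 2 * exp (1 / 2 - \<delta> * sqrt (real j)) +
      (real i * p ^ j + real i * p ^ i + real k * (q ^ j / z + q ^ i / z))" for i j
    by (simp only: tail_bound_def Let_def p_def q_def z_def distrib_left[of "real i"])
  ultimately show ?thesis
    by simp
qed

section \<open>Worst-case spikes\<close>

text \<open>Some maximiser has a large first coordinate exactly if the supremum over the sphere is
  not larger than the one over the compact part \<open>C\<close> of it. Rational thresholds make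
  this a countable combination of open conditions.\<close>

lemma first_coordinate_event_sets:
  assumes Z: "std_gaussian_matrix M n m Z" and nm: "0 < n" "0 < m"
    and ab: "a \<in> carrier_vec n" "b \<in> carrier_vec m"
  shows "{w \<in> space M. t \<le> (vec_index (u_hat \<sigma> (Z w) a b) 0)\<^sup>2} \<in> sets M"
proof (cases "t \<le> 0")
  case True
  then have "{w \<in> space M. t \<le> (vec_index (u_hat \<sigma> (Z w) a b) 0)\<^sup>2} = space M"
    by (auto intro: order_trans)
  then show ?thesis by simp
next
  case False
  let ?I = "{..<n}" and ?J = "{..<m}"
  define Y where "Y A = (\<lambda>(i, j). vec_index a i * vec_index b j + \<sigma> * A (i, j))" for A :: "nat \<times> nat \<Rightarrow> real"
  define f where "f v A = nsq ?J (tm ?I (Y A) v)" for v A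
  define S where "S = {v :: nat \<Rightarrow> real. nsq ?I v = 1 \<and> (\<forall>i\<ge>n. v i = 0)}"
  define C where "C = S \<inter> {v. t \<le> (v 0)\<^sup>2}"
  \<comment> \<open>For every rational level, exceeding it on the sphere \<open>S\<close> implies
    exceeding it on \<open>C\<close>.\<close>
  define Q where "Q A \<longleftrightarrow> (\<forall>q :: rat. (\<exists>v\<in>S. real_of_rat q < f v A) \<longrightarrow> (\<exists>v\<in>C. real_of_rat q < f v A))" for A
  define X where "X w = (\<lambda>p\<in>?I \<times> ?J. Z w $$ p)" for w
  have cont: "continuous_on UNIV (\<lambda>A. f v A)" for v
    unfolding f_def tm_def Y_def by (auto intro!: continuous_intros)
  have "open {A. \<exists>v\<in>T. q < f v A}" for T q
    unfolding Bex_def by (intro open_Collect_ex open_Collect_conj open_Collect_const open_Collect_less cont continuous_intros)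
  then have Q_sets: "gauss_event (?I \<times> ?J) Q \<in> sets (gauss_space (?I \<times> ?J))"
    unfolding Q_def by (intro sets.sets_Collect_countable_All sets.sets_Collect_imp gauss_space_open_sets)
  have "(t \<le> (vec_index (u_hat \<sigma> (Z w) a b) 0)\<^sup>2) = Q (X w)" if w: "w \<in> space M" for w
  proof -
    have Zw: "Z w \<in> carrier_mat n m"
      using Z w by (auto simp: std_gaussian_matrix_def)
    let ?B = "\<lambda>p. spiked_mat \<sigma> (Z w) a b $$ p"
    have "tm ?I (Y (X w)) v j = tm ?I ?B v j" if "j \<in> ?J" for v j
      using that by (intro tm_cong) (auto simp: Y_def X_def spiked_mat_entry[OF Zw ab])
    then have fX: "f v (X w) = nsq ?J (tm ?I ?B v)" for v
      unfolding f_def by (intro nsq_cong) auto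
    have "t \<le> (vec_index (u_hat \<sigma> (Z w) a b) 0)\<^sup>2 \<longleftrightarrow> (\<exists>v. is_top n m ?B v \<and> t \<le> (v 0)\<^sup>2)"
      unfolding u_hat_def using False
      by (intro leading_left_singular_vec_first_coordinate[OF spiked_mat_carrier[OF Zw ab] nm(1)]) simp
    also have "\<dots> \<longleftrightarrow> Q (X w)"
    proof
      assume "\<exists>v. is_top n m ?B v \<and> t \<le> (v 0)\<^sup>2"
      then obtain v where v: "is_top n m ?B v" "t \<le> (v 0)\<^sup>2" by blast
      define v' where "v' i = (if i < n then v i else 0)" for i
      have "nsq ?I v' = nsq ?I v" "tm ?I ?B v' = tm ?I ?B v"
        by (auto intro!: nsq_cong tm_cong ext simp: v'_def)
      then have top: "is_top n m ?B v'"
        using v(1) by (simp add: is_top_def)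
      then have max: "f z (X w) \<le> f v' (X w)" if "z \<in> S" for z
        using that by (auto simp: S_def fX is_top_def) (metis mult_1)
      have "v' \<in> C"
        using top v(2) nm by (auto simp: C_def S_def is_top_def v'_def)
      then show "Q (X w)"
        unfolding Q_def using max by (meson less_le_trans)
    next
      assume Q: "Q (X w)"
      obtain u where u: "is_top n m ?B u" "\<forall>i\<ge>n. u i = 0"
        using ex_is_top[OF nm(1)] by blast
      have uS: "u \<in> S" using u by (simp add: S_def is_top_def)
      have "compact C"
        unfolding C_def S_def by (intro compact_Int_closed compact_sphere_fun closed_Collect_le continuous_intros)
      \<comment> \<open>A rational level below the maximum is exceeded on \<open>S\<close>, and then
        on \<open>C\<close>.\<close>
      moreover have "C \<noteq> {}"
      proof -
        obtain q where "real_of_rat q < f u (X w)"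
          using of_rat_dense[of "f u (X w) - 1" "f u (X w)"] by auto
        then show ?thesis using Q uS unfolding Q_def by blast
      qed
      moreover have "continuous_on C (\<lambda>v. f v (X w))"
        unfolding f_def by (intro continuous_intros)
      ultimately obtain v where v: "v \<in> C" "\<And>z. z \<in> C \<Longrightarrow> f z (X w) \<le> f v (X w)"
        using continuous_attains_sup[of C "\<lambda>v. f v (X w)"] by blast
      have "f u (X w) \<le> f v (X w)"
      proof (rule ccontr)
        assume "\<not> ?thesis"
        then obtain q where q: "f v (X w) < real_of_rat q" "real_of_rat q < f u (X w)"
          using of_rat_dense[of "f v (X w)" "f u (X w)"] by auto
        then obtain z where "z \<in> C" "real_of_rat q < f z (X w)"
          using Q uS unfolding Q_def by blast
        then show False using v(2)[of z] q by linarith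
      qed
      then have "is_top n m ?B v"
        using v(1) u unfolding is_top_def fX C_def S_def
        by (auto intro: order_trans[OF _ mult_left_mono])
      then show "\<exists>v. is_top n m ?B v \<and> t \<le> (v 0)\<^sup>2"
        using v(1) by (auto simp: C_def)
    qed
    finally show ?thesis .
  qed
  then have "{w \<in> space M. t \<le> (vec_index (u_hat \<sigma> (Z w) a b) 0)\<^sup>2} = {w \<in> space M. Q (X w)}"
    by auto
  then show ?thesis
    using std_gaussian_matrix_event(1)[OF Z nm Q_sets] by (simp add: X_def)
qed

text \<open>The quotient is monotone in \<open>s2\<close>: nondecreasing with limit \<open>n\<close>
  if \<open>m \<le> n\<close>, and otherwise decreasing, with value \<open>sqrt (n * m)\<close> at
  the threshold. In the latter case the claim is \<open>(g - n) * (s2 - g) \<ge> 0\<close> in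
  disguise.\<close>

lemma limit_loss_le:
  fixes n m s2 :: real
  assumes "0 < n" "0 < m" "sqrt (n * m) \<le> s2"
  shows "n * (s2 + m) / (s2 + n) \<le> max n (sqrt (n * m))"
proof (cases "m \<le> n")
  case True
  have "0 \<le> sqrt (n * m)" using assms by simp
  then have "0 < s2 + n" using assms by linarith
  moreover have "n * (s2 + m) \<le> n * (s2 + n)"
    using assms True by (intro mult_left_mono) auto
  ultimately have "n * (s2 + m) / (s2 + n) \<le> n"
    by (simp add: pos_divide_le_eq)
  then show ?thesis by simp
next
  case False
  define g where "g = sqrt (n * m)"
  have g: "g\<^sup>2 = n * m" "0 \<le> g" "g \<le> s2"
    using assms by (simp_all add: g_def)
  have "n\<^sup>2 \<le> g\<^sup>2"
    using assms False mult_left_mono[of n m n] by (simp add: g(1) power2_eq_square[of n])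
  then have ng: "n \<le> g" using g(2) by (rule power2_le_imp_le)
  have "0 \<le> (g - n) * (s2 - g)"
    using ng g by simp
  then have "n * (s2 + m) \<le> g * (s2 + n)"
    using g(1) by (simp add: power2_eq_square algebra_simps)
  moreover have "0 < s2 + n" using assms g by linarith
  ultimately have "n * (s2 + m) / (s2 + n) \<le> g"
    by (simp add: pos_divide_le_eq)
  then show ?thesis by (simp add: g_def)
qed

text \<open>For \<open>n \<ge> m\<close> the limiting loss approaches its supremum as the spike grows, for \<open>n < m\<close> as the
  spike decreases to the detection threshold.\<close>

lemma limit_loss_ge:
  fixes n m \<epsilon> :: real
  assumes nm: "0 < n" "0 < m" and \<epsilon>: "0 < \<epsilon>" "\<epsilon> < 1"
  shows "\<exists>s2>0. 1 / (1 - \<epsilon> / 2) * sqrt (n * m) \<le> s2 \<and> (1 - \<epsilon> / 2) * max n (sqrt (n * m)) \<le> n * (s2 + m) / (s2 + n)"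
proof -
  define g where "g = sqrt (n * m)"
  have g: "g\<^sup>2 = n * m" "0 < g"
    using nm by (simp_all add: g_def)
  \<comment> \<open>Strictly above the threshold, by exactly the factor that the allowance
    \<open>1 - \<epsilon> / 2\<close> cancels.\<close>
  define \<tau> where "\<tau> = 1 / (1 - \<epsilon> / 2)"
  have \<tau>: "1 < \<tau>" "\<tau> \<le> 2" "(1 - \<epsilon> / 2) * \<tau> = 1"
    using \<epsilon> by (simp_all add: \<tau>_def field_simps)
  show ?thesis
  proof (cases "m \<le> n")
    case True
    have "g\<^sup>2 \<le> n\<^sup>2"
      using nm True mult_left_mono[of m n n] by (simp add: g(1) power2_eq_square[of n])
    then have gn: "g \<le> n" by (rule power2_le_imp_le) (use nm in simp)
    \<comment> \<open>Large enough that \<open>1 - \<epsilon> / 2\<close> times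
      \<open>s2 + n\<close> stays below \<open>s2\<close>.\<close>
    define s2 where "s2 = 2 * n / \<epsilon>"
    have s2: "0 < s2" "2 * n \<le> s2" "\<epsilon> / 2 * s2 = n"
      using nm \<epsilon> by (simp_all add: s2_def field_simps)
    have "\<tau> * g \<le> 2 * n"
      using \<tau> g gn by (intro mult_mono) auto
    moreover have "(1 - \<epsilon> / 2) * n * (s2 + n) \<le> n * (s2 + m)"
    proof -
      have "(1 - \<epsilon> / 2) * (s2 + n) = s2 - \<epsilon> / 2 * n"
        using s2(3) by (simp add: algebra_simps)
      also have "\<dots> \<le> s2 + m" using nm \<epsilon> by (smt (verit) mult_pos_pos divide_pos_pos)
      finally have "n * ((1 - \<epsilon> / 2) * (s2 + n)) \<le> n * (s2 + m)"
        using nm by (intro mult_left_mono) auto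
      then show ?thesis by (simp only: mult_ac)
    qed
    ultimately show ?thesis
      using s2 nm gn by (intro exI[of _ s2]) (simp add: g_def[symmetric] \<tau>_def[symmetric] pos_le_divide_eq max_absorb1)
  next
    case False
    have "n\<^sup>2 \<le> g\<^sup>2"
      using nm False mult_left_mono[of n m n] by (simp add: g(1) power2_eq_square[of n])
    then have ng: "n \<le> g" by (rule power2_le_imp_le) (use g(2) in simp)
    have "(1 - \<epsilon> / 2) * g * (\<tau> * g + n) \<le> n * (\<tau> * g + m)"
    proof -
      have "(1 - \<epsilon> / 2) * g * (\<tau> * g + n) = ((1 - \<epsilon> / 2) * \<tau>) * g\<^sup>2 + (1 - \<epsilon> / 2) * (g * n)"
        by (simp add: power2_eq_square algebra_simps)
      also have "\<dots> \<le> g\<^sup>2 + \<tau> * (g * n)"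
        unfolding \<tau>(3) using \<tau> \<epsilon> g nm by (intro add_mono mult_right_mono) auto
      also have "\<dots> = n * (\<tau> * g + m)"
        unfolding g(1) by (simp add: algebra_simps)
      finally show ?thesis .
    qed
    then show ?thesis
      using \<tau> g nm ng
      by (intro exI[of _ "\<tau> * g"]) (simp add: g_def[symmetric] \<tau>_def[symmetric] pos_le_divide_eq add_pos_pos max_absorb2)
  qed
qed

text \<open>Monotonicity asks for measurability of the larger set only, so this applies to the
  exceedance sets of arbitrary spikes.\<close>

lemma measure_compl_le:
  assumes "prob_space M" "G \<in> sets M" "1 - e \<le> measure M G" "B \<subseteq> space M - G"
  shows "measure M B \<le> e"
proof -
  interpret prob_space M by fact
  have "measure M B \<le> measure M (space M - G)"
    using assms by (intro finite_measure_mono) auto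
  then show ?thesis using prob_compl[OF assms(2)] assms(3) by simp
qed

lemma exceed_prob_le_1: "std_gaussian_matrix M n m Z \<Longrightarrow> exceed_prob M n m \<sigma> Z q a b \<le> 1"
  unfolding exceed_prob_def by (rule prob_space.prob_le_1) (simp add: std_gaussian_matrix_def)

lemma bdd_above_exceed_prob:
  assumes "std_gaussian_matrix M n m Z"
  shows "bdd_above ((\<lambda>(a, b). exceed_prob M n m \<sigma> Z q a b) ` X)"
  by (rule bdd_aboveI2[of _ _ 1]) (auto simp: exceed_prob_le_1[OF assms])

lemma exceed_prob_le_SUP:
  assumes "std_gaussian_matrix M n m Z" "a \<in> carrier_vec n" "b \<in> carrier_vec m"
  shows "exceed_prob M n m \<sigma> Z q a b \<le> (SUP (a, b)\<in>carrier_vec n \<times> carrier_vec m. exceed_prob M n m \<sigma> Z q a b)"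
  using assms by (intro cSUP_upper2[OF bdd_above_exceed_prob, of _ _ _ _ "(a, b)"]) auto

definition loss :: "real \<Rightarrow> rmat \<Rightarrow> rvec \<Rightarrow> rvec \<Rightarrow> real" where
  "loss \<sigma> A a b = (frobenius_norm (P_hat \<sigma> A a b * outer_prod a b))\<^sup>2 / \<sigma>\<^sup>2"

section \<open>Sequences of growing dimensions\<close>

locale spiked_sequence =
  fixes N m :: "nat \<Rightarrow> nat" and c_lo c_hi :: real
    and M :: "nat \<Rightarrow> 'w measure" and Z :: "nat \<Rightarrow> 'w \<Rightarrow> rmat" and \<sigma> :: "nat \<Rightarrow> real"
  assumes lim: "filterlim (\<lambda>k. min (N k) (m k)) at_top sequentially"
    and c: "0 < c_lo" "\<And>k. c_lo \<le> real (N k) / real (m k)" "\<And>k. real (N k) / real (m k) \<le> c_hi"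
    and Z: "\<And>k. std_gaussian_matrix (M k) (N k) (m k) (Z k)" and \<sigma>: "\<And>k. \<sigma> k > 0"
begin

definition energy :: "nat \<Rightarrow> rvec \<Rightarrow> rvec \<Rightarrow> real" where
  "energy k a b = nsq {..<N k} (vec_index a) * nsq {..<m k} (vec_index b) / (\<sigma> k)\<^sup>2"

definition g :: "nat \<Rightarrow> real" where
  "g k = sqrt (real (N k) * real (m k))"

definition limit_loss :: "nat \<Rightarrow> real \<Rightarrow> real" where
  "limit_loss k E = real (N k) * (E + real (m k)) / (E + real (N k))"

abbreviation exceed :: "nat \<Rightarrow> real \<Rightarrow> rvec \<Rightarrow> rvec \<Rightarrow> real" where
  "exceed k q a b \<equiv> exceed_prob (M k) (N k) (m k) (\<sigma> k) (Z k) q a b"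

lemma pos: "0 < N k" "0 < m k" "c_lo * real (m k) \<le> real (N k)" "real (N k) \<le> c_hi * real (m k)"
  and c_hi_pos: "0 < c_hi"
proof -
  have r: "0 < real (N k) / real (m k)" for k
    using c(1) c(2)[of k] by linarith
  from r[of 0] show "0 < c_hi" using c(3)[of 0] by linarith
  from r[of k] show nm: "0 < N k" "0 < m k" by (auto simp: zero_less_divide_iff)
  then show "c_lo * real (m k) \<le> real (N k)" "real (N k) \<le> c_hi * real (m k)"
    using c(2,3)[of k] by (auto simp: pos_le_divide_eq pos_divide_le_eq)
qed

lemma prob_space_M: "prob_space (M k)"
  using Z[of k] by (simp add: std_gaussian_matrix_def)

lemma Z_carrier: "w \<in> space (M k) \<Longrightarrow> Z k w \<in> carrier_mat (N k) (m k)"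
  using Z[of k] by (auto simp: std_gaussian_matrix_def)

lemma exceed_eq: "exceed k q a b = measure (M k) {w \<in> space (M k). q * max (real (N k)) (g k) < loss (\<sigma> k) (Z k w) a b}"
  unfolding exceed_prob_def loss_def g_def using \<sigma>[of k] by (simp add: pos_less_divide_eq mult_ac)

lemma loss_concentration:
  assumes \<tau>: "1 < \<tau>" and \<epsilon>: "0 < \<epsilon>"
  obtains \<eta> where "\<eta> \<longlonglongrightarrow> 0"
    "\<forall>\<^sub>F j in sequentially. \<forall>a\<in>carrier_vec (N j). \<forall>b\<in>carrier_vec (m j). \<tau> * g j \<le> energy j a b \<longrightarrow>
      (\<exists>G\<in>sets (M j). 1 - \<eta> j \<le> measure (M j) G \<and>
        (\<forall>w\<in>G. \<bar>loss (\<sigma> j) (Z j w) a b - limit_loss j (energy j a b)\<bar> \<le> \<epsilon> * real (N j)))"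
proof -
  \<comment> \<open>The bounds on the aspect ratio compare both dimensions with their geometric
    mean, which lies below the energy.\<close>
  define C where "C = 1 + 1 / sqrt c_lo + sqrt c_hi"
  have C: "1 \<le> C" "sqrt c_hi \<le> C" "1 / sqrt c_lo \<le> C"
    using c(1) c_hi_pos by (simp_all add: C_def)
  \<comment> \<open>An energy above \<open>\<tau>\<close> times the geometric mean of the dimensions
    bounds their product by this multiple of the squared energy.\<close>
  define \<omega> where "\<omega> = 1 / \<tau>\<^sup>2"
  have \<omega>: "0 \<le> \<omega>" "\<omega> < 1"
    using \<tau> by (simp_all add: \<omega>_def one_less_power)
  obtain \<delta> k where \<delta>: "0 < \<delta>" "8 * C * \<delta> \<le> 1" and k: "0 < k"
    and err: "overlap_error C \<delta> (168 * C ^ 3 * \<delta> + 12 * C ^ 4 * \<omega> ^ (k - 1)) \<le> \<epsilon>"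
    by (rule overlap_error_small[OF C(1) \<omega> \<epsilon>])
  have \<delta>1: "\<delta> < 1"
    using \<delta> C(1) mult_right_mono[of 1 C \<delta>] by linarith
  have Nlim: "filterlim N at_top sequentially" and mlim: "filterlim m at_top sequentially"
    by (rule filterlim_at_top_mono[OF lim], simp)+
  show thesis
  proof (rule that[of "\<lambda>j. tail_bound \<delta> k (N j) (m j)"])
    show "(\<lambda>j. tail_bound \<delta> k (N j) (m j)) \<longlonglongrightarrow> 0"
      by (rule tail_bound_tendsto_0[OF \<delta>(1) \<delta>1 Nlim mlim pos(4)])
    have "\<forall>\<^sub>F j in sequentially. Suc k \<le> min (N j) (m j)"
      using lim by (simp add: filterlim_at_top)
    then show "\<forall>\<^sub>F j in sequentially. \<forall>a\<in>carrier_vec (N j). \<forall>b\<in>carrier_vec (m j). \<tau> * g j \<le> energy j a b \<longrightarrow>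
      (\<exists>G\<in>sets (M j). 1 - tail_bound \<delta> k (N j) (m j) \<le> measure (M j) G \<and>
        (\<forall>w\<in>G. \<bar>loss (\<sigma> j) (Z j w) a b - limit_loss j (energy j a b)\<bar> \<le> \<epsilon> * real (N j)))"
    proof (eventually_elim, intro ballI impI)
      fix j a b
      assume kj: "Suc k \<le> min (N j) (m j)" and ab: "a \<in> carrier_vec (N j)" "b \<in> carrier_vec (m j)"
        and large: "\<tau> * g j \<le> energy j a b"
      define n' m' h E s where "n' = real (N j)" and "m' = real (m j)" and "h = g j" and "E = energy j a b"
        and "s = sqrt (nsq {..<N j} (vec_index a) * nsq {..<m j} (vec_index b)) / \<sigma> j"
      have n'm': "0 < n'" "0 < m'" "c_lo * m' \<le> n'" "n' \<le> c_hi * m'"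
        using pos[of j] by (simp_all add: n'_def m'_def)
      have sE: "s\<^sup>2 = E"
        by (simp add: s_def E_def energy_def power_divide)
      have g: "0 < h" "h = sqrt n' * sqrt m'" "h\<^sup>2 = n' * m'"
        using n'm' by (simp_all add: h_def g_def n'_def m'_def real_sqrt_mult power_mult_distrib)
      have gE: "\<tau> * h \<le> E" using large by (simp add: h_def E_def)
      have gE': "h \<le> E" using gE mult_right_mono[of 1 \<tau> h] \<tau> g(1) by linarith
      have s: "0 < s"
      proof -
        have "0 \<le> s" using \<sigma>[of j] by (simp add: s_def)
        moreover have "s \<noteq> 0" using sE gE' g by auto
        ultimately show ?thesis by simp
      qed
      have "n' = sqrt n' * sqrt n'" using n'm' by simp
      also have "\<dots> \<le> sqrt n' * (sqrt c_hi * sqrt m')"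
        using n'm' by (intro mult_left_mono) (auto simp: real_sqrt_mult[symmetric])
      also have "\<dots> = sqrt c_hi * h" by (simp add: g)
      also have "\<dots> \<le> C * E"
        using C gE' g by (intro mult_mono) auto
      finally have nC: "n' \<le> C * E" .
      have "m' = sqrt m' * sqrt m'" using n'm' by simp
      also have "\<dots> \<le> sqrt m' * (1 / sqrt c_lo * sqrt n')"
      proof (rule mult_left_mono)
        have "sqrt c_lo * sqrt m' \<le> sqrt n'"
          using n'm' by (simp add: real_sqrt_mult[symmetric])
        then show "sqrt m' \<le> 1 / sqrt c_lo * sqrt n'"
          using c(1) by (simp add: field_simps)
      qed (use n'm' in simp)
      also have "\<dots> = 1 / sqrt c_lo * h" by (simp add: g)
      also have "\<dots> \<le> C * E"
        using C gE' g by (intro mult_mono) auto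
      finally have mC: "m' \<le> C * E" .
      have "\<tau>\<^sup>2 * (n' * m') = (\<tau> * h)\<^sup>2" by (simp add: power_mult_distrib g(3))
      also have "\<dots> \<le> E\<^sup>2" using gE \<tau> g by (intro power_mono) auto
      finally have nm\<omega>: "n' * m' \<le> \<omega> * E\<^sup>2"
        using \<tau> by (simp add: \<omega>_def field_simps)
      show "\<exists>G\<in>sets (M j). 1 - tail_bound \<delta> k (N j) (m j) \<le> measure (M j) G \<and>
        (\<forall>w\<in>G. \<bar>loss (\<sigma> j) (Z j w) a b - limit_loss j (energy j a b)\<bar> \<le> \<epsilon> * real (N j))"
        using spiked_loss_concentration[OF Z _ _ \<sigma> ab s[unfolded s_def] C(1) _ _ _ \<omega>(2,1) \<delta> k err] kj nC mC nm\<omega>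
        unfolding s_def[symmetric] sE n'_def m'_def E_def loss_def limit_loss_def by simp
    qed
  qed
qed

text \<open>The spikes are split at \<open>1 + \<epsilon>\<close> times the threshold. Below it the
  loss cannot exceed the energy; above it the limiting loss is at most the maximum, and the
  fluctuation uses up the remaining \<open>\<epsilon>\<close>.\<close>

lemma sup_exceed_tendsto_0:
  assumes \<epsilon>: "0 < \<epsilon>"
  shows "(\<lambda>k. SUP (a, b)\<in>carrier_vec (N k) \<times> carrier_vec (m k). exceed k (1 + \<epsilon>) a b) \<longlonglongrightarrow> 0"
proof -
  obtain \<eta> where \<eta>: "\<eta> \<longlonglongrightarrow> 0" and conc:
    "\<forall>\<^sub>F j in sequentially. \<forall>a\<in>carrier_vec (N j). \<forall>b\<in>carrier_vec (m j). (1 + \<epsilon>) * g j \<le> energy j a b \<longrightarrow>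
      (\<exists>G\<in>sets (M j). 1 - \<eta> j \<le> measure (M j) G \<and>
        (\<forall>w\<in>G. \<bar>loss (\<sigma> j) (Z j w) a b - limit_loss j (energy j a b)\<bar> \<le> \<epsilon> * real (N j)))"
    using loss_concentration[OF _ \<epsilon>, of "1 + \<epsilon>"] \<epsilon> by auto
  show ?thesis
  proof (rule real_tendsto_sandwich)
    show "(\<lambda>_. 0) \<longlonglongrightarrow> (0 :: real)" by simp
    \<comment> \<open>Weak spikes have exceedance probability 0, while \<open>\<eta> k\<close> is
      not known to be nonnegative.\<close>
    show "(\<lambda>k. max 0 (\<eta> k)) \<longlonglongrightarrow> 0"
      using tendsto_max[OF tendsto_const \<eta>, of 0] by simp
    have "0 \<le> (SUP (a, b)\<in>carrier_vec (N k) \<times> carrier_vec (m k). exceed k (1 + \<epsilon>) a b)" for k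
    proof -
      have "0 \<le> exceed k (1 + \<epsilon>) (0\<^sub>v (N k)) (0\<^sub>v (m k))"
        by (simp add: exceed_prob_def)
      also have "\<dots> \<le> (SUP (a, b)\<in>carrier_vec (N k) \<times> carrier_vec (m k). exceed k (1 + \<epsilon>) a b)"
        by (rule exceed_prob_le_SUP[OF Z]) auto
      finally show ?thesis .
    qed
    then show "\<forall>\<^sub>F k in sequentially. 0 \<le> (SUP (a, b)\<in>carrier_vec (N k) \<times> carrier_vec (m k). exceed k (1 + \<epsilon>) a b)"
      by (intro always_eventually allI)
    show "\<forall>\<^sub>F k in sequentially. (SUP (a, b)\<in>carrier_vec (N k) \<times> carrier_vec (m k). exceed k (1 + \<epsilon>) a b) \<le> max 0 (\<eta> k)"
      using conc
    proof eventually_elim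
      case (elim k)
      show ?case
      proof (rule cSUP_least)
        have "(0\<^sub>v (N k) :: rvec, 0\<^sub>v (m k) :: rvec) \<in> carrier_vec (N k) \<times> carrier_vec (m k)"
          by simp
        then show "carrier_vec (N k) \<times> carrier_vec (m k) \<noteq> ({} :: (rvec \<times> rvec) set)"
          by (metis empty_iff)
        fix ab :: "rvec \<times> rvec" assume "ab \<in> carrier_vec (N k) \<times> carrier_vec (m k)"
        then obtain a b where ab: "ab = (a, b)" "a \<in> carrier_vec (N k)" "b \<in> carrier_vec (m k)" by auto
        have g: "0 < g k" using pos[of k] by (simp add: g_def)
        have max: "x * y \<le> x * max y (g k)" "x * g k \<le> x * max y (g k)" if "0 < x" for x y
          using that by (auto intro!: mult_left_mono)
        have "exceed k (1 + \<epsilon>) a b \<le> max 0 (\<eta> k)"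
        proof (cases "(1 + \<epsilon>) * g k \<le> energy k a b")
          case True
          then obtain G where G: "G \<in> sets (M k)" "1 - \<eta> k \<le> measure (M k) G"
            "\<And>w. w \<in> G \<Longrightarrow> \<bar>loss (\<sigma> k) (Z k w) a b - limit_loss k (energy k a b)\<bar> \<le> \<epsilon> * real (N k)"
            using bspec[OF bspec[OF elim ab(2)] ab(3), THEN mp, OF True] by blast
          have "g k \<le> energy k a b"
            using True mult_right_mono[of 1 "1 + \<epsilon>" "g k"] g \<epsilon> by linarith
          then have "limit_loss k (energy k a b) \<le> max (real (N k)) (g k)"
            unfolding limit_loss_def g_def using pos[of k] by (intro limit_loss_le) auto
          then have "loss (\<sigma> k) (Z k w) a b \<le> (1 + \<epsilon>) * max (real (N k)) (g k)" if "w \<in> G" for w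
            using G(3)[OF that] max(1)[OF \<epsilon>, of "real (N k)"] by (simp add: abs_le_iff distrib_right)
          then have "{w \<in> space (M k). (1 + \<epsilon>) * max (real (N k)) (g k) < loss (\<sigma> k) (Z k w) a b} \<subseteq> space (M k) - G"
            by force
          then have "exceed k (1 + \<epsilon>) a b \<le> \<eta> k"
            unfolding exceed_eq by (intro measure_compl_le[OF prob_space_M G(1,2)])
          then show ?thesis by simp
        next
          case False
          have "loss (\<sigma> k) (Z k w) a b \<le> (1 + \<epsilon>) * max (real (N k)) (g k)" if w: "w \<in> space (M k)" for w
          proof -
            have "loss (\<sigma> k) (Z k w) a b \<le> nsq {..<m k} (vec_index b) * nsq {..<N k} (vec_index a) / (\<sigma> k)\<^sup>2"
              unfolding loss_def loss_eq[OF Z_carrier[OF w] ab(2,3) pos(1)] by (intro divide_right_mono mult_left_mono) auto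
            also have "\<dots> \<le> (1 + \<epsilon>) * g k" using False by (simp add: energy_def mult.commute)
            also have "\<dots> \<le> (1 + \<epsilon>) * max (real (N k)) (g k)"
              using \<epsilon> by (intro max) auto
            finally show ?thesis .
          qed
          then have empty: "{w \<in> space (M k). (1 + \<epsilon>) * max (real (N k)) (g k) < loss (\<sigma> k) (Z k w) a b} = {}"
            by force
          show ?thesis unfolding exceed_eq empty by simp
        qed
        then show "(case ab of (a, b) \<Rightarrow> exceed k (1 + \<epsilon>) a b) \<le> max 0 (\<eta> k)"
          by (simp add: ab)
      qed
    qed
  qed
qed

lemma exceed_tendsto_1:
  assumes \<epsilon>: "0 < \<epsilon>" "\<epsilon> < 1"
  obtains a b where "\<And>k. a k \<in> carrier_vec (N k)" "\<And>k. b k \<in> carrier_vec (m k)"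
    "(\<lambda>k. exceed k (1 - \<epsilon>) (a k) (b k)) \<longlonglongrightarrow> 1"
    "\<And>q k. q \<le> 1 - \<epsilon> \<Longrightarrow> exceed k (1 - \<epsilon>) (a k) (b k) \<le> exceed k q (a k) (b k)"
proof -
  define \<tau> where "\<tau> = 1 / (1 - \<epsilon> / 2)"
  have \<tau>: "1 < \<tau>" using \<epsilon> by (simp add: \<tau>_def)
  have "\<exists>s2>0. \<tau> * g k \<le> s2 \<and> (1 - \<epsilon> / 2) * max (real (N k)) (g k) \<le> limit_loss k s2" for k
    unfolding g_def \<tau>_def limit_loss_def using limit_loss_ge[of "real (N k)" "real (m k)" \<epsilon>] pos[of k] \<epsilon> by simp
  then obtain E where E: "\<And>k. 0 < E k" "\<And>k. \<tau> * g k \<le> E k"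
    "\<And>k. (1 - \<epsilon> / 2) * max (real (N k)) (g k) \<le> limit_loss k (E k)"
    by metis
  \<comment> \<open>Along the first coordinate axis the loss is \<open>E k\<close> times one minus
    the squared first coordinate of the selected vector, whose level sets are known to be
    measurable.\<close>
  define a where "a k = Matrix.vec (N k) (\<lambda>i. if i = 0 then \<sigma> k * sqrt (E k) else 0)" for k
  define b where "b k = Matrix.vec (m k) (\<lambda>i. if i = 0 then 1 else 0 :: real)" for k
  have ab: "a k \<in> carrier_vec (N k)" "b k \<in> carrier_vec (m k)" for k
    by (simp_all add: a_def b_def)
  have first: "ip {..<n} u (vec_index (Matrix.vec n (\<lambda>i. if i = 0 then x else 0))) = u 0 * x" if "0 < n" for n u and x :: real
  proof -
    have "ip {..<n} u (vec_index (Matrix.vec n (\<lambda>i. if i = 0 then x else 0))) = (\<Sum>i<n. u i * (if i = 0 then x else 0))"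
      unfolding ip_def by (intro sum.cong) auto
    then show ?thesis
      using that by (simp add: if_distrib[of "\<lambda>y. _ * y"] cong: if_cong)
  qed
  have ipa: "ip {..<N k} u (vec_index (a k)) = u 0 * (\<sigma> k * sqrt (E k))" for k u
    unfolding a_def by (rule first) (rule pos)
  have nb: "nsq {..<m k} (vec_index (b k)) = 1" for k
    unfolding nsq_eq_ip b_def first[OF pos(2)] using pos(2)[of k] by simp
  have na: "nsq {..<N k} (vec_index (a k)) = (\<sigma> k)\<^sup>2 * E k" for k
    unfolding nsq_eq_ip ipa using pos(1)[of k] E(1)[of k] by (simp add: a_def power2_eq_square)
  have energy: "energy k (a k) (b k) = E k" for k
    using \<sigma>[of k] by (simp add: energy_def na nb)
  define Q where "Q q k = {w \<in> space (M k). q * max (real (N k)) (g k) < loss (\<sigma> k) (Z k w) (a k) (b k)}" for q k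
  have exceed: "exceed k q (a k) (b k) = measure (M k) (Q q k)" for q k
    by (simp add: exceed_eq Q_def)
  have Q_sets: "Q q k \<in> sets (M k)" for q k
  proof -
    define r where "r = q * max (real (N k)) (g k)"
    have "(r < loss (\<sigma> k) (Z k w) (a k) (b k)) = (\<not> (1 - r / E k \<le> (vec_index (u_hat (\<sigma> k) (Z k w) (a k) (b k)) 0)\<^sup>2))" if w: "w \<in> space (M k)" for w
    proof -
      define u0 where "u0 = vec_index (u_hat (\<sigma> k) (Z k w) (a k) (b k)) 0"
      have "loss (\<sigma> k) (Z k w) (a k) (b k) = ((\<sigma> k)\<^sup>2 * E k - (u0 * (\<sigma> k * sqrt (E k)))\<^sup>2) / (\<sigma> k)\<^sup>2"
        unfolding loss_def loss_eq[OF Z_carrier[OF w] ab pos(1)] by (simp add: na nb ipa u0_def)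
      also have "\<dots> = E k * (1 - u0\<^sup>2)"
        using \<sigma>[of k] E(1)[of k] by (simp add: power_mult_distrib diff_divide_distrib algebra_simps)
      also have "(r < E k * (1 - u0\<^sup>2)) = (r / E k < 1 - u0\<^sup>2)"
        using E(1)[of k] by (simp add: pos_divide_less_eq mult.commute)
      finally show ?thesis
        unfolding u0_def[symmetric] by auto
    qed
    then have "Q q k = {w \<in> space (M k). \<not> (1 - r / E k \<le> (vec_index (u_hat (\<sigma> k) (Z k w) (a k) (b k)) 0)\<^sup>2)}"
      unfolding Q_def r_def[symmetric] by auto
    then show ?thesis
      by (simp only: sets.sets_Collect_neg first_coordinate_event_sets[OF Z pos(1,2) ab])
  qed
  \<comment> \<open>Monotonicity in the level rests on measurability of the larger exceedance
    event.\<close>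
  have mono: "exceed k (1 - \<epsilon>) (a k) (b k) \<le> exceed k q (a k) (b k)" if "q \<le> 1 - \<epsilon>" for q k
  proof -
    have "q * max (real (N k)) (g k) \<le> (1 - \<epsilon>) * max (real (N k)) (g k)"
      using that by (intro mult_right_mono) auto
    then have "Q (1 - \<epsilon>) k \<subseteq> Q q k" by (auto simp: Q_def)
    then show ?thesis
      unfolding exceed by (rule finite_measure.finite_measure_mono[OF prob_space.finite_measure[OF prob_space_M] _ Q_sets])
  qed
  obtain \<eta> where \<eta>: "\<eta> \<longlonglongrightarrow> 0" and conc:
    "\<forall>\<^sub>F j in sequentially. \<forall>a\<in>carrier_vec (N j). \<forall>b\<in>carrier_vec (m j). \<tau> * g j \<le> energy j a b \<longrightarrow>
      (\<exists>G\<in>sets (M j). 1 - \<eta> j \<le> measure (M j) G \<and>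
        (\<forall>w\<in>G. \<bar>loss (\<sigma> j) (Z j w) a b - limit_loss j (energy j a b)\<bar> \<le> \<epsilon> / 4 * real (N j)))"
    using loss_concentration[OF \<tau>, of "\<epsilon> / 4"] \<epsilon> by auto
  have "(\<lambda>k. exceed k (1 - \<epsilon>) (a k) (b k)) \<longlonglongrightarrow> 1"
  proof (rule real_tendsto_sandwich)
    show "(\<lambda>k. 1 - \<eta> k) \<longlonglongrightarrow> 1"
      using tendsto_diff[OF tendsto_const \<eta>, of 1] by simp
    show "\<forall>\<^sub>F k in sequentially. exceed k (1 - \<epsilon>) (a k) (b k) \<le> 1"
      using exceed_prob_le_1[OF Z] by simp
    show "\<forall>\<^sub>F k in sequentially. 1 - \<eta> k \<le> exceed k (1 - \<epsilon>) (a k) (b k)"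
      using conc
    proof eventually_elim
      case (elim k)
      obtain G where G: "G \<in> sets (M k)" "1 - \<eta> k \<le> measure (M k) G"
        "\<And>w. w \<in> G \<Longrightarrow> \<bar>loss (\<sigma> k) (Z k w) (a k) (b k) - limit_loss k (E k)\<bar> \<le> \<epsilon> / 4 * real (N k)"
        using bspec[OF bspec[OF elim ab(1)] ab(2), unfolded energy, THEN mp, OF E(2)] by blast
      have "(1 - \<epsilon>) * max (real (N k)) (g k) < loss (\<sigma> k) (Z k w) (a k) (b k)" if "w \<in> G" for w
      proof -
        define x where "x = max (real (N k)) (g k)"
        have x: "real (N k) \<le> x" "0 < x"
          using pos(1)[of k] by (auto simp: x_def less_max_iff_disj)
        have "\<epsilon> / 4 * real (N k) \<le> \<epsilon> / 4 * x"
          using \<epsilon> x by (intro mult_left_mono) auto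
        \<comment> \<open>The budget: \<open>\<epsilon> / 2\<close> for the limiting loss and
          \<open>\<epsilon> / 4\<close> for the fluctuation leave a strict margin.\<close>
        moreover have "(1 - \<epsilon>) * x < (1 - \<epsilon> / 2) * x - \<epsilon> / 4 * x"
          using \<epsilon> x by (simp add: algebra_simps)
        ultimately show ?thesis
          using G(3)[OF that] E(3)[of k] unfolding x_def[symmetric] by linarith
      qed
      then have "G \<subseteq> Q (1 - \<epsilon>) k"
        using sets.sets_into_space[OF G(1)] by (auto simp: Q_def)
      then have "measure (M k) G \<le> exceed k (1 - \<epsilon>) (a k) (b k)"
        unfolding exceed by (rule finite_measure.finite_measure_mono[OF prob_space.finite_measure[OF prob_space_M] _ Q_sets])
      then show ?case using G(2) by linarith
    qed
  qed simp
  then show thesis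
    using that ab mono by blast
qed

end

theorem corollary3p7:
  fixes N m :: "nat \<Rightarrow> nat" and c_lo c_hi :: real
    and M :: "nat \<Rightarrow> 'w measure" and Z :: "nat \<Rightarrow> 'w \<Rightarrow> rmat" and \<sigma> :: "nat \<Rightarrow> real"
  assumes "filterlim (\<lambda>k. min (N k) (m k)) at_top sequentially"
    and "0 < c_lo"
    and "\<And>k. c_lo \<le> real (N k) / real (m k)"
    and "\<And>k. real (N k) / real (m k) \<le> c_hi"
    and "\<And>k. std_gaussian_matrix (M k) (N k) (m k) (Z k)"
    and "\<And>k. \<sigma> k > 0"
  shows "(\<forall>\<epsilon>>0.
            (\<lambda>k. SUP (a, b)\<in>carrier_vec (N k) \<times> carrier_vec (m k).
                   exceed_prob (M k) (N k) (m k) (\<sigma> k) (Z k) (1 + \<epsilon>) a b) \<longlonglongrightarrow> 0)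
       \<and> (\<forall>c>0. (\<lambda>k. real (N k) / real (m k)) \<longlonglongrightarrow> c \<longrightarrow>
            (\<forall>\<epsilon>. 0 < \<epsilon> \<and> \<epsilon> < 1 \<longrightarrow>
              (\<exists>a b. (\<forall>k. a k \<in> carrier_vec (N k) \<and> b k \<in> carrier_vec (m k)) \<and>
                 (\<lambda>k. exceed_prob (M k) (N k) (m k) (\<sigma> k) (Z k) (1 - \<epsilon>) (a k) (b k))
                   \<longlonglongrightarrow> 1)))
       \<and> (\<forall>q<1. \<not> (\<lambda>k. SUP (a, b)\<in>carrier_vec (N k) \<times> carrier_vec (m k).
                   exceed_prob (M k) (N k) (m k) (\<sigma> k) (Z k) q a b) \<longlonglongrightarrow> 0)"
proof -
  interpret spiked_sequence N m c_lo c_hi M Z \<sigma>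
    by unfold_locales fact+
  show ?thesis
  proof (intro conjI allI impI notI)
    fix \<epsilon> :: real assume "0 < \<epsilon>"
    then show "(\<lambda>k. SUP (a, b)\<in>carrier_vec (N k) \<times> carrier_vec (m k). exceed k (1 + \<epsilon>) a b) \<longlonglongrightarrow> 0"
      by (rule sup_exceed_tendsto_0)
  next
    fix c \<epsilon> :: real assume "0 < \<epsilon> \<and> \<epsilon> < 1"
    then have \<epsilon>: "0 < \<epsilon>" "\<epsilon> < 1" by auto
    show "\<exists>a b. (\<forall>k. a k \<in> carrier_vec (N k) \<and> b k \<in> carrier_vec (m k)) \<and> (\<lambda>k. exceed k (1 - \<epsilon>) (a k) (b k)) \<longlonglongrightarrow> 1"
      by (rule exceed_tendsto_1[OF \<epsilon>]) blast
  next
    fix q :: real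
    assume q: "q < 1" and lim0: "(\<lambda>k. SUP (a, b)\<in>carrier_vec (N k) \<times> carrier_vec (m k). exceed k q a b) \<longlonglongrightarrow> 0"
    \<comment> \<open>The cap at \<open>1 / 2\<close> covers factors \<open>q\<close> that are zero
      or negative.\<close>
    define \<epsilon> where "\<epsilon> = min (1 - q) (1 / 2)"
    have \<epsilon>: "0 < \<epsilon>" "\<epsilon> < 1" and q\<epsilon>: "q \<le> 1 - \<epsilon>"
      using q by (auto simp: \<epsilon>_def)
    obtain a b where ab: "\<And>k. a k \<in> carrier_vec (N k)" "\<And>k. b k \<in> carrier_vec (m k)"
      and lim1: "(\<lambda>k. exceed k (1 - \<epsilon>) (a k) (b k)) \<longlonglongrightarrow> 1"
      and mono: "\<And>q k. q \<le> 1 - \<epsilon> \<Longrightarrow> exceed k (1 - \<epsilon>) (a k) (b k) \<le> exceed k q (a k) (b k)"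
      by (rule exceed_tendsto_1[OF \<epsilon>]) blast
    have "exceed k (1 - \<epsilon>) (a k) (b k) \<le> (SUP (a, b)\<in>carrier_vec (N k) \<times> carrier_vec (m k). exceed k q a b)" for k
      using mono[OF q\<epsilon>] exceed_prob_le_SUP[OF Z ab] by (rule order_trans)
    then have "(1 :: real) \<le> 0"
      by (intro LIMSEQ_le[OF lim1 lim0]) blast
    then show False by simp
  qed
qed

end
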